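(* Let $\Delta$ be a triangle with angles $\alpha_1,\alpha_2,\alpha_3$ whose normalized angles $l_j=\alpha_j/\pi$, $j=1,2,3$, are linearly independent over $\mathbb Q$. Let $\delta$ be a trajectory of the triangle tiling billiard with tiles congruent to $\Delta$ which does not pass through the circumcenters of the crossed triangles. Then: 1. $\delta$ is not drift-periodic. 2. If $\delta$ is closed, then its symbolic coding is $\overline{s^2}$ (the bi-infinite periodic repetition of $s^2=ss$) for some word $s$ of odd length in the alphabet $\{a,b,c\}$. Consequently, its period is equal to $4n+2$ for some integer $n\ge1$, and its combinatorial orbit has central symmetry. 3. If $\delta$ is not closed, it is linearly escaping, and its symbolic coding is an infinite word that can be represented as an infinite concatenation of two finite words $\omega_1$ and $\omega_2$ in the alphabet $\{a,b,c\}$, in some order corresponding to a Sturmian sequence.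
   Context: Triangle tiling billiard: the plane is tiled by triangles congruent to $\Delta$, obtained by cutting the plane by three families of equidistant parallel lines (neighbouring tiles are images of each other under the central symmetry in the midpoint of their common side). A particle moves along a straight segment inside a tile; when it hits a side, it continues in the neighbouring tile so that the oriented angle with the side changes sign but keeps its absolute value (refraction coefficient $-1$). A trajectory is a full two-sided path of this kind that does not hit vertices of the tiling. Fact: the distance between the segment of a trajectory in a crossed tile and the circumcenter of this tile is the same for all crossed tiles; hence a trajectory passes through the circumcenters of all crossed tiles or of none. A trajectory is closed (periodic) if it is a closed curve (its period is the number of sides crossed along one traversal); drift-periodic if it is invariant under a nontrivial translation of the plane; escaping if neither; linearly escaping if escaping and staying at a bounded distance from some fixed line. Let $A,B,C$ be the vertices of $\Delta$ and $a,b,c$ the sides opposite to them; all tiles are labelled accordingly. The symbolic coding of $\delta$ is the bi-infinite word $\omega=\dots w_{-1}w_0w_1\dots$ in $\{a,b,c\}$ of the labels of successively crossed sides, $w_0$ being the first side crossed on leaving a chosen positively oriented starting tile. Let $\Omega=(\Omega_j)$ be the word in $\{A,B,C\}$ obtained from $\omega$ by replacing small letters with capital ones. Viewing $A,B,C$ as the vertices of the starting tile, with the origin at its barycenter, the combinatorial orbit of $\delta$ is the piecewise linear curve connecting successively by straight segments the points $\dots,-\overrightarrow{\Omega_{-2}\Omega_{-1}},\,0,\,\overrightarrow{\Omega_0\Omega_1},\,\overrightarrow{\Omega_0\Omega_1}+\overrightarrow{\Omega_2\Omega_3},\dots,\sum_{j=0}^k\overrightarrow{\Omega_{2j}\Omega_{2j+1}},\dots$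 (its break points are barycenters of the positively oriented tiles crossed by $\delta$).
   Formalization: Central symmetry is proved as: a point reflection maps the combinatorial orbit to the curve through barycenters of negative tiles and preserves the curve through all barycenters (literally false: abcabc gives a triangle). Passing through a circumcenter refers to the line carrying the segment. *)

theory Defs
  imports "HOL-Analysis.Analysis"
begin

text \<open>
  A label names a vertex of a tile and also the side opposite to that vertex, so passing from
  a word in small letters (sides) to the word in capital letters (vertices) is the identity.
  A tile is given by its labelled vertices in the plane \<^typ>\<open>complex\<close>.
\<close>

datatype label = LA | LB | LC

fun nxt :: "label \<Rightarrow> label" where
  "nxt LA = LB"
| "nxt LB = LC"
| "nxt LC = LA"

type_synonym tile = "label \<Rightarrow> complex"

definition nondegenerate :: "tile \<Rightarrow> bool" where
  "nondegenerate P \<longleftrightarrow> \<not> collinear {P LA, P LB, P LC}"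

definition barycenter :: "tile \<Rightarrow> complex" where
  "barycenter P = (P LA + P LB + P LC) / 3"

definition circumcenter :: "tile \<Rightarrow> complex" where
  "circumcenter P = (THE z. dist z (P LA) = dist z (P LB) \<and> dist z (P LB) = dist z (P LC))"

definition tile_angle :: "tile \<Rightarrow> label \<Rightarrow> real" where
  "tile_angle P i =
     (let u = P (nxt i) - P i; v = P (nxt (nxt i)) - P i
      in arccos ((u \<bullet> v) / (norm u * norm v)))"

definition lin_indep_over_rat :: "(label \<Rightarrow> real) \<Rightarrow> bool" where
  "lin_indep_over_rat l \<longleftrightarrow>
     (\<forall>q :: label \<Rightarrow> rat.
        of_rat (q LA) * l LA + of_rat (q LB) * l LB + of_rat (q LC) * l LC = 0
        \<longrightarrow> (\<forall>i. q i = 0))"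


section \<open>The tiling\<close>

definition side_vector :: "tile \<Rightarrow> label \<Rightarrow> complex" where
  "side_vector P i = P (nxt (nxt i)) - P (nxt i)"

text \<open>The side opposite to vertex \<open>i\<close>, without its endpoints.\<close>

definition side_interior :: "tile \<Rightarrow> label \<Rightarrow> complex set" where
  "side_interior P i = open_segment (P (nxt i)) (P (nxt (nxt i)))"

text \<open>
  The image of \<open>P\<close> under the central symmetry in the midpoint of its side \<open>i\<close>, with the labels
  carried along.  The common side keeps its label; its two endpoints exchange theirs.
\<close>

definition neighbour :: "tile \<Rightarrow> label \<Rightarrow> tile" where
  "neighbour P i = (\<lambda>j. P (nxt i) + P (nxt (nxt i)) - P j)"

text \<open>
  Cutting the plane by the three families of equidistant lines parallel to the sides of \<open>D\<close>
  produces the translates of \<open>D\<close> by the lattice spanned by its side vectors and the images of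
  these translates under the symmetry in the midpoint of one of their sides.
\<close>

definition positive_tiles :: "tile \<Rightarrow> tile set" where
  "positive_tiles D =
     {P. \<exists>m n :: int. P = (\<lambda>j. D j + of_int m * (D LB - D LA) + of_int n * (D LC - D LA))}"

definition negative_tiles :: "tile \<Rightarrow> tile set" where
  "negative_tiles D = {neighbour P i |P i. P \<in> positive_tiles D}"


section \<open>Trajectories\<close>

text \<open>
  Refraction with coefficient -1.  Crossing a side with direction vector \<open>e\<close>, a velocity
  \<open>u = r * cis t * e\<close> becomes \<open>- r * cis (- t) * e\<close>: the oriented angle \<open>t\<close> between the side and
  the line of motion changes sign, and the outer minus sign makes the particle continue on the
  other side of the crossed side (the normal component of \<open>u\<close> is kept, the tangential one is
  negated).
\<close>

definition refract :: "complex \<Rightarrow> complex \<Rightarrow> complex" where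
  "refract e u = - (e * cnj (u / e))"

text \<open>
  A trajectory is given by the bi-infinite sequences of crossed tiles \<open>T\<close>, labels \<open>w\<close> of crossed
  sides and crossing points \<open>x\<close>: in \<open>T n\<close> it runs along the segment from \<open>x (n - 1)\<close> to \<open>x n\<close>,
  and leaves through side \<open>w n\<close>.  The starting tile \<open>T 0\<close> is positively oriented.
\<close>

definition trajectory ::
  "tile \<Rightarrow> (int \<Rightarrow> tile) \<Rightarrow> (int \<Rightarrow> label) \<Rightarrow> (int \<Rightarrow> complex) \<Rightarrow> bool" where
  "trajectory D T w x \<longleftrightarrow>
     T 0 \<in> positive_tiles D \<and>
     (\<forall>n. T n \<in> positive_tiles D \<union> negative_tiles D) \<and>
     (\<forall>n. T (n + 1) = neighbour (T n) (w n)) \<and>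
     (\<forall>n. x n \<in> side_interior (T n) (w n)) \<and>
     (\<forall>n. w (n + 1) \<noteq> w n) \<and>
     (\<forall>n. \<exists>r > 0. x (n + 1) - x n = r *\<^sub>R refract (side_vector (T n) (w n)) (x n - x (n - 1)))"

text \<open>
  The distance to the circumcenter that is constant along a trajectory is the distance to the
  line carrying the segment (the circumcenter of an obtuse tile lies outside the tile).
\<close>

definition avoids_circumcenters :: "(int \<Rightarrow> tile) \<Rightarrow> (int \<Rightarrow> complex) \<Rightarrow> bool" where
  "avoids_circumcenters T x \<longleftrightarrow> (\<forall>n. circumcenter (T n) \<notin> affine hull {x (n - 1), x n})"

definition polyline :: "(int \<Rightarrow> complex) \<Rightarrow> complex set" where
  "polyline x = (\<Union>n. closed_segment (x n) (x (n + 1)))"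

definition closed_trajectory :: "(int \<Rightarrow> complex) \<Rightarrow> bool" where
  "closed_trajectory x \<longleftrightarrow> (\<exists>p :: nat. p > 0 \<and> (\<forall>n. x (n + int p) = x n))"

definition period :: "(int \<Rightarrow> complex) \<Rightarrow> nat" where
  "period x = (LEAST p :: nat. p > 0 \<and> (\<forall>n. x (n + int p) = x n))"

definition drift_periodic :: "(int \<Rightarrow> complex) \<Rightarrow> bool" where
  "drift_periodic x \<longleftrightarrow> (\<exists>v. v \<noteq> 0 \<and> (\<lambda>z. z + v) ` polyline x = polyline x)"

definition escaping :: "(int \<Rightarrow> complex) \<Rightarrow> bool" where
  "escaping x \<longleftrightarrow> \<not> closed_trajectory x \<and> \<not> drift_periodic x"

definition linearly_escaping :: "(int \<Rightarrow> complex) \<Rightarrow> bool" where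
  "linearly_escaping x \<longleftrightarrow>
     escaping x \<and>
     (\<exists>L. affine L \<and> aff_dim L = 1 \<and> (\<exists>R. \<forall>z \<in> polyline x. infdist z L \<le> R))"


section \<open>Combinatorial orbits\<close>

text \<open>
  \<open>break_point P w k\<close> is the sum of the vectors from \<open>P (w (2 * j))\<close> to \<open>P (w (2 * j + 1))\<close> over
  \<open>0 \<le> j < k\<close> if \<open>k \<ge> 0\<close>, and minus the sum over \<open>k \<le> j < 0\<close> if \<open>k < 0\<close>.
\<close>

definition break_point :: "tile \<Rightarrow> (int \<Rightarrow> label) \<Rightarrow> int \<Rightarrow> complex" where
  "break_point P w k =
     (\<Sum>j \<in> {0..<k}. P (w (2 * j + 1)) - P (w (2 * j)))
     - (\<Sum>j \<in> {k..<0}. P (w (2 * j + 1)) - P (w (2 * j)))"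

definition combinatorial_orbit :: "tile \<Rightarrow> (int \<Rightarrow> label) \<Rightarrow> complex set" where
  "combinatorial_orbit P w = polyline (break_point P w)"

text \<open>
  The break points above are the barycenters of the positively oriented crossed tiles, the
  origin being the barycenter of the starting tile (lemma \<open>break_point_eq_barycenter\<close> below).
  The following curves connect, with the same origin, the barycenters of the negatively
  oriented crossed tiles and the barycenters of all crossed tiles.
\<close>

definition negative_combinatorial_orbit :: "(int \<Rightarrow> tile) \<Rightarrow> complex set" where
  "negative_combinatorial_orbit T = polyline (\<lambda>k. barycenter (T (2 * k + 1)) - barycenter (T 0))"

definition full_combinatorial_orbit :: "(int \<Rightarrow> tile) \<Rightarrow> complex set" where
  "full_combinatorial_orbit T = polyline (\<lambda>k. barycenter (T k) - barycenter (T 0))"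

definition point_reflection :: "complex \<Rightarrow> complex \<Rightarrow> complex" where
  "point_reflection c z = 2 * c - z"

text \<open>
  For a closed trajectory a point reflection cannot be expected to map the combinatorial orbit
  to itself: for a trajectory around a single vertex (coding \<open>abcabc\<close>) the orbit is a triangle.
  The symmetry exchanges positively and negatively oriented tiles, hence maps the combinatorial
  orbit to its negative counterpart and preserves the curve through all barycenters.
\<close>

definition orbit_centrally_symmetric :: "(int \<Rightarrow> tile) \<Rightarrow> (int \<Rightarrow> label) \<Rightarrow> bool" where
  "orbit_centrally_symmetric T w \<longleftrightarrow>
     (\<exists>c. point_reflection c ` combinatorial_orbit (T 0) w = negative_combinatorial_orbit T \<and>
          point_reflection c ` full_combinatorial_orbit T = full_combinatorial_orbit T)"

lemma barycenter_neighbour_neighbour: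
  "barycenter (neighbour (neighbour P i) j) = barycenter P + (P j - P i)"
  by (cases i; cases j) (auto simp: barycenter_def neighbour_def field_simps)

lemma neighbour_neighbour_diff:
  "neighbour (neighbour P i) j k - neighbour (neighbour P i) j l = P k - P l"
  by (simp add: neighbour_def)

lemma break_point_step:
  "break_point P w (k + 1) = break_point P w k + (P (w (2 * k + 1)) - P (w (2 * k)))"
proof (cases "k \<ge> 0")
  case True
  then have "{0..<k + 1} = insert k {0..<k}" by auto
  with True show ?thesis by (simp add: break_point_def)
next
  case False
  then have "{k..<0} = insert k {k + 1..<0}" by auto
  with False show ?thesis by (simp add: break_point_def)
qed

lemma break_point_eq_barycenter:
  assumes "\<And>n. T (n + 1) = neighbour (T n) (w n)"
  shows "break_point (T 0) w k = barycenter (T (2 * k)) - barycenter (T 0)"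
proof -
  have two: "T (2 * k + 2) = neighbour (neighbour (T (2 * k)) (w (2 * k))) (w (2 * k + 1))" for k
    using assms[of "2 * k + 1"] assms[of "2 * k"] by (simp add: add.assoc)
  have shift: "T (2 * (k + 1)) = T (2 * k + 2)" for k
    by (simp add: algebra_simps)
  have diff: "T (2 * k) i - T (2 * k) j = T 0 i - T 0 j" for k i j
  proof (induction k rule: int_induct[where k = 0])
    case base
    show ?case by simp
  next
    case (step1 k)
    then show ?case by (simp add: shift two neighbour_neighbour_diff)
  next
    case (step2 k)
    then show ?case using shift[of "k - 1"] two[of "k - 1"]
      by (simp add: neighbour_neighbour_diff)
  qed
  have bary: "barycenter (T (2 * (k + 1))) =
      barycenter (T (2 * k)) + (T 0 (w (2 * k + 1)) - T 0 (w (2 * k)))" for k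
    by (simp only: shift two barycenter_neighbour_neighbour diff)
  show ?thesis
  proof (induction k rule: int_induct[where k = 0])
    case base
    show ?case by (simp add: break_point_def)
  next
    case (step1 k)
    then show ?case using bary[of k] by (simp add: break_point_step)
  next
    case (step2 k)
    have "barycenter (T (2 * k)) =
        barycenter (T (2 * (k - 1))) + (T 0 (w (2 * (k - 1) + 1)) - T 0 (w (2 * (k - 1))))"
      using bary[of "k - 1"] by (simp only: diff_add_cancel)
    moreover have "break_point (T 0) w k =
        break_point (T 0) w (k - 1) + (T 0 (w (2 * (k - 1) + 1)) - T 0 (w (2 * (k - 1))))"
      using break_point_step[of "T 0" w "k - 1"] by (simp only: diff_add_cancel)
    ultimately show ?case using step2.IH by simp
  qed
qed


section \<open>Words\<close>

definition periodic_repetition :: "'a list \<Rightarrow> int \<Rightarrow> 'a" where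
  "periodic_repetition u n = u ! nat (n mod int (length u))"

text \<open>
  \<open>w\<close> is the concatenation of the bi-infinite sequence of blocks \<open>B\<close>, block \<open>B m\<close> starting at
  position \<open>pos m\<close>.  For nonempty blocks of bounded length the blocks cover all positions.
\<close>

definition is_concatenation :: "(int \<Rightarrow> 'a list) \<Rightarrow> (int \<Rightarrow> 'a) \<Rightarrow> bool" where
  "is_concatenation B w \<longleftrightarrow>
     (\<exists>pos :: int \<Rightarrow> int. \<forall>m.
        pos (m + 1) = pos m + int (length (B m)) \<and>
        (\<forall>i < length (B m). w (pos m + int i) = B m ! i))"

text \<open>
  Bi-infinite Sturmian sequences over a two-letter alphabet, as codings of irrational rotations;
  the two cases are the two conventions at the endpoints of the coding intervals.  (For
  bi-infinite words, having \<open>n + 1\<close> factors of every length \<open>n\<close> would also admit words such as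
  \<open>\<dots>0001000\<dots>\<close>.)
\<close>

definition sturmian :: "(int \<Rightarrow> bool) \<Rightarrow> bool" where
  "sturmian s \<longleftrightarrow>
     (\<exists>\<theta> \<rho> :: real. 0 < \<theta> \<and> \<theta> < 1 \<and> \<theta> \<notin> \<rat> \<and>
        ((\<forall>n. s n \<longleftrightarrow> \<lfloor>of_int (n + 1) * \<theta> + \<rho>\<rfloor> - \<lfloor>of_int n * \<theta> + \<rho>\<rfloor> = 1) \<or>
         (\<forall>n. s n \<longleftrightarrow> \<lceil>of_int (n + 1) * \<theta> + \<rho>\<rceil> - \<lceil>of_int n * \<theta> + \<rho>\<rceil> = 1)))"

end

theory Submission
  imports Defs
begin

text \<open>
  Folding the plane along the sides of the tiling puts all tiles into one circle and the trajectory
  on one chord of it.  The positions of the vertices on the circle depend affinely on the lattice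
  point, with increments twice the angles of the triangle, and the trajectory separates the vertices
  folded into the minor arc cut off by the chord from the others.  So it walks around a cluster of
  points of an interval, joined if they differ by one of three translations.  As the chord misses
  the centre, the interval is shorter than half the sum of the translation lengths.  Subtracting the
  shortest translation from the other two and from the interval gives a system of the same kind, and
  each letter of the new walk stands for an odd number of old letters.  By the bound on the interval
  the process stops: either with an isolated point (or a hole in a cluster), whose coding has period
  3 (or 1), so that the original coding has an odd period, or with a rotation by an irrational
  angle, whose coding is Sturmian.  An odd period of the coding acts on the tiles as a point
  reflection; traversed twice, it closes the trajectory.
\<close>

section \<open>Bi-infinite sequences and words\<close>

text \<open>Linear independence enters at three points: the shortest translation is unique at every
  stage, the final rotation is irrational, and parallel segments in tiles of the same orientation
  lie in the same tile, because a lattice vector turns the direction by an integer combination of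
  the angles. The last point excludes drift-periodicity.

  Parity matters because the orientation of the tiles alternates: a block of even length has the
  same displacement wherever it occurs in the concatenation, while an odd period reverses the
  orientation. So the invariant \<open>outcome\<close> offers either an odd period or a Sturmian
  concatenation of two words of even length.

  The excess \<open>a LA + a LB + a LC - 2 * \<tau>\<close> is preserved by the reduction and starts
  as four times the angle whose sine is the distance of the chord from the centre divided by the
  radius. A reduced walk may repeat a letter although a trajectory never does, hence the three
  alternatives in \<open>contour\<close>.\<close>

lemma strict_mono_int_iff:
  fixes t :: "int \<Rightarrow> int"
  assumes "\<And>n. t n < t (n + 1)"
  shows "strict_mono t"
proof (rule strict_monoI)
  fix x y :: int
  assume "x < y"
  then have "x + 1 \<le> y" by simp
  then show "t x < t y"
  proof (induction y rule: int_ge_induct)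
    case base
    show ?case using assms .
  next
    case (step i)
    then show ?case using assms[of i] by linarith
  qed
qed

lemma strict_mono_int_between:
  fixes t :: "int \<Rightarrow> int"
  assumes "strict_mono t"
  shows "\<exists>n. t n \<le> k \<and> k < t (n + 1)"
proof -
  have step: "t n + 1 \<le> t (n + 1)" for n
    using strict_monoD[OF assms, of n "n + 1"] by simp
  have up: "t 0 + n \<le> t n" if "0 \<le> n" for n
    using that
  proof (induction n rule: int_ge_induct)
    case (step i)
    then show ?case using \<open>\<And>n. t n + 1 \<le> t (n + 1)\<close>[of i] by linarith
  qed simp
  have down: "t n \<le> t 0 + n" if "n \<le> 0" for n
    using that
  proof (induction n rule: int_le_induct)
    case (step i)
    then show ?case using \<open>\<And>n. t n + 1 \<le> t (n + 1)\<close>[of "i - 1"] by simp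
  qed simp
  define n0 where "n0 = min 0 (k - t 0)"
  have n0: "t n0 \<le> k" using down[of n0] by (auto simp: n0_def)
  define P where "P d \<longleftrightarrow> k < t (n0 + int d)" for d
  have "P (nat (max 0 (k - t 0 + 1) - n0))"
    using up[of "max 0 (k - t 0 + 1)"] by (auto simp: P_def n0_def)
  then have L: "P (LEAST d. P d)" by (rule LeastI)
  have "(LEAST d. P d) \<noteq> 0" using L n0 by (metis P_def add_0_right int_ops(1) not_le)
  then obtain d where d: "(LEAST d. P d) = Suc d" by (cases "LEAST d. P d") auto
  then have "\<not> P d" using not_less_Least[of d P] by simp
  have "t (n0 + int d) \<le> k" using \<open>\<not> P d\<close> by (simp add: P_def)
  moreover have "k < t (n0 + int d + 1)" using L unfolding d by (simp add: P_def ac_simps)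
  ultimately show ?thesis by blast
qed

text \<open>Serves to pass to the times at which a coarser walk is observed: the visits to one
  letter, or the positions left over after deleting letters.\<close>

lemma int_set_enumeration:
  fixes K :: "int set"
  assumes up: "\<And>n. \<exists>k\<in>K. n \<le> k" and down: "\<And>n. \<exists>k\<in>K. k \<le> n"
  obtains t :: "int \<Rightarrow> int" where "strict_mono t" "range t = K"
proof -
  have ex_nx: "\<exists>k'\<in>K. k < k' \<and> (\<forall>l. k < l \<and> l < k' \<longrightarrow> l \<notin> K)" for k
  proof -
    define P where "P d \<longleftrightarrow> k + 1 + int d \<in> K" for d
    obtain k' where "k' \<in> K" "k + 1 \<le> k'" using up[of "k + 1"] by blast
    then have "P (nat (k' - k - 1))" by (simp add: P_def)
    then obtain d where d: "P d" "\<forall>e<d. \<not> P e" using exists_least_iff[of P] by blast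
    have "l \<notin> K" if "k < l" "l < k + 1 + int d" for l
    proof -
      have "nat (l - k - 1) < d" using that by linarith
      then have "\<not> P (nat (l - k - 1))" using d(2) by blast
      then show ?thesis using that by (simp add: P_def)
    qed
    then show ?thesis using d(1) unfolding P_def by (intro bexI[of _ "k + 1 + int d"]) auto
  qed
  have ex_pv: "\<exists>k'\<in>K. k' < k \<and> (\<forall>l. k' < l \<and> l < k \<longrightarrow> l \<notin> K)" for k
  proof -
    define P where "P d \<longleftrightarrow> k - 1 - int d \<in> K" for d
    obtain k' where "k' \<in> K" "k' \<le> k - 1" using down[of "k - 1"] by blast
    then have "P (nat (k - 1 - k'))" by (simp add: P_def)
    then obtain d where d: "P d" "\<forall>e<d. \<not> P e" using exists_least_iff[of P] by blast
    have "l \<notin> K" if "l < k" "k - 1 - int d < l" for l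
    proof -
      have "nat (k - 1 - l) < d" using that by linarith
      then have "\<not> P (nat (k - 1 - l))" using d(2) by blast
      then show ?thesis using that by (simp add: P_def)
    qed
    then show ?thesis using d(1) unfolding P_def by (intro bexI[of _ "k - 1 - int d"]) auto
  qed
  have "\<forall>k. \<exists>k'. k' \<in> K \<and> k < k' \<and> (\<forall>l. k < l \<and> l < k' \<longrightarrow> l \<notin> K)"
    using ex_nx unfolding Bex_def by (rule allI)
  from choice[OF this] obtain nx where nx: "nx k \<in> K" "k < nx k"
    "k < l \<Longrightarrow> l < nx k \<Longrightarrow> l \<notin> K" for k l
    by auto
  have "\<forall>k. \<exists>k'. k' \<in> K \<and> k' < k \<and> (\<forall>l. k' < l \<and> l < k \<longrightarrow> l \<notin> K)"
    using ex_pv unfolding Bex_def by (rule allI)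
  from choice[OF this] obtain pv where pv: "pv k \<in> K" "pv k < k"
    "pv k < l \<Longrightarrow> l < k \<Longrightarrow> l \<notin> K" for k l
    by auto
  have nx_pv: "nx (pv k) = k" if "k \<in> K" for k
  proof (rule antisym)
    show "nx (pv k) \<le> k" using nx(3)[of "pv k" k] pv(2)[of k] that by linarith
    show "k \<le> nx (pv k)" using pv(3)[of k "nx (pv k)"] nx(1,2)[of "pv k"] by linarith
  qed
  obtain k0 where k0: "k0 \<in> K" using up[of 0] by blast
  define t where "t n = (if n \<ge> 0 then (nx ^^ nat n) k0 else (pv ^^ nat (- n)) k0)" for n :: int
  have inK: "t n \<in> K" for n
  proof (cases "n \<ge> 0")
    case True
    then show ?thesis using k0 nx(1) by (cases "nat n") (auto simp: t_def)
  next
    case False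
    then show ?thesis using k0 pv(1) by (cases "nat (- n)") (auto simp: t_def)
  qed
  have t_Suc: "t (n + 1) = nx (t n)" for n
  proof (cases "n \<ge> 0")
    case True
    then show ?thesis by (simp add: t_def nat_add_distrib)
  next
    case False
    then have "nat (- n) = Suc (nat (- (n + 1)))" by simp
    then have "t n = pv (t (n + 1))" using False by (auto simp: t_def)
    then show ?thesis using nx_pv inK by metis
  qed
  have sm: "strict_mono t" by (rule strict_mono_int_iff) (simp add: t_Suc nx)
  have "k \<in> range t" if "k \<in> K" for k
  proof -
    obtain n where n: "t n \<le> k" "k < t (n + 1)" using strict_mono_int_between[OF sm] by blast
    then have "t n = k" using nx(3)[of "t n" k] that unfolding t_Suc by linarith
    then show ?thesis by auto
  qed
  then have "range t = K" using inK by auto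
  with sm that show ?thesis by blast
qed

lemma enumeration_next:
  fixes t :: "int \<Rightarrow> int"
  assumes "strict_mono t" "range t = K" "t n < l" "l \<in> K" "\<And>i. t n < i \<Longrightarrow> i < l \<Longrightarrow> i \<notin> K"
  shows "t (n + 1) = l"
proof -
  obtain n' where n': "l = t n'" using assms by auto
  then have "n < n'" using assms(1,3) by (simp add: strict_mono_less)
  then have "t (n + 1) \<le> l" using assms(1) n' by (simp add: strict_mono_less_eq)
  moreover have "t n < t (n + 1)" using assms(1) by (simp add: strict_mono_less)
  moreover have "t (n + 1) \<in> K" using assms(2) by auto
  ultimately show ?thesis using assms(5)[of "t (n + 1)"] by linarith
qed

section \<open>Rational independence and the subtraction of lengths\<close>

definition rat_indep :: "(label \<Rightarrow> real) \<Rightarrow> bool" where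
  "rat_indep a \<longleftrightarrow> (\<forall>k :: label \<Rightarrow> int.
     of_int (k LA) * a LA + of_int (k LB) * a LB + of_int (k LC) * a LC = 0 \<longrightarrow> (\<forall>i. k i = 0))"

text \<open>For \<open>m\<close> the shortest length this is one step of the fully subtractive
  continued fraction algorithm in three variables.\<close>

definition reduce :: "label \<Rightarrow> (label \<Rightarrow> real) \<Rightarrow> label \<Rightarrow> real" where
  "reduce m a i = (if i = m then a i else a i - a m)"

lemma rat_indep_reduce:
  assumes "rat_indep a"
  shows "rat_indep (reduce m a)"
  unfolding rat_indep_def
proof (intro allI impI)
  fix k :: "label \<Rightarrow> int" and i
  assume k: "of_int (k LA) * reduce m a LA + of_int (k LB) * reduce m a LB
      + of_int (k LC) * reduce m a LC = 0"
  \<comment> \<open>Collecting the coefficients of \<open>a m\<close> in the given relation leaves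
    \<open>k m\<close> minus the two other coefficients.\<close>
  define k' where "k' = k(m := 2 * k m - k LA - k LB - k LC)"
  have eq: "of_int (k' LA) * a LA + of_int (k' LB) * a LB + of_int (k' LC) * a LC = 0"
    using k by (cases m) (simp_all add: reduce_def k'_def algebra_simps)
  then have z: "k' j = 0" for j using assms unfolding rat_indep_def by blast
  show "k i = 0"
    using z[of LA] z[of LB] z[of LC] by (cases m; cases i) (auto simp: k'_def)
qed

lemma rat_indep_neq:
  assumes "rat_indep a" "i \<noteq> j"
  shows "a i \<noteq> a j"
proof
  assume eq: "a i = a j"
  define k where "k = (\<lambda>l. if l = i then 1 else if l = j then - 1 else (0::int))"
  have "of_int (k LA) * a LA + of_int (k LB) * a LB + of_int (k LC) * a LC = 0"
    using eq assms(2) by (cases i; cases j) (auto simp: k_def)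
  then have "k i = 0" using assms(1) unfolding rat_indep_def by blast
  then show False by (simp add: k_def)
qed

lemma rat_indep_ratio:
  assumes "rat_indep a" "i \<noteq> j" "a i > 0" "a j > 0"
  shows "a i / (a j + a i) \<notin> \<rat>"
proof
  assume "a i / (a j + a i) \<in> \<rat>"
  then obtain p q :: int where pq: "q > 0" "a i / (a j + a i) = of_int p / of_int q"
    by (elim Rats_cases') auto
  then have eq: "of_int q * a i = of_int p * (a j + a i)"
    using assms by (auto simp: field_simps)
  define k where "k = (\<lambda>l. if l = i then q - p else if l = j then - p else (0::int))"
  have "of_int (k LA) * a LA + of_int (k LB) * a LB + of_int (k LC) * a LC = 0"
    using eq assms(2) by (cases i; cases j) (auto simp: k_def algebra_simps)
  then have "k i = 0" "k j = 0" using assms(1) unfolding rat_indep_def by blast+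
  then show False using assms(2) pq by (auto simp: k_def split: if_splits)
qed

text \<open>
  A translation length subtracted infinitely often tends to 0, so not all three are, since the
  excess over \<open>2 * \<tau>\<close> is constant.  If \<open>z\<close> is eventually not subtracted, then \<open>a x + a y - \<tau>\<close> is
  eventually a positive constant for the other two labels, although its limit is not positive.
\<close>

lemma reduction_terminates:
  fixes a :: "nat \<Rightarrow> label \<Rightarrow> real" and \<tau> :: "nat \<Rightarrow> real" and m :: "nat \<Rightarrow> label"
  assumes a_Suc: "\<And>n. a (Suc n) = reduce (m n) (a n)"
    and t_Suc: "\<And>n. \<tau> (Suc n) = \<tau> n - a n (m n)"
    and t_pos: "\<And>n. \<tau> n > 0"
    and a_pos: "\<And>n i. a n i > 0"
    and pair: "\<And>n i j. i \<noteq> j \<Longrightarrow> a n i + a n j > \<tau> n"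
    and deficit: "a 0 LA + a 0 LB + a 0 LC > 2 * \<tau> 0"
  shows False
proof -
  have dec: "decseq (\<lambda>n. a n i)" for i
    by (rule decseq_SucI) (use a_pos in \<open>auto simp: a_Suc reduce_def less_imp_le\<close>)
  have "\<exists>L. (\<lambda>n. a n i) \<longlonglongrightarrow> L" for i
    by (rule decseq_convergent[OF dec[of i], of 0]) (use a_pos less_imp_le in blast)+
  then have "\<forall>i. \<exists>L. (\<lambda>n. a n i) \<longlonglongrightarrow> L" by (rule allI)
  from choice[OF this] obtain L where L: "(\<lambda>n. a n i) \<longlonglongrightarrow> L i" for i by auto
  have "decseq \<tau>" by (rule decseq_SucI) (use a_pos in \<open>auto simp: t_Suc less_imp_le\<close>)
  then obtain T where T: "\<tau> \<longlonglongrightarrow> T"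
    by (rule decseq_convergent[of _ 0]) (use t_pos less_imp_le in blast)+
  have T0: "T \<ge> 0" by (rule LIMSEQ_le_const[OF T]) (use t_pos less_imp_le in blast)
  have "(\<lambda>n. \<tau> n - \<tau> (Suc n)) \<longlonglongrightarrow> T - T" by (intro tendsto_diff T LIMSEQ_Suc)
  then have min0: "(\<lambda>n. a n (m n)) \<longlonglongrightarrow> 0" by (simp add: t_Suc)
  have inf0: "L i = 0" if io: "\<exists>\<^sub>\<infinity>n. m n = i" for i
  proof (rule ccontr)
    assume "L i \<noteq> 0"
    moreover have "L i \<ge> 0" by (rule LIMSEQ_le_const[OF L]) (use a_pos less_imp_le in blast)
    ultimately have pos: "L i > 0" by simp
    have "eventually (\<lambda>n. a n (m n) < L i) sequentially"
      using min0 pos by (rule order_tendstoD)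
    then obtain M where M: "\<And>n. n \<ge> M \<Longrightarrow> a n (m n) < L i" by (auto simp: eventually_sequentially)
    obtain n where "n \<ge> M" "m n = i" using io unfolding INFM_nat_le by blast
    then have n: "a n (m n) < L i" "m n = i" using M by auto
    moreover have "L i \<le> a n i" using decseq_ge[OF dec L] .
    ultimately show False by simp
  qed
  have const: "a n LA + a n LB + a n LC - 2 * \<tau> n = a 0 LA + a 0 LB + a 0 LC - 2 * \<tau> 0" for n
  proof (induction n)
    case (Suc n)
    then show ?case by (cases "m n") (auto simp: a_Suc t_Suc reduce_def)
  qed simp
  have "(\<lambda>n. a n LA + a n LB + a n LC - 2 * \<tau> n) \<longlonglongrightarrow> L LA + L LB + L LC - 2 * T"
    by (intro tendsto_intros L T)
  moreover have "(\<lambda>n. a n LA + a n LB + a n LC - 2 * \<tau> n)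
      \<longlonglongrightarrow> a 0 LA + a 0 LB + a 0 LC - 2 * \<tau> 0"
    by (rule tendsto_eventually) (rule always_eventually, rule allI, rule const)
  ultimately have lim: "L LA + L LB + L LC - 2 * T = a 0 LA + a 0 LB + a 0 LC - 2 * \<tau> 0"
    by (rule LIMSEQ_unique)
  have "\<exists>z. \<not> (\<exists>\<^sub>\<infinity>n. m n = z)"
  proof (rule ccontr)
    assume "\<not> ?thesis"
    then have "\<exists>\<^sub>\<infinity>n. m n = i" for i by simp
    then have "L i = 0" for i by (rule inf0)
    then show False using lim deficit T0 by simp
  qed
  then obtain z N where z: "\<And>n. n \<ge> N \<Longrightarrow> m n \<noteq> z"
    by (auto simp: not_INFM MOST_nat_le)
  obtain x y where xy: "x \<noteq> y" "x \<noteq> z" "y \<noteq> z" "\<And>l. l = x \<or> l = y \<or> l = z"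
  proof (cases z)
    case LA show ?thesis by (rule that[of LB LC]) (use LA label.exhaust in auto)
  next
    case LB show ?thesis by (rule that[of LA LC]) (use LB label.exhaust in auto)
  next
    case LC show ?thesis by (rule that[of LA LB]) (use LC label.exhaust in auto)
  qed
  have kconst: "a n x + a n y - \<tau> n = a N x + a N y - \<tau> N" if "n \<ge> N" for n
    using that
  proof (induction n rule: dec_induct)
    case (step n)
    have "m n = x \<or> m n = y" using z[of n] xy(4)[of "m n"] step by auto
    then show ?case using step xy by (auto simp: a_Suc t_Suc reduce_def)
  qed simp
  have "(\<lambda>n. a n x + a n y - \<tau> n) \<longlonglongrightarrow> L x + L y - T" by (intro tendsto_intros L T)
  moreover have "(\<lambda>n. a n x + a n y - \<tau> n) \<longlonglongrightarrow> a N x + a N y - \<tau> N"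
    by (rule tendsto_eventually) (unfold eventually_sequentially, use kconst in blast)
  ultimately have klim: "L x + L y - T = a N x + a N y - \<tau> N" by (rule LIMSEQ_unique)
  \<comment> \<open>If \<open>v\<close> too were eventually not subtracted, only \<open>u\<close>
    would be; \<open>reduce\<close> does not change the subtracted length itself, so the subtracted
    lengths would end in a positive constant.\<close>
  have only: False if fin: "\<not> (\<exists>\<^sub>\<infinity>n. m n = v)" and uv: "\<And>l. l = u \<or> l = v \<or> l = z" "u \<noteq> v" for u v
  proof -
    obtain M where M: "\<And>n. n \<ge> M \<Longrightarrow> m n \<noteq> v" using fin by (auto simp: not_INFM MOST_nat_le)
    have mu: "m n = u" if "n \<ge> max M N" for n
      using M[of n] z[of n] uv(1)[of "m n"] that by auto
    have au: "a n u = a (max M N) u" if "n \<ge> max M N" for n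
      using that
    proof (induction n rule: dec_induct)
      case (step n)
      then show ?case using mu[of n] by (auto simp: a_Suc reduce_def)
    qed simp
    have "a n (m n) = a (max M N) u" if "n \<ge> max M N" for n
      unfolding mu[OF that] by (rule au[OF that])
    then have "eventually (\<lambda>n. a n (m n) = a (max M N) u) sequentially"
      unfolding eventually_sequentially by blast
    then have "(\<lambda>n. a n (m n)) \<longlonglongrightarrow> a (max M N) u" by (rule tendsto_eventually)
    then have "a (max M N) u = 0" using min0 by (rule LIMSEQ_unique)
    then show False using a_pos[of "max M N" u] by simp
  qed
  have "\<exists>\<^sub>\<infinity>n. m n = x" by (rule ccontr) (rule only[of x y]; use xy in auto)
  moreover have "\<exists>\<^sub>\<infinity>n. m n = y" by (rule ccontr) (rule only[of y x]; use xy in auto)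
  ultimately have "L x = 0" "L y = 0" by (simp_all add: inf0)
  then show False using klim T0 pair[of x y N] xy(1) by auto
qed

section \<open>Concatenations and substitutions of words\<close>

definition concat_at :: "(int \<Rightarrow> 'a list) \<Rightarrow> (int \<Rightarrow> int) \<Rightarrow> (int \<Rightarrow> 'a) \<Rightarrow> bool" where
  "concat_at B pos w \<longleftrightarrow> (\<forall>m. pos (m + 1) = pos m + int (length (B m)) \<and>
     (\<forall>i < length (B m). w (pos m + int i) = B m ! i))"

lemma concat_atD:
  assumes "concat_at B pos w"
  shows "pos (m + 1) = pos m + int (length (B m))"
    and "i < length (B m) \<Longrightarrow> w (pos m + int i) = B m ! i"
  using assms by (auto simp: concat_at_def)

lemma concat_at_strict_mono:
  assumes "concat_at B pos w" "\<And>m. B m \<noteq> []"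
  shows "strict_mono pos"
  by (rule strict_mono_int_iff) (use assms concat_atD(1) in force)

lemma concat_at_cover:
  assumes "concat_at B pos w" "\<And>m. B m \<noteq> []"
  obtains m i where "n = pos m + int i" "i < length (B m)"
proof -
  obtain m where m: "pos m \<le> n" "n < pos (m + 1)"
    using strict_mono_int_between[OF concat_at_strict_mono[OF assms]] by blast
  then show ?thesis
    using that[of m "nat (n - pos m)"] concat_atD(1)[OF assms(1), of m] by auto
qed

text \<open>The new period is a sum of \<open>N\<close> odd block lengths and hence odd. A block may
  depend on the following letter, but that letter recurs with the same period.\<close>

lemma concat_at_odd_periodic:
  assumes conc: "concat_at (\<lambda>n. \<beta> (v n) (v (n + 1))) p w"
    and odd_len: "\<And>x y. odd (length (\<beta> x y))"
    and per: "\<And>n. v (n + int N) = v n" and "odd N"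
  shows "\<exists>M :: nat. odd M \<and> (\<forall>n. w (n + int M) = w n)"
proof -
  have ne: "\<beta> x y \<noteq> []" for x y using odd_len[of x y] by auto
  have p_Suc: "p (n + 1) = p n + int (length (\<beta> (v n) (v (n + 1))))" for n
    using concat_atD(1)[OF conc] .
  have per1: "v (n + int N + 1) = v (n + 1)" for n
    using per[of "n + 1"] by (simp add: ac_simps)
  have shift: "p (n + int N) - p n = p (int N) - p 0" for n
  proof (induction n rule: int_induct[where k = 0])
    case (step1 i)
    then show ?case using p_Suc[of i] p_Suc[of "i + int N"] per[of i] per1[of i]
      by (simp add: ac_simps)
  next
    case (step2 i)
    then show ?case using p_Suc[of "i - 1"] p_Suc[of "i - 1 + int N"] per[of "i - 1"] per1[of "i - 1"]
      by (simp add: algebra_simps)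
  qed simp
  have parity: "odd (p (int n) - p 0) \<longleftrightarrow> odd n" for n
  proof (induction n)
    case (Suc n)
    have "p (int (Suc n)) - p 0 = p (int n) - p 0 + int (length (\<beta> (v (int n)) (v (int n + 1))))"
      using p_Suc[of "int n"] by (simp add: ac_simps)
    then show ?case
      using Suc odd_len by (simp only: even_add even_of_nat even_Suc) blast
  qed simp
  have sm: "strict_mono p" by (rule concat_at_strict_mono[OF conc]) (rule ne)
  define M where "M = nat (p (int N) - p 0)"
  have "p 0 < p (int N)" using strict_monoD[OF sm, of 0 "int N"] \<open>odd N\<close> by (cases N) auto
  then have M: "int M = p (int N) - p 0" by (simp add: M_def)
  have "odd (int M)" using parity[of N] \<open>odd N\<close> M by simp
  then have "odd M" by simp
  moreover have "w (n + int M) = w n" for n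
  proof -
    obtain m i where mi: "n = p m + int i" "i < length (\<beta> (v m) (v (m + 1)))"
      by (rule concat_at_cover[OF conc]) (rule ne)
    have eq: "n + int M = p (m + int N) + int i" using mi(1) M shift[of m] by simp
    have "w (n + int M) = \<beta> (v m) (v (m + 1)) ! i"
      unfolding eq using concat_atD(2)[OF conc, of i "m + int N"] mi(2) per[of m] per1[of m] by simp
    then show ?thesis using concat_atD(2)[OF conc, of i m] mi by simp
  qed
  ultimately show ?thesis by blast
qed

text \<open>Since a block depends on the following letter, the image of a finite word is fixed only
  once the letter \<open>y\<close> read after the word is known.\<close>

fun expand :: "('a \<Rightarrow> 'a \<Rightarrow> 'a list) \<Rightarrow> 'a \<Rightarrow> 'a list \<Rightarrow> 'a list" where
  "expand \<beta> y [] = []"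
| "expand \<beta> y (x # xs) = \<beta> x (hd (xs @ [y])) @ expand \<beta> y xs"

lemma expand_factor:
  assumes conc: "concat_at (\<lambda>n. \<beta> (v n) (v (n + 1))) p w"
    and "\<forall>i < length xs. v (q + int i) = xs ! i" "v (q + int (length xs)) = y"
  shows "p (q + int (length xs)) = p q + int (length (expand \<beta> y xs)) \<and>
    (\<forall>i < length (expand \<beta> y xs). w (p q + int i) = expand \<beta> y xs ! i)"
  using assms(2,3)
proof (induction xs arbitrary: q)
  case (Cons x xs)
  have vq: "v q = x" using Cons.prems(1)[rule_format, of 0] by simp
  have nx: "\<forall>i < length xs. v (q + 1 + int i) = xs ! i"
  proof (intro allI impI)
    fix i assume "i < length xs"
    then show "v (q + 1 + int i) = xs ! i"
      using Cons.prems(1)[rule_format, of "Suc i"] by (simp add: ac_simps)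
  qed
  have y: "v (q + 1 + int (length xs)) = y" using Cons.prems(2) by (simp add: ac_simps)
  note IH = Cons.IH[OF nx y]
  have vq1: "v (q + 1) = hd (xs @ [y])" using nx y by (cases xs) force+
  note c = concat_atD(1)[OF conc, of q, unfolded vq vq1]
  have "w (p q + int i) = expand \<beta> y (x # xs) ! i" if i: "i < length (expand \<beta> y (x # xs))" for i
  proof (cases "i < length (\<beta> x (hd (xs @ [y])))")
    case True
    then show ?thesis using concat_atD(2)[OF conc, of i q] vq vq1 by (simp add: nth_append)
  next
    case False
    define d where "d = i - length (\<beta> x (hd (xs @ [y])))"
    have d: "d < length (expand \<beta> y xs)" "int i = int (length (\<beta> x (hd (xs @ [y])))) + int d"
      using False i by (auto simp: d_def)
    have "w (p q + int i) = w (p (q + 1) + int d)" using c d(2) by (simp add: ac_simps)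
    also have "\<dots> = expand \<beta> y xs ! d" using IH d(1) by blast
    finally show ?thesis using False by (simp add: nth_append d_def)
  qed
  moreover have "p (q + int (length (x # xs))) = p q + int (length (expand \<beta> y (x # xs)))"
    using IH c by (simp add: ac_simps)
  ultimately show ?case by blast
qed simp

text \<open>The letter after block \<open>m\<close> is the first letter of block
  \<open>m + 1\<close>. All blocks begin with \<open>y\<close>, so the image of a block does not
  depend on its successor, and two blocks again give two blocks.\<close>

lemma concat_at_expand:
  assumes conc: "concat_at (\<lambda>n. \<beta> (v n) (v (n + 1))) p w"
    and B: "concat_at B pos v" "\<And>m. B m \<noteq> []" "\<And>m. hd (B m) = y"
  shows "concat_at (\<lambda>m. expand \<beta> y (B m)) (\<lambda>m. p (pos m)) w"
  unfolding concat_at_def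
proof
  fix m
  have "v (pos (m + 1) + int 0) = y"
    using concat_atD(2)[OF B(1), of 0 "m + 1"] B(2,3)[of "m + 1"] by (simp add: hd_conv_nth)
  then have "v (pos m + int (length (B m))) = y" using concat_atD(1)[OF B(1), of m] by simp
  from expand_factor[OF conc _ this] concat_atD[OF B(1), where m = m]
  show "p (pos (m + 1)) = p (pos m) + int (length (expand \<beta> y (B m))) \<and>
      (\<forall>i < length (expand \<beta> y (B m)). w (p (pos m) + int i) = expand \<beta> y (B m) ! i)"
    by simp
qed

lemma even_length_expand:
  assumes "\<And>x y. odd (length (\<beta> x y))"
  shows "even (length (expand \<beta> y xs)) \<longleftrightarrow> even (length xs)"
  using assms by (induction xs) auto

lemma expand_Nil_iff:
  assumes "\<And>x y. \<beta> x y \<noteq> []"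
  shows "expand \<beta> y xs = [] \<longleftrightarrow> xs = []"
  using assms by (cases xs) auto

lemma hd_expand:
  assumes "\<And>x y. \<beta> x y \<noteq> []" "\<And>x y. hd (\<beta> x y) = x" "xs \<noteq> []"
  shows "hd (expand \<beta> y xs) = hd xs"
  using assms by (cases xs) auto

text \<open>The first letter of the image reveals the first letter of the word, and the length of a
  block depends on its letter alone, so the first blocks can be cut off on both sides. This keeps
  the two Sturmian blocks distinct.\<close>

lemma expand_inject:
  assumes ne: "\<And>x y. \<beta> x y \<noteq> []" and hd: "\<And>x y. hd (\<beta> x y) = x"
    and len: "\<And>x y z. length (\<beta> x y) = length (\<beta> x z)"
  shows "expand \<beta> y xs = expand \<beta> y ys \<Longrightarrow> xs = ys"
proof (induction xs arbitrary: ys)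
  case Nil
  then show ?case using expand_Nil_iff[of \<beta>, OF ne] by (metis expand.simps(1))
next
  case (Cons x xs)
  then have "ys \<noteq> []" using ne by auto
  then obtain z zs where ys: "ys = z # zs" by (cases ys) auto
  have "hd (expand \<beta> y (x # xs)) = x" "hd (expand \<beta> y (z # zs)) = z"
    using ne hd by simp_all
  then have "x = z" using Cons.prems ys by simp
  then show ?case using Cons ys len by auto
qed

text \<open>The invariant pulled back through all reductions. The common first letter lets the
  blocks be substituted independently. Along the block starts, which all carry that letter,
  positions before and after a substitution differ by a constant, so injectivity of \<open>Y\<close>
  survives; in the end it shows that the trajectory is not closed.\<close>

definition outcome :: "(int \<Rightarrow> real) \<Rightarrow> (int \<Rightarrow> label) \<Rightarrow> bool" where
  "outcome Y w \<longleftrightarrow>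
     (\<exists>N :: nat. odd N \<and> (\<forall>n. w (n + int N) = w n)) \<or>
     (\<exists>\<sigma> \<omega>1 \<omega>2 pos. sturmian \<sigma> \<and> even (length \<omega>1) \<and> even (length \<omega>2) \<and>
        \<omega>1 \<noteq> [] \<and> \<omega>2 \<noteq> [] \<and> \<omega>1 \<noteq> \<omega>2 \<and> hd \<omega>1 = hd \<omega>2 \<and>
        concat_at (\<lambda>m. if \<sigma> m then \<omega>2 else \<omega>1) pos w \<and> inj (\<lambda>m. Y (pos m)))"

lemma outcome_expand:
  assumes conc: "concat_at (\<lambda>n. \<beta> (v n) (v (n + 1))) p w"
    and odd_len: "\<And>x y. odd (length (\<beta> x y))"
    and hd: "\<And>x y. hd (\<beta> x y) = x"
    and len: "\<And>x y z. length (\<beta> x y) = length (\<beta> x z)"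
    and shift: "\<And>n. Y (p n) = Z n + s (v n)"
    and out: "outcome Z v"
  shows "outcome Y w"
proof -
  have ne: "\<beta> x y \<noteq> []" for x y using odd_len[of x y] by auto
  from out consider
    (per) N :: nat where "odd N" "\<forall>n. v (n + int N) = v n" |
    (st) \<sigma> \<omega>1 \<omega>2 pos where "sturmian \<sigma>" "even (length \<omega>1)" "even (length \<omega>2)"
        "\<omega>1 \<noteq> []" "\<omega>2 \<noteq> []" "\<omega>1 \<noteq> \<omega>2" "hd \<omega>1 = hd \<omega>2"
        "concat_at (\<lambda>m. if \<sigma> m then \<omega>2 else \<omega>1) pos v" "inj (\<lambda>m. Z (pos m))"
    unfolding outcome_def by metis
  then show ?thesis
  proof cases
    case per
    then have "\<exists>M :: nat. odd M \<and> (\<forall>n. w (n + int M) = w n)"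
      using concat_at_odd_periodic[of \<beta>, OF conc odd_len] by blast
    then show ?thesis unfolding outcome_def by blast
  next
    case st
    define y where "y = hd \<omega>1"
    define B where "B m = (if \<sigma> m then \<omega>2 else \<omega>1)" for m
    have B: "concat_at B pos v" "B m \<noteq> []" "hd (B m) = y" for m
      using st unfolding B_def y_def by auto
    have "(\<lambda>m. expand \<beta> y (B m)) = (\<lambda>m. if \<sigma> m then expand \<beta> y \<omega>2 else expand \<beta> y \<omega>1)"
      by (auto simp: B_def)
    then have c: "concat_at (\<lambda>m. if \<sigma> m then expand \<beta> y \<omega>2 else expand \<beta> y \<omega>1) (\<lambda>m. p (pos m)) w"
      using concat_at_expand[OF conc B] by simp
    have "v (pos m) = y" for m
      using concat_atD(2)[OF B(1), of 0 m] B(2,3)[of m] by (simp add: hd_conv_nth)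
    then have "inj (\<lambda>m. Y (p (pos m)))" using st(9) by (simp add: shift inj_def)
    moreover have "expand \<beta> y \<omega>1 \<noteq> expand \<beta> y \<omega>2"
      using expand_inject[of \<beta>, OF ne hd len] st(6) by blast
    moreover have "hd (expand \<beta> y \<omega>1) = hd (expand \<beta> y \<omega>2)"
      using st(4,5,7) by (simp add: hd_expand[of \<beta>, OF ne hd])
    moreover have "expand \<beta> y \<omega>1 \<noteq> []" "expand \<beta> y \<omega>2 \<noteq> []"
      using st(4,5) by (simp_all add: expand_Nil_iff[of \<beta>, OF ne])
    moreover have "even (length (expand \<beta> y \<omega>1))" "even (length (expand \<beta> y \<omega>2))"
      using st(2,3) by (simp_all add: even_length_expand[of \<beta>, OF odd_len])
    ultimately show ?thesis using st(1) c unfolding outcome_def by blast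
  qed
qed

section \<open>Contours of systems of translations\<close>

text \<open>A cyclic order of the labels. Both orders occur, depending on the orientation of
  \<open>D\<close> and on which hand of the path the cut-off vertices lie.\<close>

locale label_rotation =
  fixes f :: "label \<Rightarrow> label"
  assumes f3 [simp]: "f (f (f i)) = i" and f_neq [simp]: "f i \<noteq> i"
begin

lemma f_eq_iff [simp]: "f i = f j \<longleftrightarrow> i = j"
  by (metis f3)

lemma f_neq' [simp]: "i \<noteq> f i" "f (f i) \<noteq> i" "i \<noteq> f (f i)"
  by (metis f3 f_neq)+

lemma label_cases:
  obtains "x = m" | "x = f m" | "x = f (f m)"
proof -
  have "x = m \<or> x = f m \<or> x = f (f m)"
    using f_neq[of m] f_neq'(2)[of m] f_neq[of "f m"]
    by (cases x; cases m; cases "f m"; cases "f (f m)") simp_all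
  then show ?thesis using that by blast
qed

lemma sum_labels: "g LA + g LB + g LC = g m + g (f m) + (g (f (f m)) :: real)"
  using f_neq[of m] f_neq'(2)[of m] f_neq[of "f m"]
  by (cases m; cases "f m"; cases "f (f m)") simp_all

text \<open>
  \<open>contour a \<tau> Y w\<close>: the walk around a cluster of points of the interval \<open>(0, \<tau>)\<close> that are joined
  by translations of lengths \<open>a i\<close>.  The letter \<open>i\<close> is emitted when the translation \<open>i\<close> leads
  out of the interval; \<open>Y n\<close> is the position after the emission of \<open>w n\<close>, measured from
  alternating ends of the interval.
\<close>

definition contour :: "(label \<Rightarrow> real) \<Rightarrow> real \<Rightarrow> (int \<Rightarrow> real) \<Rightarrow> (int \<Rightarrow> label) \<Rightarrow> bool" where
  "contour a \<tau> Y w \<longleftrightarrow> (\<forall>n. 0 < Y n \<and> Y n < \<tau> \<and>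
     (let i = f (w n); k = f i in
       (Y n + a i > \<tau> \<and> w (n + 1) = i \<and> Y (n + 1) = \<tau> - Y n) \<or>
       (Y n + a i < \<tau> \<and> Y n + a i + a k > \<tau> \<and> w (n + 1) = k \<and> Y (n + 1) = \<tau> - Y n - a i) \<or>
       (Y n + a i + a k < \<tau> \<and> w (n + 1) = w n \<and> Y (n + 1) = \<tau> - Y n - a i - a k)))"

lemma contourD:
  assumes "contour a \<tau> Y w"
  shows "0 < Y n" "Y n < \<tau>"
    "(Y n + a (f (w n)) > \<tau> \<and> w (n + 1) = f (w n) \<and> Y (n + 1) = \<tau> - Y n) \<or>
     (Y n + a (f (w n)) < \<tau> \<and> Y n + a (f (w n)) + a (f (f (w n))) > \<tau> \<and>
        w (n + 1) = f (f (w n)) \<and> Y (n + 1) = \<tau> - Y n - a (f (w n))) \<or>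
     (Y n + a (f (w n)) + a (f (f (w n))) < \<tau> \<and> w (n + 1) = w n \<and>
        Y (n + 1) = \<tau> - Y n - a (f (w n)) - a (f (f (w n))))"
  using assms unfolding contour_def Let_def by blast+

text \<open>No translation, in either direction, keeps such a point inside the open interval. So
  each move takes the first alternative and the letters rotate by \<open>f\<close>; the band is
  symmetric under reflection of the interval and hence never left.\<close>

lemma isolated_periodic:
  assumes C: "contour a \<tau> Y w" and min: "\<And>i. a m \<le> a i" and pos: "\<And>i. a i > 0"
    and iso: "\<tau> - a m \<le> Y n0" "Y n0 \<le> a m"
  shows "outcome Y w"
proof -
  have all: "\<tau> - a m \<le> Y n \<and> Y n \<le> a m" for n
  proof (induction n rule: int_induct[where k = n0])
    case base
    then show ?case using iso by simp
  next
    case (step1 i)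
    then show ?case
      using contourD[OF C, of i] min[of "f (w i)"] pos[of "f (f (w i))"] by linarith
  next
    case (step2 i)
    then show ?case
      using contourD[OF C, of "i - 1"] min[of "f (w (i - 1))"] min[of "f (f (w (i - 1)))"]
        pos[of "f (w (i - 1))"] pos[of "f (f (w (i - 1)))"]
      by (simp only: diff_add_cancel) linarith
  qed
  have step: "w (n + 1) = f (w n)" for n
    using contourD[OF C, of n] all[of n] min[of "f (w n)"] pos[of "f (f (w n))"] by linarith
  have "w (n + int 3) = w n" for n
  proof -
    have "w (n + 1 + 1 + 1) = w n" unfolding step by simp
    then show ?thesis by (simp add: add.assoc)
  qed
  then show ?thesis unfolding outcome_def by (metis odd_numeral)
qed

end

text \<open>The map exchanges two intervals of lengths \<open>p\<close> and \<open>q\<close>, which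
  is the rotation by \<open>q\<close> modulo \<open>p + q\<close>.\<close>

lemma rotation_sturmian:
  fixes G :: "int \<Rightarrow> real"
  assumes pos: "p > 0" "q > 0" and irr: "q / (p + q) \<notin> \<rat>"
    and G: "\<And>m. 0 < G m" "\<And>m. G m < p + q"
    and step: "\<And>m. (G m < p \<and> G (m + 1) = G m + q) \<or> (G m > p \<and> G (m + 1) = G m - p)"
  shows "sturmian (\<lambda>m. G m > p)" "inj G"
proof -
  define \<theta> where "\<theta> = q / (p + q)"
  define \<rho> where "\<rho> = G 0 / (p + q)"
  \<comment> \<open>The number of full turns made up to time \<open>m\<close>. It grows by 1 exactly
    when the walk wraps around, and as \<open>G m / (p + q)\<close> lies between 0 and 1, it is the
    floor in the Sturmian formula.\<close>
  define e where "e m = of_int m * \<theta> + \<rho> - G m / (p + q)" for m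
  have e_Suc: "e (m + 1) = e m + (if G m > p then 1 else 0)" for m
  proof -
    have "p / (p + q) = 1 - \<theta>" using pos by (simp add: \<theta>_def field_simps)
    then show ?thesis
      using step[of m]
      by (auto simp: e_def add_divide_distrib diff_divide_distrib distrib_right simp flip: \<theta>_def)
  qed
  have "e m \<in> \<int>" for m
  proof (induction m rule: int_induct[where k = 0])
    case base
    show ?case by (simp add: e_def \<rho>_def)
  next
    case (step1 i)
    then show ?case by (simp add: e_Suc)
  next
    case (step2 i)
    have "e (i - 1) = e i - (if G (i - 1) > p then 1 else 0)" using e_Suc[of "i - 1"] by simp
    then show ?case using step2 by simp
  qed
  then have e_floor: "e m = of_int \<lfloor>of_int m * \<theta> + \<rho>\<rfloor>" for m
  proof -
    obtain E where E: "e m = of_int E" using \<open>\<And>m. e m \<in> \<int>\<close>[of m] by (auto elim: Ints_cases)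
    have "0 < G m / (p + q)" "G m / (p + q) < 1" using G[of m] pos by auto
    then have "\<lfloor>of_int m * \<theta> + \<rho>\<rfloor> = E" using E by (intro floor_unique) (auto simp: e_def)
    then show ?thesis using E by simp
  qed
  have "G m > p \<longleftrightarrow> \<lfloor>of_int (m + 1) * \<theta> + \<rho>\<rfloor> - \<lfloor>of_int m * \<theta> + \<rho>\<rfloor> = 1" for m
  proof -
    have "real_of_int (\<lfloor>of_int (m + 1) * \<theta> + \<rho>\<rfloor> - \<lfloor>of_int m * \<theta> + \<rho>\<rfloor>) = (if G m > p then 1 else 0)"
      using e_Suc[of m] unfolding e_floor by simp
    then show ?thesis unfolding of_int_eq_1_iff[where ?'a = real, symmetric] by simp
  qed
  moreover have "0 < \<theta>" "\<theta> < 1" "\<theta> \<notin> \<rat>" using pos irr by (auto simp: \<theta>_def)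
  ultimately show "sturmian (\<lambda>m. G m > p)" unfolding sturmian_def by blast
  show "inj G"
  proof (rule injI, rule ccontr)
    fix m n assume eq: "G m = G n" and "m \<noteq> n"
    have "of_int (m - n) * \<theta> = e m - e n" by (simp add: e_def eq algebra_simps)
    then have "\<theta> = (e m - e n) / of_int (m - n)" using \<open>m \<noteq> n\<close> by (simp add: field_simps)
    also have "\<dots> \<in> \<rat>" unfolding e_floor by simp
    finally show False using \<open>\<theta> \<notin> \<rat>\<close> by simp
  qed
qed

context label_rotation
begin

text \<open>As the third length exceeds \<tau>, only the translations \<open>i\<close> and
  \<open>l\<close> act. Either the walk at some \<open>z\<close> has room for both in a row; then it
  emits \<open>z\<close> forever, going around a hole. Or the returns to \<open>z\<close> form an
  exchange of two intervals of lengths \<open>a i\<close> and \<open>a l\<close>.\<close>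

lemma two_band_outcome:
  assumes C: "contour a \<tau> Y w" and pos: "\<And>i. a i > 0" and indep: "rat_indep a"
    and two: "a i + a (f i) \<le> \<tau>" and big: "a (f (f i)) > \<tau>"
  shows "outcome Y w"
proof -
  define l where "l = f i"
  define z where "z = f l"
  have fz: "f i = l" "f l = z" "f z = i" by (simp_all add: l_def z_def)
  have dist: "i \<noteq> l" "l \<noteq> z" "i \<noteq> z" by (simp_all add: l_def z_def)
  have two': "a i + a l \<le> \<tau>" and big': "a z > \<tau>" using two big by (simp_all add: l_def z_def)
  note Y = contourD(1,2)[OF C]
  have at_l: "w (n + 1) = z \<and> Y (n + 1) = \<tau> - Y n" if "w n = l" for n
    using contourD(3)[OF C, of n] Y[of n] big' pos[of i] that fz by simp
  have at_i: "(Y n + a l > \<tau> \<and> w (n + 1) = l \<and> Y (n + 1) = \<tau> - Y n) \<or>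
      (Y n + a l < \<tau> \<and> w (n + 1) = z \<and> Y (n + 1) = \<tau> - Y n - a l)" if "w n = i" for n
    using contourD(3)[OF C, of n] Y[of n] big' pos[of l] that fz by auto
  have at_z: "(Y n + a i > \<tau> \<and> w (n + 1) = i \<and> Y (n + 1) = \<tau> - Y n) \<or>
      (Y n + a i < \<tau> \<and> Y n + a i + a l > \<tau> \<and> w (n + 1) = l \<and> Y (n + 1) = \<tau> - Y n - a i) \<or>
      (Y n + a i + a l < \<tau> \<and> w (n + 1) = z \<and> Y (n + 1) = \<tau> - Y n - a i - a l)" if "w n = z" for n
    using contourD(3)[OF C, of n] that fz by simp
  have cases: "w n = i \<or> w n = l \<or> w n = z" for n
    using label_cases[of "w n" i] fz by metis
  show ?thesis
  proof (cases "\<exists>n0. w n0 = z \<and> \<tau> - Y n0 > a i + a l")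
    case True
    then obtain n0 where n0: "w n0 = z" "\<tau> - Y n0 > a i + a l" by blast
    have "w n = z \<and> \<tau> - Y n > a i + a l" for n
    proof (induction n rule: int_induct[where k = n0])
      case base
      then show ?case using n0 by simp
    next
      case (step1 n)
      then show ?case using at_z[of n] Y[of n] pos[of l] by force
    next
      case (step2 n)
      \<comment> \<open>Going backwards takes two predecessors: a predecessor with letter
        \<open>i\<close> or \<open>l\<close> would have a position that its own predecessor cannot
        produce.\<close>
      define n1 where "n1 = n - 1"
      define n2 where "n2 = n1 - 1"
      have n: "n = n1 + 1" "n1 = n2 + 1" by (simp_all add: n1_def n2_def)
      have IH: "w (n1 + 1) = z" "\<tau> - Y (n1 + 1) > a i + a l" using step2 n(1) by auto
      consider "w n1 = i" | "w n1 = l" | "w n1 = z" using cases by blast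
      then have "w n1 = z \<and> \<tau> - Y n1 > a i + a l"
      proof cases
        case 1
        then have "Y n1 > a i" using at_i[of n1] IH dist by auto
        moreover have "w (n2 + 1) = i" using 1 n by simp
        ultimately show ?thesis
          using cases[of n2] at_l[of n2] at_i[of n2] at_z[of n2] dist Y[of n2] n(2) by auto
      next
        case 2
        then have "Y n1 > a i + a l" using at_l[of n1] IH by auto
        moreover have "w (n2 + 1) = l" using 2 n by simp
        ultimately show ?thesis
          using cases[of n2] at_l[of n2] at_i[of n2] at_z[of n2] dist Y[of n2] pos[of i] n(2) by auto
      next
        case 3
        then show ?thesis using at_z[of n1] IH dist by auto
      qed
      then show ?case by (simp add: n1_def)
    qed
    then have "\<forall>n. w (n + int 1) = w n" by simp
    then show ?thesis unfolding outcome_def using odd_one by blast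
  next
    case False
    define K where "K = {n. w n = z}"
    have ex: "\<exists>k\<in>K. n \<le> k \<and> k \<le> n + 2" for n
    proof -
      have "w n = z \<or> w (n + 1) = z \<or> w (n + 1 + 1) = z"
        using cases[of n] at_l[of n] at_i[of n] at_l[of "n + 1"] by auto
      then show ?thesis unfolding K_def by (auto simp: add.assoc intro: exI[of _ n])
    qed
    have "\<exists>k\<in>K. n \<le> k" "\<exists>k\<in>K. k \<le> n" for n using ex[of n] ex[of "n - 2"] by auto
    then obtain t :: "int \<Rightarrow> int" where t: "strict_mono t" "range t = K" by (rule int_set_enumeration)
    define G where "G m = \<tau> - Y (t m)" for m
    have wt: "w (t m) = z" for m using t(2) unfolding K_def by blast
    have step: "t (m + 1) = t m + 2 \<and>
        ((G m < a i \<and> G (m + 1) = G m + a l \<and> w (t m + 1) = i) \<or>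
         (G m > a i \<and> G (m + 1) = G m - a i \<and> w (t m + 1) = l))" for m
    proof -
      have notC: "\<not> Y (t m) + a i + a l < \<tau>" using False wt[of m] by auto
      have two_step: "t m + 2 = t m + 1 + 1" by simp
      consider "Y (t m) + a i > \<tau>" "w (t m + 1) = i" "Y (t m + 1) = \<tau> - Y (t m)"
        | "Y (t m) + a i < \<tau>" "w (t m + 1) = l" "Y (t m + 1) = \<tau> - Y (t m) - a i"
        using at_z[OF wt[of m]] notC by blast
      then show ?thesis
      proof cases
        case 1
        \<comment> \<open>Here \<open>Y (t m + 1) = G m < a i\<close>, so \<open>two'\<close> leaves
          room for the translation \<open>l\<close>.\<close>
        then have 2: "w (t m + 2) = z" "Y (t m + 2) = \<tau> - Y (t m + 1) - a l"
          using at_i[of "t m + 1"] two' unfolding two_step by auto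
        have "t (m + 1) = t m + 2"
        proof (rule enumeration_next[OF t])
          fix j assume "t m < j" "j < t m + 2"
          then have "j = t m + 1" by simp
          then show "j \<notin> K" using 1 dist by (simp add: K_def)
        qed (use 2 in \<open>auto simp: K_def\<close>)
        then show ?thesis using 1 2 by (auto simp: G_def)
      next
        case c2: 2
        then have 2: "w (t m + 2) = z" "Y (t m + 2) = \<tau> - Y (t m + 1)"
          using at_l[of "t m + 1"] unfolding two_step by auto
        have "t (m + 1) = t m + 2"
        proof (rule enumeration_next[OF t])
          fix j assume "t m < j" "j < t m + 2"
          then have "j = t m + 1" by simp
          then show "j \<notin> K" using c2 dist by (simp add: K_def)
        qed (use 2 in \<open>auto simp: K_def\<close>)
        then show ?thesis using c2 2 by (auto simp: G_def)
      qed
    qed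
    have Gr: "0 < G m" "G m < a i + a l" for m
    proof -
      show "0 < G m" using Y[of "t m"] by (simp add: G_def)
      show "G m < a i + a l" using at_z[OF wt[of m]] False wt[of m] pos[of l] unfolding G_def by force
    qed
    have irr: "a l / (a i + a l) \<notin> \<rat>"
      using rat_indep_ratio[OF indep, of l i] dist pos by auto
    note rot = rotation_sturmian[of "a i" "a l" G, OF pos pos irr Gr]
    have st: "sturmian (\<lambda>m. G m > a i)" and inj: "inj G" using rot step by blast+
    have conc: "concat_at (\<lambda>m. if G m > a i then [z, l] else [z, i]) t w"
      unfolding concat_at_def
    proof (intro allI conjI impI)
      fix m
      show "t (m + 1) = t m + int (length (if G m > a i then [z, l] else [z, i]))"
        using step[of m] by simp
      fix j assume "j < length (if G m > a i then [z, l] else [z, i])"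
      then have "j = 0 \<or> j = 1" by (auto split: if_splits)
      then show "w (t m + int j) = (if G m > a i then [z, l] else [z, i]) ! j"
        using wt[of m] step[of m] by auto
    qed
    have "inj (\<lambda>m. Y (t m))" using inj by (simp add: inj_def G_def)
    then show ?thesis
      unfolding outcome_def using st conc dist
      by (intro disjI2 exI[of _ "\<lambda>m. G m > a i"] exI[of _ "[z, i]"] exI[of _ "[z, l]"] exI[of _ t])
        auto
  qed
qed

text \<open>
  Collapsing the translation \<open>m\<close> turns a contour into a contour of the reduced system.  In the
  words this deletes the two letters following each \<open>m\<close>; the next letter decides their order.
\<close>

definition insertion :: "label \<Rightarrow> label \<Rightarrow> label \<Rightarrow> label list" where
  "insertion m x y =
     (if x = m then if y = f m then [m, f m, f (f m)] else [m, f (f m), f m] else [x])"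

text \<open>By \<open>noniso\<close> each visited point has an \<open>m\<close>-neighbour. Such
  pairs are collapsed to their lower ends, which range over an interval of length
  \<open>\<tau> - a m\<close>. By \<open>pair\<close> no two different translations fit in a row, so
  the third alternative of \<open>contour\<close> is absent before the reduction.\<close>

lemma contour_reduce:
  assumes C: "contour a \<tau> Y w" and pos: "\<And>i. a i > 0"
    and min: "\<And>i. i \<noteq> m \<Longrightarrow> a m < a i"
    and pair: "\<And>i j. i \<noteq> j \<Longrightarrow> a i + a j > \<tau>"
    and noniso: "\<And>n. Y n < \<tau> - a m \<or> a m < Y n"
  obtains Z v where "contour (reduce m a) (\<tau> - a m) Z v" "outcome Z v \<Longrightarrow> outcome Y w"
proof -
  define j where "j = f m"
  define k where "k = f j"
  have fs: "f m = j" "f j = k" "f k = m" by (simp_all add: j_def k_def)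
  have dist: "m \<noteq> j" "j \<noteq> k" "m \<noteq> k" "j \<noteq> m" "k \<noteq> j" "k \<noteq> m" by (simp_all add: j_def k_def)
  have mj: "a m < a j" and mk: "a m < a k" using min dist by blast+
  have pmj: "a m + a j > \<tau>" and pmk: "a m + a k > \<tau>" and pjk: "a j + a k > \<tau>"
    using pair dist by blast+
  note Y = contourD(1,2)[OF C]
  have cases: "w n = m \<or> w n = j \<or> w n = k" for n
    using label_cases[of "w n" m] fs by metis
  have at_k: "(Y n + a m > \<tau> \<and> w (n + 1) = m \<and> Y (n + 1) = \<tau> - Y n) \<or>
      (Y n + a m < \<tau> \<and> w (n + 1) = j \<and> Y (n + 1) = \<tau> - Y n - a m)" if "w n = k" for n
    using contourD(3)[OF C, of n] Y[of n] pmj that fs by auto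
  have at_j: "(Y n + a k > \<tau> \<and> w (n + 1) = k \<and> Y (n + 1) = \<tau> - Y n) \<or>
      (Y n + a k < \<tau> \<and> w (n + 1) = m \<and> Y (n + 1) = \<tau> - Y n - a k)" if "w n = j" for n
    using contourD(3)[OF C, of n] Y[of n] pmk that fs by auto
  have at_m: "(Y n + a j > \<tau> \<and> w (n + 1) = j \<and> Y (n + 1) = \<tau> - Y n) \<or>
      (Y n + a j < \<tau> \<and> w (n + 1) = k \<and> Y (n + 1) = \<tau> - Y n - a j)" if "w n = m" for n
    using contourD(3)[OF C, of n] Y[of n] pjk that fs by auto
  \<comment> \<open>If \<open>m\<close> follows \<open>k\<close>, then \<open>Y n < a m\<close> and
    \<open>noniso\<close> decides; if it follows \<open>j\<close>, the translation \<open>k\<close>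
    just used is longer than \<open>m\<close>.\<close>
  have m_range: "Y n < \<tau> - a m" if "w n = m" for n
  proof -
    define n1 where "n1 = n - 1"
    have n: "n = n1 + 1" by (simp add: n1_def)
    show ?thesis
      using that cases[of n1] at_k[of n1] at_j[of n1] at_m[of n1] Y[of n1] dist mk noniso[of n]
      unfolding n by auto
  qed
  have m_next: "(Y n + a j > \<tau> \<and> w (n + 1) = j \<and> w (n + 2) = k \<and> w (n + 3) = j \<and>
        Y (n + 3) = \<tau> - a m - Y n) \<or>
      (Y n + a j < \<tau> \<and> w (n + 1) = k \<and> w (n + 2) = j \<and>
        ((Y n + a j - a m + a k > \<tau> \<and> w (n + 3) = k \<and> Y (n + 3) = \<tau> - Y n - a j + a m) \<or>
         (Y n + a j - a m + a k < \<tau> \<and> w (n + 3) = m \<and>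
            Y (n + 3) = \<tau> - Y n - a j + a m - a k)))" if m: "w n = m" for n
  proof -
    have n: "n + 2 = n + 1 + 1" "n + 3 = n + 1 + 1 + 1" by simp_all
    note r = m_range[OF m]
    show ?thesis
      using at_m[OF m]
    proof
      assume A: "Y n + a j > \<tau> \<and> w (n + 1) = j \<and> Y (n + 1) = \<tau> - Y n"
      then have B: "w (n + 1 + 1) = k" "Y (n + 1 + 1) = Y n"
        using at_j[of "n + 1"] r pmk by auto
      then have "w (n + 1 + 1 + 1) = j" "Y (n + 1 + 1 + 1) = \<tau> - Y n - a m"
        using at_k[of "n + 1 + 1"] r by auto
      then show ?thesis unfolding n using A B by auto
    next
      assume A: "Y n + a j < \<tau> \<and> w (n + 1) = k \<and> Y (n + 1) = \<tau> - Y n - a j"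
      then have B: "w (n + 1 + 1) = j" "Y (n + 1 + 1) = Y n + a j - a m"
        using at_k[of "n + 1"] Y(1)[of n] mj by auto
      then show ?thesis
        unfolding n using A at_j[of "n + 1 + 1"] by auto
    qed
  qed
  \<comment> \<open>Drops the two letters after each \<open>m\<close>; neither of them is an
    \<open>m\<close> itself, so the dropped pairs do not overlap.\<close>
  define K where "K = {n. w (n - 1) \<noteq> m \<and> w (n - 2) \<noteq> m}"
  have after_m: "w (n + 1) \<noteq> m" "w (n + 2) \<noteq> m" if "w n = m" for n
    using m_next[OF that] dist by auto
  have ex: "\<exists>k\<in>K. n \<le> k \<and> k \<le> n + 2" for n
  proof (cases "w (n - 1) = m")
    case True
    then have "n + 2 \<in> K" using after_m[of "n - 1"] by (simp add: K_def)
    then show ?thesis by (intro bexI[of _ "n + 2"]) auto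
  next
    case F: False
    show ?thesis
    proof (cases "w (n - 2) = m")
      case True
      then have "n + 1 \<in> K" using after_m[of "n - 2"] F by (simp add: K_def)
      then show ?thesis by (intro bexI[of _ "n + 1"]) auto
    next
      case False
      then have "n \<in> K" using F by (simp add: K_def)
      then show ?thesis by (intro bexI[of _ n]) auto
    qed
  qed
  have "\<exists>k\<in>K. n \<le> k" "\<exists>k\<in>K. k \<le> n" for n using ex[of n] ex[of "n - 2"] by auto
  then obtain t :: "int \<Rightarrow> int" where t: "strict_mono t" "range t = K" by (rule int_set_enumeration)
  have tK: "w (t n - 1) \<noteq> m" "w (t n - 2) \<noteq> m" for n using t(2) unfolding K_def by blast+
  have t_m: "t (n + 1) = t n + 3" if "w (t n) = m" for n
  proof (rule enumeration_next[OF t])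
    show "t n + 3 \<in> K" using after_m[OF that] by (simp add: K_def add.commute)
    fix i assume "t n < i" "i < t n + 3"
    then have "i = t n + 1 \<or> i = t n + 2" by auto
    then show "i \<notin> K" using that by (auto simp: K_def)
  qed simp
  have t_nm: "t (n + 1) = t n + 1" if "w (t n) \<noteq> m" for n
  proof (rule enumeration_next[OF t])
    show "t n + 1 \<in> K" using that tK[of n] by (simp add: K_def)
  qed auto
  have k_range: "Y (t n) > a m" if "w (t n) = k" for n
  proof -
    define n1 where "n1 = t n - 1"
    define n2 where "n2 = n1 - 1"
    have n: "t n = n1 + 1" "n1 = n2 + 1" by (simp_all add: n1_def n2_def)
    have "w n1 \<noteq> m" "w n2 \<noteq> m" using tK[of n] by (simp_all add: n1_def n2_def)
    moreover have "w (n1 + 1) = k" using that n by simp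
    ultimately have j1: "w n1 = j" "Y (t n) = \<tau> - Y n1"
      using cases[of n1] at_k[of n1] at_j[of n1] dist n(1) by auto
    then have "w (n2 + 1) = j" using n(2) by simp
    then have "Y n1 = \<tau> - Y n2 - a m"
      using \<open>w n2 \<noteq> m\<close> cases[of n2] at_k[of n2] at_j[of n2] dist n(2) by auto
    then show ?thesis using j1 Y[of n2] by simp
  qed
  have j_range: "Y (t n) < \<tau> - a m" if "w (t n) = j" for n
  proof -
    define n1 where "n1 = t n - 1"
    have n: "t n = n1 + 1" by (simp add: n1_def)
    have "w n1 \<noteq> m" using tK[of n] by (simp add: n1_def)
    moreover have "w (n1 + 1) = j" using that n by simp
    ultimately have "Y (t n) = \<tau> - Y n1 - a m"
      using cases[of n1] at_k[of n1] at_j[of n1] dist n(1) by auto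
    then show ?thesis using Y[of n1] by simp
  qed
  define v where "v n = w (t n)" for n
  \<comment> \<open>After \<open>m\<close> and \<open>j\<close> the position is the lower end of its
    \<open>m\<close>-pair, after a retained \<open>k\<close> the upper end by
    \<open>k_range\<close>; a pair is recorded by its lower end.\<close>
  define s where "s x = (if x = k then a m else 0)" for x
  define Z where "Z n = Y (t n) - s (v n)" for n
  have R: "reduce m a m = a m" "reduce m a j = a j - a m" "reduce m a k = a k - a m"
    using dist by (simp_all add: reduce_def)
  have "contour (reduce m a) (\<tau> - a m) Z v"
    unfolding contour_def Let_def
  proof (intro allI conjI)
    fix n
    consider "v n = m" | "v n = j" | "v n = k" using cases[of "t n"] v_def by metis
    note vcases = this
    then show "0 < Z n"
      by cases (use Y(1)[of "t n"] k_range[of n] dist in \<open>auto simp: Z_def s_def v_def\<close>)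
    from vcases show "Z n < \<tau> - a m"
      by cases (use Y(2)[of "t n"] m_range[of "t n"] j_range[of n] dist in \<open>auto simp: Z_def s_def v_def\<close>)
    from vcases show "(Z n + reduce m a (f (v n)) > \<tau> - a m \<and> v (n + 1) = f (v n) \<and>
          Z (n + 1) = \<tau> - a m - Z n) \<or>
        (Z n + reduce m a (f (v n)) < \<tau> - a m \<and>
          Z n + reduce m a (f (v n)) + reduce m a (f (f (v n))) > \<tau> - a m \<and>
          v (n + 1) = f (f (v n)) \<and> Z (n + 1) = \<tau> - a m - Z n - reduce m a (f (v n))) \<or>
        (Z n + reduce m a (f (v n)) + reduce m a (f (f (v n))) < \<tau> - a m \<and> v (n + 1) = v n \<and>
          Z (n + 1) = \<tau> - a m - Z n - reduce m a (f (v n)) - reduce m a (f (f (v n))))"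
    proof cases
      case 1
      then have "t (n + 1) = t n + 3" "w (t n) = m" using t_m[of n] by (simp_all add: v_def)
      then show ?thesis
        using m_next[of "t n"] dist 1 by (auto simp: Z_def s_def v_def fs R)
    next
      case 2
      then have "t (n + 1) = t n + 1" "w (t n) = j" using t_nm[of n] dist by (simp_all add: v_def)
      then show ?thesis
        using at_j[of "t n"] Y(1)[of "t n"] pmk dist 2 by (auto simp: Z_def s_def v_def fs R)
    next
      case 3
      then have "t (n + 1) = t n + 1" "w (t n) = k" using t_nm[of n] dist by (simp_all add: v_def)
      then show ?thesis
        using at_k[of "t n"] k_range[of n] pmj dist 3 by (auto simp: Z_def s_def v_def fs R)
    qed
  qed
  moreover have "outcome Y w" if out: "outcome Z v"
  proof (rule outcome_expand[where \<beta> = "insertion m" and p = t and s = s, OF _ _ _ _ _ out])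
    show "concat_at (\<lambda>n. insertion m (v n) (v (n + 1))) t w"
      unfolding concat_at_def
    proof (rule allI)
      fix n
      show "t (n + 1) = t n + int (length (insertion m (v n) (v (n + 1)))) \<and>
        (\<forall>i < length (insertion m (v n) (v (n + 1))). w (t n + int i) = insertion m (v n) (v (n + 1)) ! i)"
      proof (cases "w (t n) = m")
        case True
        then show ?thesis
          using t_m[of n] m_next[of "t n"] dist
          by (auto simp: insertion_def v_def fs less_Suc_eq numeral_3_eq_3)
      next
        case False
        then show ?thesis using t_nm[of n] by (auto simp: insertion_def v_def)
      qed
    qed
    show "Y (t n) = Z n + s (v n)" for n by (simp add: Z_def)
  qed (auto simp: insertion_def)
  ultimately show ?thesis using that by blast
qed

text \<open>A counterexample could be reduced forever: two translations fitting in a row would lead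
  to \<open>two_band_outcome\<close>, a point without \<open>m\<close>-neighbours to
  \<open>isolated_periodic\<close>. Dependent choice then yields a sequence contradicting
  \<open>reduction_terminates\<close>.\<close>

lemma contour_outcome:
  assumes "contour a \<tau> Y w" "\<And>i. a i > 0" "rat_indep a" "a LA + a LB + a LC > 2 * \<tau>"
  shows "outcome Y w"
proof (rule ccontr)
  assume no: "\<not> outcome Y w"
  define bad where "bad = (\<lambda>(a, \<tau>, Y, w). contour a \<tau> Y w \<and> (\<forall>i. a i > 0) \<and> rat_indep a \<and>
    a LA + a LB + a LC > 2 * \<tau> \<and> \<not> outcome Y w)"
  define rel where "rel = (\<lambda>(a :: label \<Rightarrow> real, \<tau> :: real, Y :: int \<Rightarrow> real, w :: int \<Rightarrow> label)
    (a', \<tau>', Y' :: int \<Rightarrow> real, w' :: int \<Rightarrow> label).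
    (\<forall>i j. i \<noteq> j \<longrightarrow> a i + a j > \<tau>) \<and> (\<exists>m. a' = reduce m a \<and> \<tau>' = \<tau> - a m))"
  have ex: "\<exists>q'. bad q' \<and> rel q q'" if q: "bad q" for q
  proof -
    obtain a \<tau> Y w where qq: "q = (a, \<tau>, Y, w)" by (metis prod_cases4)
    then have C: "contour a \<tau> Y w" and pos: "\<And>i. a i > 0" and indep: "rat_indep a"
      and sum: "a LA + a LB + a LC > 2 * \<tau>" and no: "\<not> outcome Y w"
      using q by (auto simp: bad_def)
    have UNIV: "(UNIV :: label set) = {LA, LB, LC}" using label.exhaust by auto
    have "finite (UNIV :: label set)" "(UNIV :: label set) \<noteq> {}" unfolding UNIV by auto
    then obtain m where "\<And>i. a m \<le> a i" using ex_min_if_finite[of "range a"]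
      by (metis (mono_tags, lifting) arg_min_least UNIV_I)
    then have minle: "a m \<le> a i" for i by blast
    have min: "a m < a i" if "i \<noteq> m" for i
      using minle[of i] rat_indep_neq[OF indep that] by simp
    have pairf: "a i + a (f i) > \<tau>" for i
    proof (rule ccontr)
      assume "\<not> ?thesis"
      then have two: "a i + a (f i) \<le> \<tau>" by simp
      \<comment> \<open>The excess at work: if two of the lengths add up to at most \<tau>, the
        third one is larger than \<tau>.\<close>
      then have "a (f (f i)) > \<tau>" using sum sum_labels[of a i] by simp
      then show False using two_band_outcome[OF C pos indep two] no by blast
    qed
    have pair: "a i + a j > \<tau>" if "i \<noteq> j" for i j
      using that pairf[of i] pairf[of j] by (rule_tac label_cases[of j i]) (auto simp: ac_simps)
    have noniso: "Y n < \<tau> - a m \<or> a m < Y n" for n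
      using isolated_periodic[OF C minle pos, of n] no by force
    obtain Z v where Z: "contour (reduce m a) (\<tau> - a m) Z v" "outcome Z v \<Longrightarrow> outcome Y w"
      using contour_reduce[OF C pos min pair noniso] by blast
    have "reduce m a i > 0" for i using pos min by (simp add: reduce_def)
    moreover have "reduce m a LA + reduce m a LB + reduce m a LC > 2 * (\<tau> - a m)"
      using sum by (cases m) (auto simp: reduce_def)
    ultimately have "bad (reduce m a, \<tau> - a m, Z, v)"
      using Z no rat_indep_reduce[OF indep] by (auto simp: bad_def)
    then show ?thesis using pair unfolding qq rel_def by blast
  qed
  have "bad (a, \<tau>, Y, w)" using assms no by (simp add: bad_def)
  from dependent_nat_choice[of "\<lambda>_. bad" "\<lambda>_. rel"] this ex
  obtain q where q: "\<And>n. bad (q n)" "\<And>n. rel (q n) (q (Suc n))" by blast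
  define aa where "aa n = fst (q n)" for n
  define tt where "tt n = fst (snd (q n))" for n
  have "\<exists>m. aa (Suc n) = reduce m (aa n) \<and> tt (Suc n) = tt n - aa n m" for n
    using q(2)[of n] by (auto simp: rel_def aa_def tt_def split: prod.splits)
  then have "\<forall>n. \<exists>m. aa (Suc n) = reduce m (aa n) \<and> tt (Suc n) = tt n - aa n m" by blast
  from choice[OF this] obtain mm where
    mm: "\<And>n. aa (Suc n) = reduce (mm n) (aa n)" "\<And>n. tt (Suc n) = tt n - aa n (mm n)" by blast
  have p: "aa n i > 0" "aa n LA + aa n LB + aa n LC > 2 * tt n" for n i
    using q(1)[of n] by (auto simp: bad_def aa_def tt_def split: prod.splits)
  have "tt n > 0" for n
  proof -
    obtain a' \<tau>' Y' w' where qn: "q n = (a', \<tau>', Y', w')" by (metis prod_cases4)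
    then have "contour a' \<tau>' Y' w'" using q(1)[of n] by (simp add: bad_def)
    then have "0 < Y' 0" "Y' 0 < \<tau>'" by (rule contourD)+
    then show ?thesis using qn by (simp add: tt_def)
  qed
  moreover have "aa n i + aa n j > tt n" if "i \<noteq> j" for n i j
    using q(2)[of n] that by (auto simp: rel_def aa_def tt_def split: prod.splits)
  ultimately show False using reduction_terminates[of aa mm tt, OF mm _ p(1) _ p(2)] by blast
qed

end

section \<open>Triangles and their circumcircles\<close>

lemma Im_cnj_mult_eq_0_imp_scaleR:
  assumes "Im (cnj u * v) = 0" "u \<noteq> 0"
  shows "\<exists>r :: real. v = r *\<^sub>R u"
proof -
  have "cnj u * v = of_real (Re (cnj u * v))" using assms(1) by (simp add: complex_eq_iff)
  then have "u * cnj u * v = of_real (Re (cnj u * v)) * u" by (simp add: mult.assoc mult.commute)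
  then have "v = (Re (cnj u * v) / (cmod u)\<^sup>2) *\<^sub>R u"
    using assms(2)
    by (simp add: complex_norm_square[symmetric] scaleR_conv_of_real field_simps del: of_real_power)
  then show ?thesis by blast
qed

text \<open>Twice the signed area. \<open>Im (cnj u * v)\<close> is the determinant of
  \<open>u\<close> and \<open>v\<close>, the form in which signed areas and distances appear
  throughout.\<close>

definition area :: "tile \<Rightarrow> real" where
  "area P = Im (cnj (P LB - P LA) * (P LC - P LA))"

lemma area_nonzero:
  assumes "nondegenerate P"
  shows "area P \<noteq> 0"
proof
  assume 0: "area P = 0"
  have "collinear {P LA, P LB, P LC}"
  proof (cases "P LB = P LA")
    case True
    then show ?thesis by simp
  next
    case False
    then obtain r where "P LC - P LA = r *\<^sub>R (P LB - P LA)"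
      using Im_cnj_mult_eq_0_imp_scaleR 0 unfolding area_def by (metis right_minus_eq)
    then have "collinear {P LB - P LA, 0, P LC - P LA}"
      by (auto simp: insert_commute collinear_lemma)
    then show ?thesis using collinear_3[of "P LB" "P LA" "P LC"] by (simp add: insert_commute)
  qed
  then show False using assms by (simp add: nondegenerate_def)
qed

lemma area_rotate: "Im (cnj (P (nxt i) - P i) * (P (nxt (nxt i)) - P i)) = area P"
  by (cases i) (simp_all add: area_def algebra_simps)

lemma sides_independent:
  assumes "nondegenerate P" "of_real r * (P LB - P LA) + of_real s * (P LC - P LA) = 0"
  shows "r = 0" "s = 0"
proof -
  have ar: "area P = Re (P LB - P LA) * Im (P LC - P LA) - Im (P LB - P LA) * Re (P LC - P LA)"
    by (simp add: area_def algebra_simps)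
  have eqs: "r * Re (P LB - P LA) + s * Re (P LC - P LA) = 0"
    "r * Im (P LB - P LA) + s * Im (P LC - P LA) = 0"
    using assms(2) by (auto simp: complex_eq_iff)
  have "r * area P = 0" "s * area P = 0" unfolding ar using eqs by algebra+
  then show "r = 0" "s = 0" using area_nonzero[OF assms(1)] by auto
qed

lemma dist_eq_iff:
  "dist z p = dist z q \<longleftrightarrow> 2 * (Re (q - p) * Re (z - p) + Im (q - p) * Im (z - p)) = (Re (q - p))\<^sup>2 + (Im (q - p))\<^sup>2"
proof -
  have "dist z p = dist z q \<longleftrightarrow> (dist z p)\<^sup>2 = (dist z q)\<^sup>2"
    by (simp add: power2_eq_iff_nonneg)
  also have "\<dots> \<longleftrightarrow> 2 * (Re (q - p) * Re (z - p) + Im (q - p) * Im (z - p)) = (Re (q - p))\<^sup>2 + (Im (q - p))\<^sup>2"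
    unfolding dist_norm cmod_power2 by (simp add: power2_eq_square algebra_simps)
  finally show ?thesis .
qed

lemma circumcenter_ex1:
  assumes "nondegenerate P"
  shows "\<exists>!z. dist z (P LA) = dist z (P LB) \<and> dist z (P LB) = dist z (P LC)"
proof -
  define a b c d where "a = Re (P LB - P LA)" and "b = Im (P LB - P LA)"
    and "c = Re (P LC - P LA)" and "d = Im (P LC - P LA)"
  define S where "S = a * d - b * c"
  have S: "S \<noteq> 0" using area_nonzero[OF assms] by (simp add: area_def S_def a_def b_def c_def d_def algebra_simps)
  have iff: "(dist z (P LA) = dist z (P LB) \<and> dist z (P LB) = dist z (P LC)) \<longleftrightarrow>
      2 * (a * Re (z - P LA) + b * Im (z - P LA)) = a\<^sup>2 + b\<^sup>2 \<and>
      2 * (c * Re (z - P LA) + d * Im (z - P LA)) = c\<^sup>2 + d\<^sup>2" for z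
  proof -
    have "(dist z (P LA) = dist z (P LB) \<and> dist z (P LB) = dist z (P LC)) \<longleftrightarrow>
        dist z (P LA) = dist z (P LB) \<and> dist z (P LA) = dist z (P LC)" by auto
    then show ?thesis unfolding dist_eq_iff a_def b_def c_def d_def .
  qed
  define X where "X = ((a\<^sup>2 + b\<^sup>2) * d - (c\<^sup>2 + d\<^sup>2) * b) / (2 * S)"
  define Y where "Y = ((c\<^sup>2 + d\<^sup>2) * a - (a\<^sup>2 + b\<^sup>2) * c) / (2 * S)"
  have XY: "2 * (a * X + b * Y) = a\<^sup>2 + b\<^sup>2" "2 * (c * X + d * Y) = c\<^sup>2 + d\<^sup>2"
    using S unfolding X_def Y_def by (simp_all add: divide_simps) (simp_all add: S_def algebra_simps)
  show ?thesis
  proof (rule ex1I)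
    show "dist (P LA + Complex X Y) (P LA) = dist (P LA + Complex X Y) (P LB) \<and>
        dist (P LA + Complex X Y) (P LB) = dist (P LA + Complex X Y) (P LC)"
      unfolding iff using XY by simp
    fix z assume "dist z (P LA) = dist z (P LB) \<and> dist z (P LB) = dist z (P LC)"
    then have z: "2 * (a * Re (z - P LA) + b * Im (z - P LA)) = a\<^sup>2 + b\<^sup>2"
      "2 * (c * Re (z - P LA) + d * Im (z - P LA)) = c\<^sup>2 + d\<^sup>2" unfolding iff by auto
    have "S * (Re (z - P LA) - X) = 0" "S * (Im (z - P LA) - Y) = 0"
      unfolding S_def using XY z by algebra+
    then show "z = P LA + Complex X Y" using S by (simp add: complex_eq_iff)
  qed
qed

lemma circumcenter_dist:
  assumes "nondegenerate P"
  shows "dist (circumcenter P) (P i) = dist (circumcenter P) (P LA)"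
  using theI'[OF circumcenter_ex1[OF assms]] unfolding circumcenter_def by (cases i) auto

lemma circumcenter_eqI:
  assumes "nondegenerate P" "\<And>i. dist z (P i) = r"
  shows "circumcenter P = z"
  unfolding circumcenter_def by (rule the1_equality[OF circumcenter_ex1[OF assms(1)]]) (simp add: assms(2))

lemma nondegenerate_iff_area: "nondegenerate P \<longleftrightarrow> area P \<noteq> 0"
proof
  show "area P \<noteq> 0 \<Longrightarrow> nondegenerate P"
  proof (rule ccontr)
    assume a: "area P \<noteq> 0" "\<not> nondegenerate P"
    then have "collinear {P LB, P LA, P LC}" by (simp add: nondegenerate_def insert_commute)
    then have "collinear {0, P LB - P LA, P LC - P LA}" by (simp add: collinear_3)
    then consider "P LB - P LA = 0" | "P LC - P LA = 0" | r where "P LC - P LA = r *\<^sub>R (P LB - P LA)"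
      unfolding collinear_lemma by blast
    then show False
      using a(1) by cases (auto simp: area_def algebra_simps)
  qed
qed (rule area_nonzero)

text \<open>On a circle about 0 the quotient of a chord by its conjugate is determined by the
  product of the ends. Hence refraction in a side with ends \<open>a\<close> and \<open>b\<close> is
  conjugation followed by multiplication with \<open>a * b / R\<^sup>2\<close>.\<close>

lemma chord_direction:
  assumes "cmod a = R" "cmod b = R" "R > 0"
  shows "(b - a) * of_real (R\<^sup>2) = - (a * b) * cnj (b - a)"
proof -
  have "a * cnj a = of_real (R\<^sup>2)" "b * cnj b = of_real (R\<^sup>2)"
    using assms by (simp_all add: complex_norm_square[symmetric] del: of_real_power)
  then have "(b - a) * of_real (R\<^sup>2) = b * (a * cnj a) - a * (b * cnj b)"
    by (simp only: left_diff_distrib)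
  then show ?thesis by (simp add: algebra_simps)
qed

text \<open>\<open>tile_angle\<close> is unsigned; the sign of the area supplies the orientation
  that \<open>arccos\<close> loses.\<close>

lemma tile_angle_polar:
  assumes "nondegenerate P" "q = (P (nxt (nxt i)) - P i) / (P (nxt i) - P i)" "o1 = sgn (area P)"
  shows "q = of_real (cmod q) * cis (o1 * tile_angle P i)" "0 < tile_angle P i" "tile_angle P i < pi"
    "q \<noteq> 0"
proof -
  define u v where "u = P (nxt i) - P i" and "v = P (nxt (nxt i)) - P i"
  have ar: "Im (cnj u * v) = area P" using area_rotate[of P i] by (simp add: u_def v_def)
  have S: "area P \<noteq> 0" using area_nonzero[OF assms(1)] .
  have nz: "u \<noteq> 0" "v \<noteq> 0" using ar S by auto
  have q: "q = cnj u * v / of_real ((cmod u)\<^sup>2)"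
    using nz assms(2) unfolding u_def[symmetric] v_def[symmetric] complex_norm_square
    by (simp add: field_simps)
  have Imq: "Im q = area P / (cmod u)\<^sup>2" unfolding q Im_divide_of_real ar ..
  have Req: "Re q = (u \<bullet> v) / (cmod u)\<^sup>2"
    unfolding q Re_divide_of_real by (simp add: inner_complex_def)
  show "q \<noteq> 0" using Imq S nz by auto
  have cq: "cmod q = cmod v / cmod u" using assms(2) by (simp add: norm_divide u_def v_def)
  have "Re q / cmod q = (u \<bullet> v) / (norm u * norm v)"
    unfolding Req cq using nz by (simp add: power2_eq_square field_simps)
  then have ta: "tile_angle P i = arccos (Re q / cmod q)"
    by (simp add: tile_angle_def Let_def u_def v_def)
  have cosA: "cos (Arg q) = Re q / cmod q" using \<open>q \<noteq> 0\<close> by (simp add: cos_Arg)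
  have sgnIm: "sgn (Im q) = o1" using Imq assms(3) nz by (simp add: sgn_divide)
  have main: "Arg q = o1 * tile_angle P i \<and> 0 < tile_angle P i \<and> tile_angle P i < pi"
  proof (cases "Im q > 0")
    case True
    then have "0 < Arg q" "Arg q < pi" using Arg_lt_pi[of q] by auto
    moreover have "tile_angle P i = Arg q"
      unfolding ta cosA[symmetric] using calculation by (simp add: arccos_cos)
    ultimately show ?thesis using sgnIm True by simp
  next
    case False
    moreover have "Im q \<noteq> 0" using Imq S nz by simp
    ultimately have neg: "Im q < 0" by simp
    then have "Arg q < 0" "- pi < Arg q" using Arg_neg_iff[of q] mpi_less_Arg by auto
    moreover have "tile_angle P i = - Arg q"
      unfolding ta cosA[symmetric] using calculation arccos_cos[of "- Arg q"] by simp
    moreover have "o1 = - 1" using sgnIm neg by simp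
    ultimately show ?thesis by simp
  qed
  then show "0 < tile_angle P i" "tile_angle P i < pi" by auto
  show "q = of_real (cmod q) * cis (o1 * tile_angle P i)"
    using main rcis_cmod_Arg[of q] by (metis rcis_def)
qed

text \<open>The product of the three quotients of sides is -1, so the sum is an odd multiple of
  \<pi>, and it lies between 0 and \<open>3 * pi\<close>.\<close>

lemma tile_angle_sum:
  assumes "nondegenerate P"
  shows "tile_angle P LA + tile_angle P LB + tile_angle P LC = pi"
proof -
  define o1 where "o1 = sgn (area P)"
  have o1: "o1 = 1 \<or> o1 = - 1" using area_nonzero[OF assms] by (auto simp: o1_def sgn_if)
  define q where "q i = (P (nxt (nxt i)) - P i) / (P (nxt i) - P i)" for i
  note pol = tile_angle_polar[OF assms q_def o1_def]
  define \<Sigma> where "\<Sigma> = tile_angle P LA + tile_angle P LB + tile_angle P LC"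
  have "q LA * q LB * q LC = - 1"
  proof -
    have ne: "P LC - P LA \<noteq> 0" "P LA - P LB \<noteq> 0" "P LB - P LC \<noteq> 0"
      using pol(4)[of LA] pol(4)[of LB] pol(4)[of LC] by (auto simp: q_def)
    then have ne': "P LB - P LA \<noteq> 0" "P LC - P LB \<noteq> 0" "P LA - P LC \<noteq> 0" by auto
    have "q LA * q LB * q LC =
      ((P LC - P LA) / (P LA - P LC)) * ((P LA - P LB) / (P LB - P LA)) * ((P LB - P LC) / (P LC - P LB))"
      by (simp add: q_def)
    also have "\<dots> = (- 1) * (- 1) * (- 1)"
    proof -
      have "z / (- z) = - 1" if "z \<noteq> 0" for z :: complex using that by simp
      from this[OF ne(1)] this[OF ne(2)] this[OF ne(3)] show ?thesis by simp
    qed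
    finally show ?thesis by simp
  qed
  then have prod: "of_real (cmod (q LA) * cmod (q LB) * cmod (q LC)) * cis (o1 * \<Sigma>) = - 1"
    using pol(1)[of LA] pol(1)[of LB] pol(1)[of LC]
    by (simp add: \<Sigma>_def cis_mult[symmetric] distrib_left ac_simps)
  then have "cmod (of_real (cmod (q LA) * cmod (q LB) * cmod (q LC)) * cis (o1 * \<Sigma>)) = 1" by simp
  then have "cmod (q LA) * cmod (q LB) * cmod (q LC) = 1" by (simp add: norm_mult)
  then have "cis (o1 * \<Sigma>) = - 1" using prod by simp
  then have "Re (cis (o1 * \<Sigma>)) = - 1" by simp
  then have "cos (o1 * \<Sigma>) = - 1" by simp
  then have "cos \<Sigma> = - 1" using o1 by auto
  then obtain n :: int where n: "\<Sigma> = (2 * of_int n + 1) * pi" unfolding cos_eq_minus1 by blast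
  have "0 < \<Sigma>" "\<Sigma> < 3 * pi"
    using pol(2,3)[of LA] pol(2,3)[of LB] pol(2,3)[of LC] by (auto simp: \<Sigma>_def)
  then have "0 < 2 * real_of_int n + 1" "2 * real_of_int n + 1 < 3"
    unfolding n by (auto simp: zero_less_mult_iff)
  then have "n = 0" by linarith
  then show ?thesis using n by (simp add: \<Sigma>_def)
qed

text \<open>The inscribed angle theorem: a complex number divided by its conjugate has twice the
  argument, and in the quotient of the two chord directions given by \<open>chord_direction\<close>
  the common end \<open>d i\<close> cancels.\<close>

lemma inscribed_angle:
  assumes "nondegenerate P" "c = circumcenter P"
  shows "P (nxt (nxt i)) - c = cis (2 * (sgn (area P) * tile_angle P i)) * (P (nxt i) - c)"
proof -
  define R where "R = dist c (P LA)"
  define d where "d j = P j - c" for j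
  have dR: "cmod (d j) = R" for j
    using circumcenter_dist[OF assms(1), of j] assms(2) by (simp add: d_def R_def dist_norm norm_minus_commute)
  have R0: "R > 0"
  proof (rule ccontr)
    assume "\<not> R > 0"
    then have "R = 0" by (simp add: R_def)
    then have "P j = c" for j using dR[of j] by (simp add: d_def)
    then show False using area_nonzero[OF assms(1)] by (simp add: area_def)
  qed
  define q where "q = (P (nxt (nxt i)) - P i) / (P (nxt i) - P i)"
  define \<phi> where "\<phi> = sgn (area P) * tile_angle P i"
  note pol = tile_angle_polar[OF assms(1) q_def refl]
  define u v where "u = d (nxt i) - d i" and "v = d (nxt (nxt i)) - d i"
  have quv: "q = v / u" by (simp add: q_def u_def v_def d_def)
  have nz: "u \<noteq> 0" "v \<noteq> 0" using pol(4) quv by auto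
  have "q = cis (2 * \<phi>) * cnj q"
  proof -
    have "cis \<phi> * cis \<phi> * cnj (cis \<phi>) = cis \<phi>" by (simp add: cis_cnj cis_mult)
    then have "cis (2 * \<phi>) * cnj (cis \<phi>) = cis \<phi>" by (simp add: cis_mult)
    then show ?thesis using pol(1) unfolding \<phi>_def[symmetric] by (metis complex_cnj_mult complex_cnj_complex_of_real mult.left_commute)
  qed
  then have 1: "v * cnj u = cis (2 * \<phi>) * cnj v * u"
    unfolding quv using nz by (simp add: field_simps)
  have 2: "u * of_real (R\<^sup>2) = - (d i * d (nxt i)) * cnj u"
    "v * of_real (R\<^sup>2) = - (d i * d (nxt (nxt i))) * cnj v"
    unfolding u_def v_def by (rule chord_direction[OF dR dR R0])+
  have di: "d i \<noteq> 0" using dR[of i] R0 by auto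
  have nzc: "cnj u \<noteq> 0" "cnj v \<noteq> 0" using nz by auto
  have "(d i * d (nxt (nxt i))) * cnj v * cnj u = cis (2 * \<phi>) * cnj v * (d i * d (nxt i) * cnj u)"
    using 1 2 by algebra
  then have "d (nxt (nxt i)) = cis (2 * \<phi>) * d (nxt i)" using di nzc by simp
  then show ?thesis by (simp add: d_def \<phi>_def)
qed

lemma rat_indep_angles:
  assumes "lin_indep_over_rat (\<lambda>j. tile_angle P j / pi)"
  shows "rat_indep (\<lambda>j. 2 * tile_angle P j)"
  unfolding rat_indep_def
proof (intro allI impI)
  fix k :: "label \<Rightarrow> int" and i
  assume k: "of_int (k LA) * (2 * tile_angle P LA) + of_int (k LB) * (2 * tile_angle P LB)
      + of_int (k LC) * (2 * tile_angle P LC) = 0"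
  define q :: "label \<Rightarrow> rat" where "q j = of_int (k j)" for j
  have "of_rat (q LA) * (tile_angle P LA / pi) + of_rat (q LB) * (tile_angle P LB / pi)
      + of_rat (q LC) * (tile_angle P LC / pi) = 0"
    using k by (simp add: q_def field_simps)
  then have "q i = 0" using assms unfolding lin_indep_over_rat_def by blast
  then show "k i = 0" by (simp add: q_def)
qed

section \<open>Folding along a trajectory\<close>

interpretation nxt: label_rotation nxt
proof
  show "nxt (nxt (nxt i)) = i" "nxt i \<noteq> i" for i by (cases i; simp)+
qed

lemma sgn_cnj: "sgn (cnj z) = cnj (sgn z)"
  by (simp add: sgn_eq)

lemma sgn_unit_mult:
  fixes z v :: complex
  assumes "cmod z = 1"
  shows "sgn (z * v) = z * sgn v"
  using assms by (simp add: sgn_eq norm_mult)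

lemma neighbour_neighbour: "neighbour (neighbour P i) i = P"
  by (rule ext) (simp add: neighbour_def)

lemma neighbour_swap:
  "neighbour P i (nxt i) = P (nxt (nxt i))" "neighbour P i (nxt (nxt i)) = P (nxt i)"
  by (simp_all add: neighbour_def)

locale tiling_trajectory =
  fixes D :: tile and T :: "int \<Rightarrow> tile" and w :: "int \<Rightarrow> label" and x :: "int \<Rightarrow> complex"
  assumes nondegenerate: "nondegenerate D"
    and independent: "lin_indep_over_rat (\<lambda>j. tile_angle D j / pi)"
    and trajectory: "trajectory D T w x"
begin

lemma T_Suc: "T (n + 1) = neighbour (T n) (w n)"
  and x_side: "x n \<in> side_interior (T n) (w n)"
  and w_Suc: "w (n + 1) \<noteq> w n"
  and x_Suc: "\<exists>r > 0. x (n + 1) - x n = r *\<^sub>R refract (side_vector (T n) (w n)) (x n - x (n - 1))"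
  and T_0: "T 0 \<in> positive_tiles D"
  using trajectory unfolding trajectory_def by auto

definition R :: real where "R = dist (circumcenter D) (D LA)"
definition d :: "label \<Rightarrow> complex" where "d j = D j - circumcenter D"
definition e :: "int \<Rightarrow> complex" where "e n = (if even n then 1 else - 1)"
definition ctr :: "int \<Rightarrow> complex" where "ctr n = circumcenter (T n)"

lemma e_Suc [simp]: "e (n + 1) = - e n" by (simp add: e_def)
lemma e_square [simp]: "e n * e n = 1" "e n * (e n * z) = z" by (simp_all add: e_def)
lemma cnj_e [simp]: "cnj (e n) = e n" by (simp add: e_def)
lemma cmod_e [simp]: "cmod (e n) = 1" by (simp add: e_def)
lemma e_nonzero [simp]: "e n \<noteq> 0" by (simp add: e_def)

lemma cmod_d: "cmod (d j) = R"
  using circumcenter_dist[OF nondegenerate, of j]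
  by (simp add: d_def R_def dist_norm norm_minus_commute)

lemma d_rotate: "d (nxt (nxt i)) = cis (2 * (sgn (area D) * tile_angle D i)) * d (nxt i)"
  unfolding d_def by (rule inscribed_angle[OF nondegenerate refl])

lemma R_pos: "R > 0"
proof (rule ccontr)
  assume "\<not> R > 0"
  then have "R = 0" by (simp add: R_def)
  then have "d j = 0" for j using cmod_d[of j] by simp
  then have "D j = circumcenter D" for j by (simp add: d_def)
  then show False using area_nonzero[OF nondegenerate] by (simp add: area_def)
qed

lemma d_nonzero [simp]: "d j \<noteq> 0"
  using cmod_d[of j] R_pos by auto

lemma d_cnj: "d j * cnj (d j) = of_real (R\<^sup>2)"
  using cmod_d[of j] by (simp add: complex_norm_square[symmetric])

lemma area_rotate_d: "Im (cnj (d (nxt i) - d i) * (d (nxt (nxt i)) - d i)) = area D"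
  using area_rotate[of D i] by (simp add: d_def)

lemma T_form: "\<exists>c. \<forall>j. T n j = c + e n * d j"
proof (induction n rule: int_induct[where k = 0])
  case base
  from T_0 obtain p q :: int where
    "T 0 = (\<lambda>j. D j + of_int p * (D LB - D LA) + of_int q * (D LC - D LA))"
    unfolding positive_tiles_def by auto
  then show ?case
    by (intro exI[of _ "circumcenter D + of_int p * (D LB - D LA) + of_int q * (D LC - D LA)"])
      (simp add: e_def d_def)
next
  case (step1 n)
  then obtain c where "\<forall>j. T n j = c + e n * d j" by blast
  then show ?case
    by (intro exI[of _ "c + e n * (d (nxt (w n)) + d (nxt (nxt (w n))))"])
      (simp add: T_Suc neighbour_def, simp add: algebra_simps)
next
  case (step2 n)
  define m where "m = n - 1"
  have n: "n = m + 1" by (simp add: m_def)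
  from step2 obtain c where c: "\<forall>j. T n j = c + e n * d j" by blast
  have c': "T (m + 1) j = c - e m * d j" for j using c by (simp add: n)
  have "T m = neighbour (T (m + 1)) (w m)" unfolding T_Suc neighbour_neighbour ..
  then have "T m j = T (m + 1) (nxt (w m)) + T (m + 1) (nxt (nxt (w m))) - T (m + 1) j" for j
    by (simp add: neighbour_def)
  then have "T m j = c - e m * (d (nxt (w m)) + d (nxt (nxt (w m)))) + e m * d j" for j
    unfolding c' by (simp add: algebra_simps)
  then show ?case unfolding m_def by blast
qed

lemma T_eq: "T n j = ctr n + e n * d j"
proof -
  obtain c where c: "\<And>j. T n j = c + e n * d j" using T_form by blast
  have "area (T n) = area D"
    by (simp add: area_def c d_def e_def algebra_simps)
  then have "nondegenerate (T n)"
    using area_nonzero[OF nondegenerate] by (simp add: nondegenerate_iff_area)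
  then have "ctr n = c"
    unfolding ctr_def
    by (rule circumcenter_eqI[where r = R]) (simp add: c dist_norm norm_mult cmod_d)
  then show ?thesis using c by simp
qed

lemma ctr_Suc: "ctr (n + 1) = ctr n + e n * (d (nxt (w n)) + d (nxt (nxt (w n))))"
proof -
  have "T (n + 1) LA = T n (nxt (w n)) + T n (nxt (nxt (w n))) - T n LA"
    by (simp add: T_Suc neighbour_def)
  then have "ctr (n + 1) - e n * d LA = ctr n + e n * d (nxt (w n)) + (ctr n + e n * d (nxt (nxt (w n))))
      - (ctr n + e n * d LA)" by (simp add: T_eq)
  then show ?thesis by (simp add: algebra_simps)
qed

lemma x_exit:
  obtains \<mu> :: real where "0 < \<mu>" "\<mu> < 1"
    "x n = ctr n + e n * (of_real (1 - \<mu>) * d (nxt (w n)) + of_real \<mu> * d (nxt (nxt (w n))))"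
proof -
  from x_side[of n] obtain \<mu> where "0 < \<mu>" "\<mu> < 1"
    "x n = (1 - \<mu>) *\<^sub>R T n (nxt (w n)) + \<mu> *\<^sub>R T n (nxt (nxt (w n)))"
    unfolding side_interior_def in_segment by blast
  then show ?thesis
    by (intro that[of \<mu>]) (auto simp: T_eq scaleR_conv_of_real algebra_simps)
qed

lemma x_exit_bary:
  obtains \<beta> :: "label \<Rightarrow> real" where "\<beta> (w n) = 0" "\<And>j. j \<noteq> w n \<Longrightarrow> \<beta> j > 0"
    "\<beta> LA + \<beta> LB + \<beta> LC = 1"
    "x n = ctr n + e n * (of_real (\<beta> LA) * d LA + of_real (\<beta> LB) * d LB + of_real (\<beta> LC) * d LC)"
proof -
  obtain \<mu> where l: "0 < \<mu>" "\<mu> < 1"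
    "x n = ctr n + e n * (of_real (1 - \<mu>) * d (nxt (w n)) + of_real \<mu> * d (nxt (nxt (w n))))"
    by (rule x_exit)
  define \<beta> where "\<beta> j = (if j = w n then 0 else if j = nxt (w n) then 1 - \<mu> else \<mu>)" for j
  show ?thesis
    by (rule that[of \<beta>]; cases "w n"; use l in \<open>auto simp: \<beta>_def\<close>)
qed

lemma x_entry_bary:
  obtains \<beta> :: "label \<Rightarrow> real" where "\<beta> (w n) = 0" "\<And>j. j \<noteq> w n \<Longrightarrow> \<beta> j > 0"
    "\<beta> LA + \<beta> LB + \<beta> LC = 1"
    "x n = ctr (n + 1) +
       e (n + 1) * (of_real (\<beta> LA) * d LA + of_real (\<beta> LB) * d LB + of_real (\<beta> LC) * d LC)"
proof -
  obtain \<mu> where l: "0 < \<mu>" "\<mu> < 1"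
    "x n = ctr n + e n * (of_real (1 - \<mu>) * d (nxt (w n)) + of_real \<mu> * d (nxt (nxt (w n))))"
    by (rule x_exit)
  \<comment> \<open>The ends of the common side exchange their labels, so \<mu> and
    \<open>1 - \<mu>\<close> change places compared with the exit.\<close>
  define \<beta> where "\<beta> j = (if j = w n then 0 else if j = nxt (w n) then \<mu> else 1 - \<mu>)" for j
  show ?thesis
    by (rule that[of \<beta>]; (simp only: ctr_Suc e_Suc)?; cases "w n"; use l in \<open>auto simp: \<beta>_def algebra_simps\<close>)
qed

definition side :: "int \<Rightarrow> complex" where
  "side n = e n * (d (nxt (nxt (w n))) - d (nxt (w n)))"

lemma side_vector_eq: "side_vector (T n) (w n) = side n"
  by (simp add: side_vector_def side_def T_eq algebra_simps)

text \<open>The coordinate belonging to the exit side is positive at the entry point and 0 at the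
  exit point, so the segment cannot be parallel to that side.\<close>

lemma transversal_step: "Im (cnj (side (n + 1)) * (x (n + 1) - x n)) \<noteq> 0"
proof -
  obtain \<beta> where \<beta>: "\<beta> (w (n + 1)) = 0" "\<beta> LA + \<beta> LB + \<beta> LC = 1"
    "x (n + 1) = ctr (n + 1) +
      e (n + 1) * (of_real (\<beta> LA) * d LA + of_real (\<beta> LB) * d LB + of_real (\<beta> LC) * d LC)"
    by (rule x_exit_bary)
  obtain \<beta>' where \<beta>': "\<beta>' (w (n + 1)) > 0" "\<beta>' LA + \<beta>' LB + \<beta>' LC = 1"
    "x n = ctr (n + 1) +
      e (n + 1) * (of_real (\<beta>' LA) * d LA + of_real (\<beta>' LB) * d LB + of_real (\<beta>' LC) * d LC)"
    by (rule x_entry_bary) (use w_Suc in blast)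
  define \<gamma> where "\<gamma> j = \<beta> j - \<beta>' j" for j
  define i where "i = w (n + 1)"
  have \<gamma>i: "\<gamma> i < 0" using \<beta>(1) \<beta>'(1) by (simp add: \<gamma>_def i_def)
  have s0: "\<gamma> i + \<gamma> (nxt i) + \<gamma> (nxt (nxt i)) = 0"
    using \<beta>(2) \<beta>'(2) nxt.sum_labels[of \<gamma> i] by (simp add: \<gamma>_def)
  have "x (n + 1) - x n =
      e (n + 1) * (of_real (\<gamma> LA) * d LA + of_real (\<gamma> LB) * d LB + of_real (\<gamma> LC) * d LC)"
    unfolding \<beta>(3) \<beta>'(3) by (simp add: \<gamma>_def algebra_simps)
  also have "of_real (\<gamma> LA) * d LA + of_real (\<gamma> LB) * d LB + of_real (\<gamma> LC) * d LC =
      of_real (\<gamma> i) * d i + of_real (\<gamma> (nxt i)) * d (nxt i) + of_real (\<gamma> (nxt (nxt i))) * d (nxt (nxt i))"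
    by (cases i) simp_all
  also have "\<gamma> (nxt i) = - \<gamma> i - \<gamma> (nxt (nxt i))" using s0 by simp
  finally have diff: "x (n + 1) - x n = e (n + 1) * (of_real (\<gamma> i) * (d i - d (nxt i)) +
      of_real (\<gamma> (nxt (nxt i))) * (d (nxt (nxt i)) - d (nxt i)))"
    by (simp add: algebra_simps)
  define s where "s = d (nxt (nxt i)) - d (nxt i)"
  have "cnj (side (n + 1)) * (x (n + 1) - x n) =
      cnj s * (of_real (\<gamma> i) * (d i - d (nxt i)) + of_real (\<gamma> (nxt (nxt i))) * s)"
    unfolding diff side_def i_def[symmetric] s_def[symmetric] by (simp add: ac_simps)
  also have "Im \<dots> = \<gamma> i * Im (cnj s * (d i - d (nxt i)))"
    by (simp add: algebra_simps)
  also have "\<dots> = \<gamma> i * area D" using area_rotate_d[of "nxt i"] by (simp add: s_def)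
  finally show ?thesis using \<gamma>i area_nonzero[OF nondegenerate] by simp
qed

lemma transversal: "Im (cnj (side n) * (x n - x (n - 1))) \<noteq> 0"
  using transversal_step[of "n - 1"] by simp

lemma x_neq: "x n \<noteq> x (n - 1)"
  using transversal[of n] by auto

definition u :: "int \<Rightarrow> complex" where "u n = sgn (x n - x (n - 1))"

lemma cmod_u [simp]: "cmod (u n) = 1"
  using x_neq[of n] by (simp add: u_def norm_sgn)

lemma u_nonzero [simp]: "u n \<noteq> 0"
  using cmod_u[of n] by (metis norm_zero zero_neq_one)

lemma u_cnj [simp]: "cnj (u n) * u n = 1" "u n * cnj (u n) = 1"
  using complex_norm_square[of "u n"] by (simp_all add: mult.commute)

lemma x_diff: "x n - x (n - 1) = of_real (cmod (x n - x (n - 1))) * u n"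
  using x_neq[of n] by (simp add: u_def sgn_eq)

lemma transversal_u: "Im (cnj (u n) * side n) \<noteq> 0"
proof
  assume 0: "Im (cnj (u n) * side n) = 0"
  have "Im (cnj (side n) * u n) = - Im (cnj (u n) * side n)" by (simp add: algebra_simps)
  then have "Im (cnj (side n) * u n) = 0" by (simp only: 0)
  then have "Im (of_real (cmod (x n - x (n - 1))) * (cnj (side n) * u n)) = 0" by simp
  then show False
    using transversal[of n] x_diff[of n] by (simp add: mult.left_commute)
qed

lemma side_chord: "side n * of_real (R\<^sup>2) = - (d (nxt (w n)) * d (nxt (nxt (w n)))) * cnj (side n)"
proof -
  have "(d (nxt (nxt (w n))) - d (nxt (w n))) * of_real (R\<^sup>2) =
      - (d (nxt (w n)) * d (nxt (nxt (w n)))) * cnj (d (nxt (nxt (w n))) - d (nxt (w n)))"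
    by (rule chord_direction[OF cmod_d cmod_d R_pos])
  then show ?thesis by (simp add: side_def mult.assoc mult.left_commute)
qed

lemma u_Suc: "u (n + 1) * of_real (R\<^sup>2) = d (nxt (w n)) * d (nxt (nxt (w n))) * cnj (u n)"
proof -
  define a where "a = d (nxt (w n)) * d (nxt (nxt (w n)))"
  define v where "v = x n - x (n - 1)"
  define s where "s = side n"
  define \<omega> where "\<omega> = a / of_real (R\<^sup>2)"
  have s: "s \<noteq> 0" using transversal_u[of n] by (auto simp: s_def)
  have "s = - \<omega> * cnj s"
    using side_chord[of n] R_pos by (simp add: \<omega>_def a_def s_def field_simps)
  then have "s * cnj v = - \<omega> * cnj s * cnj v" by simp
  then have "refract s v = \<omega> * cnj v"
    using s by (simp add: refract_def field_simps)
  moreover obtain r where r: "r > 0" "x (n + 1) - x n = r *\<^sub>R refract s v"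
    using x_Suc[of n] unfolding side_vector_eq s_def v_def by blast
  ultimately have "u (n + 1) = sgn (r *\<^sub>R (\<omega> * cnj v))" by (simp add: u_def)
  also have "\<dots> = sgn (\<omega> * cnj v)" using r(1) by (simp add: sgn_scaleR)
  also have "\<dots> = \<omega> * sgn (cnj v)"
    by (rule sgn_unit_mult) (use R_pos in \<open>simp add: \<omega>_def a_def norm_divide norm_mult cmod_d power2_eq_square\<close>)
  also have "sgn (cnj v) = cnj (u n)" by (simp only: sgn_cnj u_def v_def)
  finally have "u (n + 1) = \<omega> * cnj (u n)" .
  then show ?thesis using R_pos by (simp add: \<omega>_def a_def)
qed

text \<open>
  The position of the vertex \<open>j\<close> of \<open>T n\<close> on the circle after folding, up to the reflection in
  the imaginary axis for odd \<open>n\<close>.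
\<close>

definition z :: "int \<Rightarrow> label \<Rightarrow> complex" where "z n j = cnj (u n) * (e n * d j)"

lemma cmod_z: "cmod (z n j) = R"
  by (simp add: z_def norm_mult cmod_d)

lemma z_rotate: "z n (nxt (nxt i)) = cis (2 * (sgn (area D) * tile_angle D i)) * z n (nxt i)"
  by (simp add: z_def d_rotate ac_simps)

text \<open>Each end of the common side, being the same point under another label, is only reflected
  in the imaginary axis; undoing the reflections folds all tiles into one circle.\<close>

lemma z_shared:
  "z (n + 1) (nxt (w n)) = - cnj (z n (nxt (nxt (w n))))"
  "z (n + 1) (nxt (nxt (w n))) = - cnj (z n (nxt (w n)))"
proof -
  define a b where "a = d (nxt (w n))" and "b = d (nxt (nxt (w n)))"
  have "cnj (u (n + 1) * of_real (R\<^sup>2)) = cnj (a * b * cnj (u n))"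
    unfolding u_Suc a_def b_def ..
  then have U: "cnj (u (n + 1)) * of_real (R\<^sup>2) = cnj a * cnj b * u n" by simp
  have nz: "complex_of_real (R\<^sup>2) \<noteq> 0" using R_pos by simp
  have ab: "a * cnj a = of_real (R\<^sup>2)" "b * cnj b = of_real (R\<^sup>2)" by (simp_all only: a_def b_def d_cnj)
  have "of_real (R\<^sup>2) * (cnj (u (n + 1)) * a) = (cnj (u (n + 1)) * of_real (R\<^sup>2)) * a"
    by (simp only: ac_simps)
  also have "\<dots> = (a * cnj a) * (u n * cnj b)" unfolding U by (simp only: ac_simps)
  finally have "of_real (R\<^sup>2) * (cnj (u (n + 1)) * a) = of_real (R\<^sup>2) * (u n * cnj b)"
    unfolding ab .
  moreover have "of_real (R\<^sup>2) * (cnj (u (n + 1)) * b) = (cnj (u (n + 1)) * of_real (R\<^sup>2)) * b"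
    by (simp only: ac_simps)
  then have "of_real (R\<^sup>2) * (cnj (u (n + 1)) * b) = (b * cnj b) * (u n * cnj a)"
    unfolding U by (simp only: ac_simps)
  then have "of_real (R\<^sup>2) * (cnj (u (n + 1)) * b) = of_real (R\<^sup>2) * (u n * cnj a)"
    unfolding ab .
  ultimately have "cnj (u (n + 1)) * a = u n * cnj b" "cnj (u (n + 1)) * b = u n * cnj a"
    using nz mult_left_cancel by blast+
  then show "z (n + 1) (nxt (w n)) = - cnj (z n (nxt (nxt (w n))))"
    "z (n + 1) (nxt (nxt (w n))) = - cnj (z n (nxt (w n)))"
    by (simp_all add: z_def a_def b_def mult.left_commute[of _ "e n"])
qed

text \<open>
  \<open>g n j\<close> is the signed distance of the vertex \<open>j\<close> of the tile \<open>T n\<close> from the trajectory,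
  \<open>h n\<close> that of its circumcenter.
\<close>

definition g :: "int \<Rightarrow> label \<Rightarrow> real" where "g n j = Im (cnj (u n) * (T n j - x n))"
definition h :: "int \<Rightarrow> real" where "h n = Im (cnj (u n) * (ctr n - x n))"

lemma g_eq: "g n j = Im (z n j) + h n"
  by (simp add: g_def h_def z_def T_eq algebra_simps)

lemma g_exit:
  obtains \<mu> :: real where "0 < \<mu>" "\<mu> < 1"
    "T n (nxt (w n)) - x n = - of_real \<mu> * side n"
    "T n (nxt (nxt (w n))) - x n = of_real (1 - \<mu>) * side n"
proof -
  obtain \<mu> where l: "0 < \<mu>" "\<mu> < 1"
    "x n = ctr n + e n * (of_real (1 - \<mu>) * d (nxt (w n)) + of_real \<mu> * d (nxt (nxt (w n))))"
    by (rule x_exit)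
  show ?thesis
    by (rule that[OF l(1,2)]) (simp_all add: T_eq l(3) side_def algebra_simps)
qed

text \<open>The product becomes the negative of its conjugate: the component of the side across the
  motion is kept, the one along it changes sign.\<close>

lemma Im_u_Suc_side: "Im (cnj (u (n + 1)) * (of_real r * side n)) = Im (cnj (u n) * (of_real r * side n))"
proof -
  define a where "a = d (nxt (w n)) * d (nxt (nxt (w n)))"
  have nz: "complex_of_real (R\<^sup>2) \<noteq> 0" using R_pos by simp
  have aa: "a * cnj a = of_real (R\<^sup>2) * of_real (R\<^sup>2)"
  proof -
    have "a * cnj a = (d (nxt (w n)) * cnj (d (nxt (w n)))) *
        (d (nxt (nxt (w n))) * cnj (d (nxt (nxt (w n)))))" by (simp add: a_def ac_simps)
    then show ?thesis unfolding d_cnj .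
  qed
  have "cnj (u (n + 1) * of_real (R\<^sup>2)) = cnj (a * cnj (u n))" unfolding u_Suc a_def ..
  then have U: "cnj (u (n + 1)) * of_real (R\<^sup>2) = cnj a * u n" by simp
  have S: "side n * of_real (R\<^sup>2) = - a * cnj (side n)" unfolding side_chord a_def ..
  have "(of_real (R\<^sup>2) * of_real (R\<^sup>2)) * (cnj (u (n + 1)) * side n) =
      (cnj (u (n + 1)) * of_real (R\<^sup>2)) * (side n * of_real (R\<^sup>2))" by (simp only: ac_simps)
  also have "\<dots> = (a * cnj a) * (- (u n * cnj (side n)))" unfolding U S by (simp add: ac_simps)
  also have "\<dots> = (of_real (R\<^sup>2) * of_real (R\<^sup>2)) * (- (u n * cnj (side n)))" unfolding aa ..
  finally have "cnj (u (n + 1)) * side n = - (u n * cnj (side n))"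
    using nz by (simp only: mult_cancel_left mult_eq_0_iff) simp
  then have "Im (cnj (u (n + 1)) * side n) = Im (cnj (u n) * side n)" by simp
  moreover have "Im (cnj v * (of_real r * side n)) = r * Im (cnj v * side n)" for v
    by (simp add: algebra_simps)
  ultimately show ?thesis by simp
qed

lemma g_entry: "g (n + 1) j = Im (cnj (u (n + 1)) * (T (n + 1) j - x n))"
proof -
  define c where "c = cmod (x (n + 1) - x n)"
  have "x (n + 1) - x n = of_real c * u (n + 1)" using x_diff[of "n + 1"] by (simp add: c_def)
  then have "cnj (u (n + 1)) * (x (n + 1) - x n) = of_real c * (cnj (u (n + 1)) * u (n + 1))"
    by (simp only: ac_simps)
  also have "\<dots> = of_real c" by simp
  finally have "cnj (u (n + 1)) * (x (n + 1) - x n) = of_real c" .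
  then have "Im (cnj (u (n + 1)) * (x (n + 1) - x n)) = 0" by simp
  then show ?thesis by (simp add: g_def algebra_simps)
qed

lemma g_shared:
  "g (n + 1) (nxt (w n)) = g n (nxt (nxt (w n)))"
  "g (n + 1) (nxt (nxt (w n))) = g n (nxt (w n))"
proof -
  obtain \<mu> where l: "T n (nxt (w n)) - x n = - of_real \<mu> * side n"
    "T n (nxt (nxt (w n))) - x n = of_real (1 - \<mu>) * side n"
    by (rule g_exit)
  show "g (n + 1) (nxt (w n)) = g n (nxt (nxt (w n)))"
    unfolding g_entry unfolding g_def T_Suc neighbour_swap l by (rule Im_u_Suc_side)
  show "g (n + 1) (nxt (nxt (w n))) = g n (nxt (w n))"
    unfolding g_entry unfolding g_def T_Suc neighbour_swap l
    using Im_u_Suc_side[of n "- \<mu>"] by simp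
qed

text \<open>A vertex of the crossed side keeps both its distance \<open>g\<close> from the path and
  its height \<open>Im (z n j)\<close>, and \<open>h\<close> is their difference. This is the known
  invariant of trajectories, with a sign.\<close>

lemma h_const: "h n = h 0"
proof -
  have "h (n + 1) = h n" for n
    using g_shared(1)[of n] z_shared(1)[of n] by (simp add: g_eq)
  note step = this
  show ?thesis
  proof (induction n rule: int_induct[where k = 0])
    case (step1 n)
    then show ?case using step by simp
  next
    case (step2 n)
    then show ?case using step[of "n - 1"] by simp
  qed simp
qed

lemma g_exit_signs: "g n (nxt (w n)) * g n (nxt (nxt (w n))) < 0"
proof -
  obtain \<mu> where l: "0 < \<mu>" "\<mu> < 1" "T n (nxt (w n)) - x n = - of_real \<mu> * side n"
    "T n (nxt (nxt (w n))) - x n = of_real (1 - \<mu>) * side n"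
    by (rule g_exit)
  define c where "c = Im (cnj (u n) * side n)"
  have eqs: "g n (nxt (w n)) = - \<mu> * c" "g n (nxt (nxt (w n))) = (1 - \<mu>) * c"
    unfolding g_def l c_def by (simp_all add: algebra_simps)
  have "g n (nxt (w n)) * g n (nxt (nxt (w n))) = - (\<mu> * (1 - \<mu>) * c\<^sup>2)"
    unfolding eqs by (simp add: power2_eq_square algebra_simps)
  moreover have "c \<noteq> 0" using transversal_u by (simp add: c_def)
  ultimately show ?thesis using l by simp
qed

text \<open>Each vertex is an end of the side of exit or of the side of entry, and the path crosses
  these sides strictly between their ends. This provides the strict inequalities in
  \<open>contour\<close>.\<close>

lemma g_nonzero: "g n j \<noteq> 0"
proof -
  define m where "m = n - 1"
  have n: "n = m + 1" by (simp add: m_def)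
  have ex: "g k (nxt (w k)) \<noteq> 0 \<and> g k (nxt (nxt (w k))) \<noteq> 0" for k
    using g_exit_signs[of k] by auto
  show ?thesis
  proof (cases "j = w n")
    case False
    then show ?thesis using ex[of n] nxt.label_cases[of j "w n"] by metis
  next
    case True
    then have "j \<noteq> w m" using w_Suc[of m] n by simp
    then have "j = nxt (w m) \<or> j = nxt (nxt (w m))" using nxt.label_cases[of j "w m"] by metis
    then show ?thesis using ex[of m] g_shared[of m] unfolding n by auto
  qed
qed

lemma h_nonzero:
  assumes "avoids_circumcenters T x"
  shows "h n \<noteq> 0"
proof
  assume "h n = 0"
  then have "Im (cnj (u n) * (ctr n - x n)) = 0" unfolding h_def .
  then obtain r where r: "ctr n - x n = r *\<^sub>R u n"
    using Im_cnj_mult_eq_0_imp_scaleR[OF _ u_nonzero] by blast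
  define c where "c = r / cmod (x n - x (n - 1))"
  have "ctr n - x n = c *\<^sub>R (x n - x (n - 1))"
    using r x_neq[of n] by (simp add: c_def u_def sgn_div_norm divide_inverse)
  then have "ctr n = (- c) *\<^sub>R x (n - 1) + (1 + c) *\<^sub>R x n" by (simp add: algebra_simps)
  moreover have "- c + (1 + c) = 1" by simp
  ultimately have "ctr n \<in> affine hull {x (n - 1), x n}" unfolding affine_hull_2 by blast
  then show False using assms unfolding avoids_circumcenters_def ctr_def by blast
qed

end

section \<open>From points on a circle to positions in an interval\<close>

lemma sin_ge_sin:
  assumes "0 < \<psi>" "\<psi> < pi / 2" "\<psi> \<le> \<theta>" "\<theta> \<le> pi - \<psi>"
  shows "sin \<psi> \<le> sin \<theta>"
proof -
  have "cos (pi / 2 - \<psi>) \<le> cos \<bar>\<theta> - pi / 2\<bar>"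
    by (rule cos_monotone_0_pi_le) (use assms in \<open>auto simp: abs_if\<close>)
  also have "\<dots> = cos (pi / 2 - \<theta>)" by (metis cos_abs_real cos_minus minus_diff_eq)
  finally show ?thesis by (simp add: cos_diff)
qed

lemma sin_le_sin:
  assumes "0 < \<psi>" "\<psi> < pi / 2" "pi - \<psi> \<le> \<theta>" "\<theta> \<le> 2 * pi + \<psi>"
  shows "sin \<theta> \<le> sin \<psi>"
proof -
  have "cos (pi / 2 + \<psi>) \<le> cos \<bar>\<theta> - 3 / 2 * pi\<bar>"
    by (rule cos_monotone_0_pi_le) (use assms in \<open>auto simp: abs_if\<close>)
  also have "\<dots> = cos (\<theta> - pi - pi / 2)" by (simp add: algebra_simps)
  also have "\<dots> = - sin \<theta>" by (subst cos_diff) (simp add: sin_diff)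
  finally show ?thesis by (simp add: cos_add)
qed

lemma Arg_eqI:
  assumes "v = of_real r * cis t" "r > 0" "- pi < t" "t \<le> pi"
  shows "Arg v = t"
  using assms by (intro Arg_unique[of r]) (simp_all add: cis_conv_exp)

context label_rotation
begin

text \<open>A chord at height \<open>\<eta> = R * sin \<psi>\<close> cuts off the arc of arguments
  between \<psi> and \<pi> - \<psi>. Of each crossed side one end lies on this arc, and the third
  vertex of the next tile decides which side is crossed next. Only the first two alternatives of
  \<open>contour\<close> arise here; the third one can appear after a reduction.\<close>

lemma circle_contour:
  fixes y :: "int \<Rightarrow> label \<Rightarrow> complex"
  assumes norm: "\<And>n j. cmod (y n j) = R" and "R > 0" "0 < \<eta>"
    and shared: "\<And>n. y (n + 1) (f (f (w n))) = - cnj (y n (f (w n)))"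
      "\<And>n. y (n + 1) (f (w n)) = - cnj (y n (f (f (w n))))"
    and rotate: "\<And>n i. y n (f (f i)) = cis (a i) * y n (f i)"
    and inside: "\<And>n. Im (y n (f (w n))) > \<eta>" and outside: "\<And>n. Im (y n (f (f (w n)))) < \<eta>"
    and generic: "\<And>n j. Im (y n j) \<noteq> \<eta>"
    and pos: "\<And>i. a i > 0" and sum: "a LA + a LB + a LC = 2 * pi"
  shows "contour a (pi - 2 * arcsin (\<eta> / R)) (\<lambda>n. Arg (y (n + 1) (f (f (w n)))) - arcsin (\<eta> / R)) w"
    and "0 < arcsin (\<eta> / R)"
proof -
  define \<psi> where "\<psi> = arcsin (\<eta> / R)"
  have "\<eta> < R" using inside[of 0] norm[of 0 "f (w 0)"] abs_Im_le_cmod[of "y 0 (f (w 0))"] by linarith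
  then have q: "0 < \<eta> / R" "\<eta> / R < 1" using \<open>R > 0\<close> \<open>0 < \<eta>\<close> by auto
  have \<eta>: "\<eta> = R * sin \<psi>" using q \<open>R > 0\<close> by (simp add: \<psi>_def)
  have \<psi>: "0 < \<psi>" "\<psi> < pi / 2"
    using q arcsin_less_arcsin[of 0 "\<eta> / R"] arcsin_less_arcsin[of "\<eta> / R" 1] by (auto simp: \<psi>_def)
  then show "0 < arcsin (\<eta> / R)" by (simp add: \<psi>_def)
  define A where "A n = Arg (y (n + 1) (f (f (w n))))" for n
  have yA: "y (n + 1) (f (f (w n))) = of_real R * cis (A n)" for n
    using rcis_cmod_Arg[of "y (n + 1) (f (f (w n)))"] norm by (simp add: A_def rcis_def)
  have Im: "Im (of_real R * cis t) = R * sin t" for t by simp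
  have black: "Im (y (n + 1) (f (f (w n)))) > \<eta>" for n using shared(1) inside by simp
  have white: "Im (y (n + 1) (f (w n))) < \<eta>" for n using shared(2) outside by simp
  have A: "\<psi> < A n" "A n < pi - \<psi>" for n
  proof -
    have s: "sin \<psi> < sin (A n)" using black[of n] unfolding yA Im \<eta> using \<open>R > 0\<close> by simp
    have "Im (y (n + 1) (f (f (w n)))) > 0" using black[of n] \<open>0 < \<eta>\<close> by simp
    then have "0 < A n" "A n < pi" using Arg_lt_pi by (auto simp: A_def)
    then show "\<psi> < A n" using sin_le_sin[OF \<psi>, of "A n + 2 * pi"] s \<psi> by fastforce
    show "A n < pi - \<psi>" using sin_le_sin[OF \<psi>, of "A n"] s \<psi> \<open>A n < pi\<close> by fastforce
  qed
  \<comment> \<open>Passing to the next tile reflects the arc, which is why positions are measured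
    from alternating ends.\<close>
  have reflect: "A (n + 1) = pi - t"
    if "y (n + 1) (f (w (n + 1))) = of_real R * cis t" "\<psi> < t" "t < pi - \<psi>" for n t
  proof -
    have "y (n + 1 + 1) (f (f (w (n + 1)))) = - cnj (of_real R * cis t)"
      unfolding shared(1) that(1) ..
    also have "\<dots> = of_real R * cis (pi - t)" by (simp add: complex_eq_iff)
    finally show ?thesis
      unfolding A_def using that \<psi> \<open>R > 0\<close> by (intro Arg_eqI[where r = R]) auto
  qed
  have "contour a (pi - 2 * \<psi>) (\<lambda>n. A n - \<psi>) w"
    unfolding contour_def Let_def
  proof (intro allI conjI)
    fix n
    show "0 < A n - \<psi>" "A n - \<psi> < pi - 2 * \<psi>" using A[of n] by auto
    define i where "i = f (w n)"
    define k where "k = f i"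
    have fs: "f (w n) = i" "f i = k" "f k = w n" by (simp_all add: i_def k_def)
    have third: "y (n + 1) (w n) = of_real R * cis (A n + a i)"
      using rotate[of "n + 1" i] yA[of n] by (simp add: fs cis_mult[symmetric] ac_simps)
    have last: "y (n + 1) i = of_real R * cis (A n + a i + a k)"
      using rotate[of "n + 1" k] third by (simp add: fs cis_mult[symmetric] ac_simps)
    have sum_i: "a (w n) + a i + a k = 2 * pi"
      using sum sum_labels[of a "w n"] by (simp add: fs)
    have last_white: "sin (A n + a i + a k) < sin \<psi>"
      using white[of n] \<open>R > 0\<close> unfolding fs last Im \<eta> by simp
    have cases: "j = w n \<or> j = i \<or> j = k" for j
      using label_cases[of j "w n"] fs by metis
    have black_k: "Im (y (n + 1) k) > \<eta>" and white_i: "Im (y (n + 1) i) < \<eta>"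
      using black[of n] white[of n] by (simp_all add: fs)
    show "(A n - \<psi> + a (f (w n)) > pi - 2 * \<psi> \<and> w (n + 1) = f (w n) \<and>
        A (n + 1) - \<psi> = pi - 2 * \<psi> - (A n - \<psi>)) \<or>
      (A n - \<psi> + a (f (w n)) < pi - 2 * \<psi> \<and> A n - \<psi> + a (f (w n)) + a (f (f (w n))) > pi - 2 * \<psi> \<and>
        w (n + 1) = f (f (w n)) \<and> A (n + 1) - \<psi> = pi - 2 * \<psi> - (A n - \<psi>) - a (f (w n))) \<or>
      (A n - \<psi> + a (f (w n)) + a (f (f (w n))) < pi - 2 * \<psi> \<and> w (n + 1) = w n \<and>
        A (n + 1) - \<psi> = pi - 2 * \<psi> - (A n - \<psi>) - a (f (w n)) - a (f (f (w n))))"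
    proof (cases "Im (y (n + 1) (w n)) < \<eta>")
      case True
      then have "sin (A n + a i) < sin \<psi>" using \<open>R > 0\<close> unfolding third Im \<eta> by simp
      then have "A n + a i > pi - \<psi>"
        using sin_ge_sin[OF \<psi>, of "A n + a i"] A(1)[of n] pos[of i] by fastforce
      moreover have "f (w (n + 1)) = k"
        using inside[of "n + 1"] cases[of "f (w (n + 1))"] True white_i by auto
      then have "w (n + 1) = i" using fs by (metis f_eq_iff)
      moreover have "A (n + 1) = pi - A n"
        by (rule reflect) (use \<open>f (w (n + 1)) = k\<close> yA[of n] A[of n] fs in auto)
      ultimately show ?thesis unfolding fs by auto
    next
      case False
      then have third_black: "Im (y (n + 1) (w n)) > \<eta>" using generic[of "n + 1" "w n"] by simp
      then have s: "sin \<psi> < sin (A n + a i)" using \<open>R > 0\<close> unfolding third Im \<eta> by simp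
      text \<open>If the third vertex were beyond a full turn, the second endpoint of the entered side
        would lie in the arc as well.\<close>
      have lt: "A n + a i < pi - \<psi>"
      proof (rule ccontr)
        assume "\<not> ?thesis"
        then have "2 * pi + \<psi> < A n + a i" using sin_le_sin[OF \<psi>, of "A n + a i"] s by fastforce
        then have "sin \<psi> \<le> sin (A n + a i + a k - 2 * pi)"
          using A(2)[of n] pos[of k] pos[of "w n"] sum_i by (intro sin_ge_sin[OF \<psi>]) auto
        also have "\<dots> = sin (A n + a i + a k)" by (simp add: sin_diff)
        finally show False using last_white by simp
      qed
      moreover have "A n + a i + a k > pi - \<psi>"
        using sin_ge_sin[OF \<psi>, of "A n + a i + a k"] A(1)[of n] pos[of i] pos[of k] last_white
        by fastforce
      moreover have "f (f (w (n + 1))) = i"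
        using outside[of "n + 1"] cases[of "f (f (w (n + 1)))"] third_black black_k by auto
      then have wk: "w (n + 1) = k" using fs by (metis f3)
      moreover have "A (n + 1) = pi - (A n + a i)"
        by (rule reflect) (use wk fs third lt A(1)[of n] pos[of i] in auto)
      ultimately show ?thesis unfolding fs by auto
    qed
  qed
  then show "contour a (pi - 2 * arcsin (\<eta> / R)) (\<lambda>n. Arg (y (n + 1) (f (f (w n)))) - arcsin (\<eta> / R)) w"
    unfolding A_def \<psi>_def .
qed

end

lemma label_rotation_nxt_nxt: "label_rotation (\<lambda>i. nxt (nxt i))"
  by standard simp_all

text \<open>
  The reflections bringing the minor arc cut off by the trajectory to the top of the circle and
  the rotation along the vertices of the tiles to the positive sense.
\<close>

lemma normalizing_symmetry:
  fixes o1 s :: real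
  assumes "o1 = 1 \<or> o1 = - 1" "s = 1 \<or> s = - 1"
  obtains N :: "complex \<Rightarrow> complex" where "\<And>v. N (- cnj v) = - cnj (N v)"
    "\<And>t v. N (cis (o1 * t) * v) = cis t * N v" "\<And>v. Im (N v) = s * Im v" "\<And>v. cmod (N v) = cmod v"
proof -
  consider "o1 = 1" "s = 1" | "o1 = - 1" "s = 1" | "o1 = 1" "s = - 1" | "o1 = - 1" "s = - 1"
    using assms by blast
  then show ?thesis
  proof cases
    case 1 show ?thesis by (rule that[of "\<lambda>v. v"]) (simp_all add: 1)
  next
    case 2 show ?thesis by (rule that[of "\<lambda>v. - cnj v"]) (simp_all add: 2 cis_cnj)
  next
    case 3 show ?thesis by (rule that[of "\<lambda>v. - v"]) (simp_all add: 3)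
  next
    case 4 show ?thesis by (rule that[of cnj]) (simp_all add: 4 cis_cnj)
  qed
qed

section \<open>Trajectories as contours\<close>

context tiling_trajectory
begin

text \<open>All tiles carry their labels in the same cyclic order, so \<open>nxt (w n)\<close> is
  always on the same hand of the path. Hence one cyclic order \<open>f\<close> serves the whole
  trajectory.\<close>

lemma exit_side_const:
  assumes "s \<noteq> 0"
  shows "s * g n (nxt (w n)) < 0 \<longleftrightarrow> s * g 0 (nxt (w 0)) < 0"
proof -
  define black where "black n j \<longleftrightarrow> s * g n j < 0" for n j
  have ex: "black n (nxt (w n)) \<longleftrightarrow> \<not> black n (nxt (nxt (w n)))" for n
    using g_exit_signs[of n] assms unfolding black_def
    by (auto simp: mult_less_0_iff zero_less_mult_iff)
  have sh: "black (n + 1) (nxt (w n)) \<longleftrightarrow> black n (nxt (nxt (w n)))"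
    "black (n + 1) (nxt (nxt (w n))) \<longleftrightarrow> black n (nxt (w n))" for n
    by (simp_all add: black_def g_shared)
  have step: "black (n + 1) (nxt (w (n + 1))) \<longleftrightarrow> black n (nxt (w n))" for n
  proof -
    have "w (n + 1) = nxt (w n) \<or> w (n + 1) = nxt (nxt (w n))"
      using nxt.label_cases[of "w (n + 1)" "w n"] w_Suc[of n] by metis
    then show ?thesis
      using ex[of n] ex[of "n + 1"] sh[of n] by auto
  qed
  have "black n (nxt (w n)) \<longleftrightarrow> black 0 (nxt (w 0))"
  proof (induction n rule: int_induct[where k = 0])
    case (step1 n)
    then show ?case using step by simp
  next
    case (step2 n)
    then show ?case using step[of "n - 1"] by simp
  qed simp
  then show ?thesis by (simp add: black_def)
qed

lemma trajectory_outcome: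
  assumes avoids: "avoids_circumcenters T x"
  obtains Y where "outcome Y w" "finite (range u) \<Longrightarrow> finite (range Y)"
proof -
  define h0 where "h0 = h 0"
  have h0: "h0 \<noteq> 0" using h_nonzero[OF avoids] by (simp add: h0_def)
  have g0: "g n j = Im (z n j) + h0" for n j using h_const[of n] by (simp add: g_eq h0_def)
  \<comment> \<open>Chosen so that \<open>f (w n)\<close> is the end of the crossed side that the
    path separates from the circumcenter; \<open>o1\<close> is the sense of rotation belonging to
    \<open>f\<close>.\<close>
  define f where "f = (if h0 * g 0 (nxt (w 0)) < 0 then nxt else (\<lambda>i. nxt (nxt i)))"
  define o1 where "o1 = (if h0 * g 0 (nxt (w 0)) < 0 then sgn (area D) else - sgn (area D))"
  interpret f: label_rotation f
    using nxt.label_rotation_axioms label_rotation_nxt_nxt by (simp add: f_def)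
  have "sgn (area D) = 1 \<or> sgn (area D) = - 1"
    using area_nonzero[OF nondegenerate] by (auto simp: sgn_if)
  then have "o1 = 1 \<or> o1 = - 1" by (auto simp: o1_def)
  moreover have "- sgn h0 = 1 \<or> - sgn h0 = - 1" using h0 by (auto simp: sgn_if)
  ultimately obtain N :: "complex \<Rightarrow> complex" where N: "\<And>v. N (- cnj v) = - cnj (N v)"
    "\<And>t v. N (cis (o1 * t) * v) = cis t * N v" "\<And>v. Im (N v) = - sgn h0 * Im v"
    "\<And>v. cmod (N v) = cmod v"
    by (rule normalizing_symmetry[of o1 "- sgn h0"]) blast
  define y where "y n j = N (z n j)" for n j
  define a where "a = (\<lambda>j. 2 * tile_angle D j)"
  have black: "h0 * g n (f (w n)) < 0" and white: "h0 * g n (f (f (w n))) > 0" for n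
  proof -
    have "g n (nxt (w n)) * g n (nxt (nxt (w n))) < 0" by (rule g_exit_signs)
    moreover have "h0 * h0 > 0" using h0 not_real_square_gt_zero by blast
    ultimately have "(h0 * h0) * (g n (nxt (w n)) * g n (nxt (nxt (w n)))) < 0"
      by (rule mult_pos_neg[rotated])
    then have "(h0 * g n (nxt (w n))) * (h0 * g n (nxt (nxt (w n)))) < 0" by (simp only: ac_simps)
    then have "h0 * g n (nxt (w n)) < 0 \<and> h0 * g n (nxt (nxt (w n))) > 0 \<or>
        h0 * g n (nxt (w n)) > 0 \<and> h0 * g n (nxt (nxt (w n))) < 0"
      by (simp only: mult_less_0_iff) blast
    then show "h0 * g n (f (w n)) < 0" "h0 * g n (f (f (w n))) > 0"
      using exit_side_const[OF h0, of n] by (auto simp: f_def)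
  qed
  have Im_y: "h0 * g n j = \<bar>h0\<bar> * (\<bar>h0\<bar> - Im (y n j))" for n j
    using h0 by (cases "h0 > 0") (auto simp: y_def N g0 algebra_simps)
  have pos: "a i > 0" for i using tile_angle_polar(2)[OF nondegenerate refl refl, of i] by (simp add: a_def)
  have sum: "a LA + a LB + a LC = 2 * pi" using tile_angle_sum[OF nondegenerate] by (simp add: a_def)
  define \<psi> where "\<psi> = arcsin (\<bar>h0\<bar> / R)"
  define Y where "Y = (\<lambda>n. Arg (y (n + 1) (f (f (w n)))) - \<psi>)"
  have "f.contour a (pi - 2 * arcsin (\<bar>h0\<bar> / R))
      (\<lambda>n. Arg (y (n + 1) (f (f (w n)))) - arcsin (\<bar>h0\<bar> / R)) w \<and> 0 < arcsin (\<bar>h0\<bar> / R)"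
  proof (intro conjI)
    have 1: "cmod (y n j) = R" for n j by (simp add: y_def N cmod_z)
    have 2: "y (n + 1) (f (f (w n))) = - cnj (y n (f (w n)))" for n
      by (simp add: y_def f_def z_shared N)
    have 3: "y (n + 1) (f (w n)) = - cnj (y n (f (f (w n))))" for n
      by (simp add: y_def f_def z_shared N)
    have 4: "y n (f (f i)) = cis (a i) * y n (f i)" for n i
    proof (cases "h0 * g 0 (nxt (w 0)) < 0")
      case True
      then show ?thesis
        using N(2)[of "a i" "z n (nxt i)"] z_rotate[of n i]
        by (simp add: y_def f_def o1_def a_def mult.left_commute)
    next
      case False
      have "z n (nxt i) = cis (- sgn (area D) * a i) * z n (nxt (nxt i))"
        unfolding z_rotate[of n i] by (simp add: a_def cis_mult mult.assoc[symmetric])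
      then show ?thesis
        using False N(2)[of "a i" "z n (nxt (nxt i))"]
        by (simp add: y_def f_def o1_def)
    qed
    have 5: "Im (y n (f (w n))) > \<bar>h0\<bar>" for n
      using black[of n] h0 unfolding Im_y by (simp add: mult_less_0_iff)
    have 6: "Im (y n (f (f (w n)))) < \<bar>h0\<bar>" for n
      using white[of n] h0 unfolding Im_y by (simp add: zero_less_mult_iff)
    have 7: "Im (y n j) \<noteq> \<bar>h0\<bar>" for n j
      using Im_y[of n j] g_nonzero[of n j] h0 by auto
    have 8: "0 < \<bar>h0\<bar>" using h0 by simp
    note c = f.circle_contour[of y R "\<bar>h0\<bar>" w a, OF 1 R_pos 8 2 3 4 5 6 7 pos sum]
    show "f.contour a (pi - 2 * arcsin (\<bar>h0\<bar> / R))
      (\<lambda>n. Arg (y (n + 1) (f (f (w n)))) - arcsin (\<bar>h0\<bar> / R)) w" by (rule c)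
    show "0 < arcsin (\<bar>h0\<bar> / R)" by (rule c)
  qed
  then have C: "f.contour a (pi - 2 * \<psi>) Y w" and "\<psi> > 0" by (simp_all add: Y_def \<psi>_def)
  have "outcome Y w"
  proof (rule f.contour_outcome[OF C pos])
    show "rat_indep a" unfolding a_def by (rule rat_indep_angles[OF independent])
    \<comment> \<open>The excess is \<open>4 * \<psi>\<close>, positive because the path misses the
      circumcenters.\<close>
    show "a LA + a LB + a LC > 2 * (pi - 2 * \<psi>)" using sum \<open>\<psi> > 0\<close> by simp
  qed
  \<comment> \<open>\<open>Y n\<close> depends only on a direction, an orientation sign and a label,
    so infinitely many positions require infinitely many directions.\<close>
  moreover have "finite (range Y)" if "finite (range u)"
  proof -
    have UNIV: "(UNIV :: label set) = {LA, LB, LC}" using label.exhaust by auto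
    have "range Y \<subseteq> (\<lambda>(v, c, j). Arg (N (cnj v * (c * d j))) - \<psi>) ` (range u \<times> {1, - 1} \<times> {LA, LB, LC})"
    proof
      fix r assume "r \<in> range Y"
      then obtain n where "r = Y n" by blast
      then have "r = (\<lambda>(v, c, j). Arg (N (cnj v * (c * d j))) - \<psi>) (u (n + 1), e (n + 1), f (f (w n)))"
        by (simp add: Y_def y_def z_def)
      moreover have "(u (n + 1), e (n + 1), f (f (w n))) \<in> range u \<times> {1, - 1} \<times> {LA, LB, LC}"
        using UNIV by (auto simp: e_def)
      ultimately show "r \<in> (\<lambda>(v, c, j). Arg (N (cnj v * (c * d j))) - \<psi>) `
          (range u \<times> {1, - 1} \<times> {LA, LB, LC})" by blast
    qed
    then show ?thesis by (rule finite_subset) (use that in simp)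
  qed
  ultimately show ?thesis by (rule that)
qed

end

section \<open>Lattice translates of tiles\<close>

context tiling_trajectory
begin

text \<open>With the symmetric product \<Delta> the factor of a single refraction is, up to a power
  of \<open>R\<close>, the quotient of \<Delta> by \<open>d (w n)\<close>. Two conjugations in a row
  cancel \<Delta> and leave a rotation given by the two crossed labels.\<close>

lemma u_Suc2: "u (n + 2) * d (w (n + 1)) = u n * d (w n)"
proof -
  define \<Delta> where "\<Delta> = d LA * d LB * d LC"
  define r where "r = complex_of_real (R\<^sup>2)"
  have r0: "r \<noteq> 0" using R_pos by (simp add: r_def)
  have D: "d i * (d (nxt i) * d (nxt (nxt i))) = \<Delta>" for i
    by (cases i) (simp_all add: \<Delta>_def)
  have DD: "\<Delta> * cnj \<Delta> = r * r * r"
  proof -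
    have "\<Delta> * cnj \<Delta> = (d LA * cnj (d LA)) * (d LB * cnj (d LB)) * (d LC * cnj (d LC))"
      by (simp add: \<Delta>_def ac_simps)
    then show ?thesis unfolding d_cnj r_def .
  qed
  have 1: "d (w n) * (u (n + 1) * r) = \<Delta> * cnj (u n)" for n
    using D[of "w n"] u_Suc[of n] by (simp add: r_def mult.assoc[symmetric])
  have "cnj (d (w n) * (u (n + 1) * r)) = cnj (\<Delta> * cnj (u n))" unfolding 1 ..
  then have 2: "cnj (d (w n)) * (cnj (u (n + 1)) * r) = cnj \<Delta> * u n" by (simp add: r_def)
  have 3: "d (w (n + 1)) * (u (n + 2) * r) = \<Delta> * cnj (u (n + 1))"
    using 1[of "n + 1"] by (simp add: add.assoc)
  have dr: "d (w n) * cnj (d (w n)) = r" unfolding r_def by (rule d_cnj)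
  have "(r * r * r) * (u (n + 2) * d (w (n + 1))) =
      (d (w (n + 1)) * (u (n + 2) * r)) * r * (d (w n) * cnj (d (w n)))"
    unfolding dr by (simp only: ac_simps)
  also have "\<dots> = \<Delta> * d (w n) * (cnj (d (w n)) * (cnj (u (n + 1)) * r))"
    unfolding 3 by (simp only: ac_simps)
  also have "\<dots> = (r * r * r) * (u n * d (w n))" unfolding 2 DD[symmetric] by (simp only: ac_simps)
  finally show ?thesis using r0 by (simp only: mult_cancel_left mult_eq_0_iff) simp
qed

lemma ctr_Suc2: "ctr (n + 2) = ctr n + e n * (d (w (n + 1)) - d (w n))"
proof -
  define S where "S = d LA + d LB + d LC"
  have S: "d (nxt i) + d (nxt (nxt i)) = S - d i" for i by (cases i) (simp_all add: S_def)
  have "ctr (n + 2) = ctr (n + 1 + 1)" by (simp add: add.assoc)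
  also have "\<dots> = ctr n + e n * (S - d (w n)) - e n * (S - d (w (n + 1)))"
    unfolding ctr_Suc S e_Suc by simp
  finally show ?thesis by (simp add: algebra_simps)
qed

definition lattice_vec :: "int \<Rightarrow> int \<Rightarrow> complex" where
  "lattice_vec p q = of_int p * (d LB - d LA) + of_int q * (d LC - d LA)"

text \<open>By the inscribed angles, \<open>d LB\<close> and \<open>d LC\<close> arise from
  \<open>d LA\<close> by the turns assigned to the two basis vectors; the definition extends these
  additively to the lattice.\<close>

definition lattice_angle :: "int \<Rightarrow> int \<Rightarrow> real" where
  "lattice_angle p q = 2 * sgn (area D) * (of_int p * tile_angle D LC - of_int q * tile_angle D LB)"

definition coordB :: "label \<Rightarrow> int" where "coordB j = (if j = LB then 1 else 0)"
definition coordC :: "label \<Rightarrow> int" where "coordC j = (if j = LC then 1 else 0)"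

lemma lattice_vec_add: "lattice_vec (p + p') (q + q') = lattice_vec p q + lattice_vec p' q'"
  and lattice_vec_diff: "lattice_vec (p - p') (q - q') = lattice_vec p q - lattice_vec p' q'"
  by (simp_all add: lattice_vec_def algebra_simps)

lemma lattice_angle_add: "lattice_angle (p + p') (q + q') = lattice_angle p q + lattice_angle p' q'"
  and lattice_angle_diff: "lattice_angle (p - p') (q - q') = lattice_angle p q - lattice_angle p' q'"
  by (simp_all add: lattice_angle_def algebra_simps)

lemma d_lattice: "d j = d LA + lattice_vec (coordB j) (coordC j)"
  by (cases j) (simp_all add: lattice_vec_def coordB_def coordC_def)

lemma d_angle: "d j = d LA * cis (lattice_angle (coordB j) (coordC j))"
proof (cases j)
  case LB
  then show ?thesis
    using d_rotate[of LC] by (simp add: lattice_angle_def coordB_def coordC_def ac_simps)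
next
  case LC
  have "d LA = cis (2 * (sgn (area D) * tile_angle D LB)) * d LC" using d_rotate[of LB] by simp
  then have "d LA * cis (- (2 * (sgn (area D) * tile_angle D LB))) = d LC"
    by (simp add: mult.commute[of _ "d LC"] mult.assoc cis_mult)
  then show ?thesis using LC by (simp add: lattice_angle_def coordB_def coordC_def ac_simps)
qed (simp add: lattice_angle_def coordB_def coordC_def)

text \<open>Displacement between tiles of one orientation and turn of the direction are read off
  from the same two integers. This is the affine dependence on the lattice point.\<close>

definition reaches :: "int \<Rightarrow> int \<Rightarrow> int \<Rightarrow> int \<Rightarrow> bool" where
  "reaches m n p q \<longleftrightarrow> ctr n = ctr m + e m * lattice_vec p q \<and> u n = u m * cis (- lattice_angle p q)"

lemma reaches_Suc2:
  assumes "even (n - m)"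
  shows "reaches m n p q \<longleftrightarrow> reaches m (n + 2)
    (p + (coordB (w (n + 1)) - coordB (w n))) (q + (coordC (w (n + 1)) - coordC (w n)))"
proof -
  define B C where "B = coordB (w (n + 1)) - coordB (w n)" and "C = coordC (w (n + 1)) - coordC (w n)"
  have em: "e n = e m" using assms by (auto simp: e_def)
  have vec: "d (w (n + 1)) - d (w n) = lattice_vec B C"
    unfolding B_def C_def lattice_vec_diff using d_lattice[of "w (n + 1)"] d_lattice[of "w n"] by simp
  have c: "ctr (n + 2) = ctr n + e m * lattice_vec B C" unfolding ctr_Suc2 em vec ..
  have "u (n + 2) * (d LA * cis (lattice_angle (coordB (w (n + 1))) (coordC (w (n + 1))))) =
      u n * (d LA * cis (lattice_angle (coordB (w n)) (coordC (w n))))"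
    using u_Suc2[of n] d_angle[of "w (n + 1)"] d_angle[of "w n"] by simp
  then have "u (n + 2) * cis (lattice_angle (coordB (w (n + 1))) (coordC (w (n + 1)))) =
      u n * cis (lattice_angle (coordB (w n)) (coordC (w n)))"
    by (simp add: mult.left_commute)
  then have "u (n + 2) * cis (lattice_angle (coordB (w (n + 1))) (coordC (w (n + 1)))) *
        cis (- lattice_angle (coordB (w (n + 1))) (coordC (w (n + 1)))) =
      u n * cis (lattice_angle (coordB (w n)) (coordC (w n))) *
        cis (- lattice_angle (coordB (w (n + 1))) (coordC (w (n + 1))))" by simp
  then have U: "u (n + 2) = u n * cis (- lattice_angle B C)"
    by (simp add: mult.assoc cis_mult B_def C_def lattice_angle_diff)
  have "reaches m (n + 2) (p + B) (q + C) \<longleftrightarrow>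
      ctr n + e m * lattice_vec B C = ctr m + e m * lattice_vec p q + e m * lattice_vec B C \<and>
      u n * cis (- lattice_angle B C) = u m * cis (- lattice_angle p q) * cis (- lattice_angle B C)"
    unfolding reaches_def c U lattice_vec_add lattice_angle_add
    by (simp add: algebra_simps cis_mult)
  also have "\<dots> \<longleftrightarrow> reaches m n p q" unfolding reaches_def by auto
  finally show ?thesis unfolding B_def C_def by blast
qed

lemma even_reaches:
  assumes "even (n - m)"
  shows "\<exists>p q. reaches m n p q"
proof -
  have "\<exists>p q. reaches m (m + 2 * k) p q" for k :: int
  proof (induction k rule: int_induct[where k = 0])
    case base
    have "reaches m m 0 0" by (simp add: reaches_def lattice_vec_def lattice_angle_def)
    then show ?case by auto
  next
    case (step1 k)
    then obtain p q where "reaches m (m + 2 * k) p q" by blast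
    then have "\<exists>p q. reaches m (m + 2 * k + 2) p q" using reaches_Suc2[of "m + 2 * k" m p q] by auto
    then show ?case by (simp add: algebra_simps)
  next
    case (step2 k)
    define l where "l = m + 2 * (k - 1)"
    have l: "l + 2 = m + 2 * k" "even (l - m)" by (auto simp: l_def)
    from step2 obtain p q where "reaches m (l + 2) p q" unfolding l by blast
    then have "reaches m l (p - (coordB (w (l + 1)) - coordB (w l))) (q - (coordC (w (l + 1)) - coordC (w l)))"
      using reaches_Suc2[OF l(2)] by (simp only: diff_add_cancel)
    then show ?case unfolding l_def by blast
  qed
  from this[of "(n - m) div 2"] show ?thesis using assms by simp
qed

lemma lattice_vec_eq_0:
  assumes "of_real r * (d LB - d LA) + of_real s * (d LC - d LA) = 0"
  shows "r = 0" "s = 0"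
  using sides_independent[OF nondegenerate, of r s] assms by (simp_all add: d_def)

text \<open>The turn is an integer combination of the angles that vanishes modulo \<pi>; replacing
  \<pi> by the sum of the angles makes this a relation that independence forbids unless it is
  trivial. Squares are taken because parallel segments may be traversed in opposite senses.\<close>

lemma same_tile_if_parallel:
  assumes "even (n - m)" "(u n)\<^sup>2 = (u m)\<^sup>2"
  shows "ctr n = ctr m"
proof -
  obtain p q where pq: "reaches m n p q" using even_reaches[OF assms(1)] by blast
  then have "(u m)\<^sup>2 * (cis (- lattice_angle p q))\<^sup>2 = (u m)\<^sup>2 * 1"
    using assms(2) by (simp add: reaches_def power_mult_distrib)
  then have "(cis (- lattice_angle p q))\<^sup>2 = 1" by (simp only: mult_cancel_left) simp
  then have "cis (2 * (- lattice_angle p q)) = 1" by (simp add: power2_eq_square cis_mult)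
  then have "Re (cis (2 * (- lattice_angle p q))) = 1" by simp
  then have "cos (2 * lattice_angle p q) = 1" by simp
  moreover have "sgn (area D) = 1 \<or> sgn (area D) = - 1"
    using area_nonzero[OF nondegenerate] by (auto simp: sgn_if)
  moreover define \<phi> where "\<phi> = 4 * (of_int p * tile_angle D LC - of_int q * tile_angle D LB)"
  have "2 * lattice_angle p q = sgn (area D) * \<phi>" by (simp add: lattice_angle_def \<phi>_def)
  ultimately have "cos \<phi> = 1" by auto
  then obtain l :: int where
    l: "4 * (of_int p * tile_angle D LC - of_int q * tile_angle D LB) = of_int l * 2 * pi"
    unfolding cos_one_2pi_int \<phi>_def by blast
  define k where "k j = (case j of LA \<Rightarrow> - l | LB \<Rightarrow> - 2 * q - l | LC \<Rightarrow> 2 * p - l)" for j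
  have "of_int (k LA) * (2 * tile_angle D LA) + of_int (k LB) * (2 * tile_angle D LB)
      + of_int (k LC) * (2 * tile_angle D LC) =
      4 * (of_int p * tile_angle D LC - of_int q * tile_angle D LB) -
      of_int l * 2 * (tile_angle D LA + tile_angle D LB + tile_angle D LC)"
    by (simp add: k_def algebra_simps)
  also have "\<dots> = 0" unfolding tile_angle_sum[OF nondegenerate] l by simp
  finally have k0: "k j = 0" for j
    using rat_indep_angles[OF independent] unfolding rat_indep_def by blast
  have "l = 0" "q = 0" "p = 0" using k0[of LA] k0[of LB] k0[of LC] by (simp_all add: k_def)
  then show ?thesis using pq by (simp add: reaches_def lattice_vec_def)
qed

lemma same_direction_if_same_tile:
  assumes "even (n - m)" "ctr n = ctr m"
  shows "u n = u m"
proof -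
  obtain p q where pq: "reaches m n p q" using even_reaches[OF assms(1)] by blast
  then have "lattice_vec p q = 0" using assms(2) by (simp add: reaches_def)
  then have "of_real (real_of_int p) * (d LB - d LA) + of_real (real_of_int q) * (d LC - d LA) = 0"
    by (simp add: lattice_vec_def)
  from lattice_vec_eq_0[OF this] have "p = 0" "q = 0" by simp_all
  then show ?thesis using pq by (simp add: reaches_def lattice_angle_def)
qed

lemma T_in_cball: "T n j \<in> cball (ctr n) R"
  by (simp add: T_eq dist_norm norm_mult cmod_d)

lemma x_in_cball: "x n \<in> cball (ctr n) R" "x n \<in> cball (ctr (n + 1)) R"
proof -
  have "x n \<in> closed_segment (T n (nxt (w n))) (T n (nxt (nxt (w n))))"
    using x_side[of n] unfolding side_interior_def open_segment_def by blast
  moreover have "x n \<in> closed_segment (T (n + 1) (nxt (w n))) (T (n + 1) (nxt (nxt (w n))))"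
    using x_side[of n] closed_segment_commute
    unfolding side_interior_def open_segment_def T_Suc neighbour_swap by blast
  ultimately show "x n \<in> cball (ctr n) R" "x n \<in> cball (ctr (n + 1)) R"
    using closed_segment_subset[OF T_in_cball T_in_cball convex_cball] by blast+
qed

lemma segment_in_cball: "closed_segment (x n) (x (n + 1)) \<subseteq> cball (ctr (n + 1)) R"
  by (rule closed_segment_subset[OF x_in_cball(2) x_in_cball(1) convex_cball])

text \<open>
  Distant translates of a segment of a drift-periodic trajectory lie in different tiles, but in
  tiles of the same orientation parallel segments do not occur.
\<close>

lemma translate_parallel_segment:
  assumes "(\<lambda>p. p + v) ` polyline x = polyline x"
  shows "\<exists>m p. p \<in> closed_segment (x 0) (x 1) \<and> p + v \<in> closed_segment (x m) (x (m + 1)) \<and>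
    (u (m + 1))\<^sup>2 = (u 1)\<^sup>2"
proof -
  define S where "S = (\<lambda>p. p + v) ` closed_segment (x 0) (x 1)"
  have x01: "x 0 \<noteq> x 1" using x_neq[of 1] by auto
  have "closed_segment (x 0) (x (0 + 1)) \<subseteq> polyline x" unfolding polyline_def by blast
  then have "S \<subseteq> polyline x" unfolding S_def using assms by auto
  then have S: "S = (\<Union>m. S \<inter> closed_segment (x m) (x (m + 1)))" unfolding polyline_def by blast
  have "uncountable S"
  proof
    assume "countable S"
    then have "countable ((\<lambda>p. p - v) ` S)" by simp
    moreover have "(\<lambda>p. p - v) ` S = closed_segment (x 0) (x 1)" by (simp add: S_def image_image)
    ultimately show False using uncountable_closed_segment[OF x01] by simp
  qed
  \<comment> \<open>Countably many segments cover an uncountable set, so one of them meets it in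
    infinitely many points; two common points already fix the direction up to sign.\<close>
  then obtain m :: int where inf: "infinite (S \<inter> closed_segment (x m) (x (m + 1)))"
    using S countable_UN[of UNIV "\<lambda>m. S \<inter> closed_segment (x m) (x (m + 1))"] countable_finite
    by (metis countableI_type)
  let ?A = "S \<inter> closed_segment (x m) (x (m + 1))"
  from inf obtain p1 where p1: "p1 \<in> ?A" using infinite_imp_nonempty by blast
  from inf have "infinite (?A - {p1})" by simp
  then obtain p2 where p2: "p2 \<in> ?A - {p1}" using infinite_imp_nonempty by blast
  have p: "p1 \<in> S \<inter> closed_segment (x m) (x (m + 1))"
    "p2 \<in> S \<inter> closed_segment (x m) (x (m + 1))" "p1 \<noteq> p2" using p1 p2 by auto
  have diff: "\<exists>r :: real. r \<noteq> 0 \<and> a - b = of_real r * u (k + 1)"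
    if ab: "a \<in> closed_segment (x k) (x (k + 1))" "b \<in> closed_segment (x k) (x (k + 1))" "a \<noteq> b" for a b k
  proof -
    obtain s t where st: "a = (1 - s) *\<^sub>R x k + s *\<^sub>R x (k + 1)" "b = (1 - t) *\<^sub>R x k + t *\<^sub>R x (k + 1)"
      using ab(1,2) unfolding in_segment by blast
    have "a - b = of_real (s - t) * (x (k + 1) - x k)"
      unfolding st by (simp add: scaleR_conv_of_real algebra_simps)
    also have "\<dots> = of_real ((s - t) * cmod (x (k + 1) - x k)) * u (k + 1)"
      using x_diff[of "k + 1"] by simp
    finally show ?thesis using ab(3) by (intro exI[of _ "(s - t) * cmod (x (k + 1) - x k)"]) auto
  qed
  obtain q1 q2 where q: "q1 \<in> closed_segment (x 0) (x 1)" "q2 \<in> closed_segment (x 0) (x 1)"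
    "p1 = q1 + v" "p2 = q2 + v" using p by (auto simp: S_def)
  obtain r where r: "r \<noteq> 0" "p1 - p2 = of_real r * u (m + 1)" using diff p by blast
  obtain s where s: "s \<noteq> 0" "q1 - q2 = of_real s * u 1" using diff[of q1 0 q2] q p(3) by auto
  have eq: "of_real r * u (m + 1) = of_real s * u 1" using r s q by simp
  then have "cmod (of_real r * u (m + 1)) = cmod (of_real s * u 1)" by simp
  then have "\<bar>r\<bar> = \<bar>s\<bar>" by (simp add: norm_mult)
  then have rs: "r\<^sup>2 = s\<^sup>2" by (simp add: power2_eq_iff abs_eq_iff)
  have "of_real (r\<^sup>2) * (u (m + 1))\<^sup>2 = (of_real r * u (m + 1))\<^sup>2" by (simp add: power_mult_distrib)
  also have "\<dots> = of_real (r\<^sup>2) * (u 1)\<^sup>2" unfolding eq rs by (simp add: power_mult_distrib)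
  finally have "(u (m + 1))\<^sup>2 = (u 1)\<^sup>2" using r(1) by simp
  then show ?thesis using q p by blast
qed

text \<open>One translate does not suffice, since it may lie in a tile of the opposite orientation.
  Among the original and the translates by \<open>K\<close> and by \<open>2 * K\<close> times
  \<open>v\<close>, two have the same orientation and would lie in the same tile.\<close>

lemma not_drift_periodic: "\<not> drift_periodic x"
proof
  assume "drift_periodic x"
  then obtain v where v: "v \<noteq> 0" "(\<lambda>p. p + v) ` polyline x = polyline x"
    unfolding drift_periodic_def by blast
  have iter: "(\<lambda>p. p + of_nat k * v) ` polyline x = polyline x" for k
  proof (induction k)
    case (Suc k)
    have "(\<lambda>p. p + of_nat (Suc k) * v) ` polyline x = (\<lambda>p. p + v) ` (\<lambda>p. p + of_nat k * v) ` polyline x"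
      by (simp add: image_image algebra_simps)
    then show ?case by (simp only: Suc v(2))
  qed simp
  \<comment> \<open>Comparing the two translates involves four points, each within \<open>R\<close>
    of a circumcenter, hence the bound \<open>4 * R\<close>.\<close>
  obtain K :: nat where "4 * R / cmod v < of_nat K" using reals_Archimedean2 by blast
  then have K: "4 * R < cmod (of_nat K * v)" using v(1) by (simp add: norm_mult field_simps)
  obtain m1 p1 where 1: "p1 \<in> closed_segment (x 0) (x 1)"
    "p1 + of_nat K * v \<in> closed_segment (x m1) (x (m1 + 1))" "(u (m1 + 1))\<^sup>2 = (u 1)\<^sup>2"
    using translate_parallel_segment[OF iter[of K]] by blast
  obtain m2 p2 where 2: "p2 \<in> closed_segment (x 0) (x 1)"
    "p2 + of_nat (2 * K) * v \<in> closed_segment (x m2) (x (m2 + 1))" "(u (m2 + 1))\<^sup>2 = (u 1)\<^sup>2"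
    using translate_parallel_segment[OF iter[of "2 * K"]] by blast
  define V where "V = of_nat K * v"
  have V2: "of_nat (2 * K) * v = V + V" by (simp add: V_def algebra_simps)
  have p: "cmod (p1 - ctr 1) \<le> R" "cmod (p2 - ctr 1) \<le> R"
    using segment_in_cball[of 0] 1(1) 2(1) by (auto simp: dist_norm norm_minus_commute)
  have q: "cmod (p1 + V - ctr (m1 + 1)) \<le> R" "cmod (p2 + (V + V) - ctr (m2 + 1)) \<le> R"
    using segment_in_cball[of m1] segment_in_cball[of m2] 1(2) 2(2) unfolding V2 V_def[symmetric]
    by (auto simp: dist_norm norm_minus_commute)
  have V: "4 * R < cmod V" using K by (simp add: V_def)
  have "even (m1 + 1 - 1) \<or> even (m2 + 1 - 1) \<or> even ((m2 + 1) - (m1 + 1))" by auto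
  then consider "ctr (m1 + 1) = ctr 1" | "ctr (m2 + 1) = ctr 1" | "ctr (m2 + 1) = ctr (m1 + 1)"
    using same_tile_if_parallel 1(3) 2(3) by metis
  then show False
  proof cases
    case 1
    have "V = (p1 + V - ctr (m1 + 1)) - (p1 - ctr 1)" by (simp add: 1)
    then have "cmod V \<le> R + R" using norm_triangle_le_diff[of "p1 + V - ctr (m1 + 1)" "p1 - ctr 1" "R + R"] p q by simp
    then show False using V R_pos by simp
  next
    case 2
    have "V + V = (p2 + (V + V) - ctr (m2 + 1)) - (p2 - ctr 1)" by (simp add: 2)
    then have "cmod (V + V) \<le> R + R"
      using norm_triangle_le_diff[of "p2 + (V + V) - ctr (m2 + 1)" "p2 - ctr 1" "R + R"] p q by simp
    moreover have "cmod (V + V) = 2 * cmod V" by (simp add: norm_mult flip: mult_2)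
    ultimately show False using V R_pos by simp
  next
    case 3
    have "V = ((p2 + (V + V) - ctr (m2 + 1)) - (p1 + V - ctr (m1 + 1))) - ((p2 - ctr 1) - (p1 - ctr 1))"
      by (simp add: 3)
    moreover have "cmod ((p2 + (V + V) - ctr (m2 + 1)) - (p1 + V - ctr (m1 + 1))) \<le> R + R"
      "cmod ((p2 - ctr 1) - (p1 - ctr 1)) \<le> R + R"
      using norm_triangle_le_diff p q by (meson add_mono)+
    ultimately have "cmod V \<le> (R + R) + (R + R)" using norm_triangle_le_diff by (metis add_mono)
    then show False using V by simp
  qed
qed

end

section \<open>Closed and escaping trajectories\<close>

lemma periodic_int_mult:
  fixes k :: int
  assumes "\<And>n. f (n + int q) = f n"
  shows "f (n + k * int q) = f n"
proof (induction k rule: int_induct[where k = 0])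
  case (step1 k)
  then show ?case using assms[of "n + k * int q"] by (simp add: algebra_simps)
next
  case (step2 k)
  then show ?case using assms[of "n + (k - 1) * int q"] by (simp add: algebra_simps)
qed simp

lemma periodic_repetition_square:
  assumes per: "\<And>n. w (n + int m) = w n" and "m > 0"
  defines "s \<equiv> map (\<lambda>i. w (int i)) [0..<m]"
  shows "w = periodic_repetition (s @ s)"
proof
  fix n :: int
  define r where "r = n mod int (2 * m)"
  have r: "0 \<le> r" "r < int (2 * m)" using \<open>m > 0\<close> by (simp_all add: r_def)
  have len: "length s = m" by (simp add: s_def)
  have per2: "w (k + int (2 * m)) = w k" for k
    using per[of "k + int m"] per[of k] by (simp add: add.assoc)
  have "w n = w (r + (n div int (2 * m)) * int (2 * m))" by (simp only: r_def mod_div_mult_eq)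
  also have "\<dots> = w r" by (rule periodic_int_mult) (rule per2)
  also have "\<dots> = (s @ s) ! nat r"
  proof (cases "nat r < m")
    case True
    then show ?thesis using r by (simp add: nth_append len) (simp add: s_def)
  next
    case False
    then have "nat r - m < m" using r by linarith
    moreover have "w r = w (int (nat r - m))"
      using per[of "r - int m"] False r by (simp add: of_nat_diff)
    ultimately show ?thesis using False r(1) by (simp add: nth_append len) (simp add: s_def)
  qed
  also have "length (s @ s) = 2 * m" by (simp add: len)
  then have "(s @ s) ! nat r = periodic_repetition (s @ s) n"
    by (simp only: periodic_repetition_def r_def)
  finally show "w n = periodic_repetition (s @ s) n" .
qed

lemma point_reflection_polyline:
  "point_reflection c ` polyline y = polyline (\<lambda>k. point_reflection c (y k))"
proof -
  have "point_reflection c ` closed_segment a b =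
      closed_segment (point_reflection c a) (point_reflection c b)" for a b
  proof -
    have "point_reflection c ((1 - t) *\<^sub>R a + t *\<^sub>R b) =
        (1 - t) *\<^sub>R point_reflection c a + t *\<^sub>R point_reflection c b" for t
      by (simp add: point_reflection_def scaleR_conv_of_real algebra_simps)
    then show ?thesis unfolding closed_segment_image_interval image_image by (simp only:)
  qed
  then show ?thesis by (simp add: polyline_def image_UN)
qed

lemma polyline_shift: "polyline (\<lambda>k. y (k + r)) = polyline y"
proof -
  have "(\<exists>k. p \<in> closed_segment (y (k + r)) (y (k + 1 + r))) \<longleftrightarrow>
      (\<exists>k. p \<in> closed_segment (y k) (y (k + 1)))" for p
  proof
    assume "\<exists>k. p \<in> closed_segment (y (k + r)) (y (k + 1 + r))"
    then obtain k where "p \<in> closed_segment (y (k + r)) (y (k + r + 1))" by (auto simp: ac_simps)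
    then show "\<exists>k. p \<in> closed_segment (y k) (y (k + 1))" by blast
  next
    assume "\<exists>k. p \<in> closed_segment (y k) (y (k + 1))"
    then obtain k where "p \<in> closed_segment (y (k - r + r)) (y (k - r + 1 + r))" by auto
    then show "\<exists>k. p \<in> closed_segment (y (k + r)) (y (k + 1 + r))" by blast
  qed
  then show ?thesis unfolding polyline_def by blast
qed

text \<open>The floor or ceiling of \<open>m * \<theta> + \<rho>\<close> counts the occurrences of
  \<open>True\<close> up to a constant, which gives bounded deviation from linear growth.\<close>

lemma sturmian_counting:
  assumes "sturmian \<sigma>"
  obtains \<theta> B :: real and F :: "int \<Rightarrow> int"
  where "\<And>m. F (m + 1) = F m + (if \<sigma> m then 1 else 0)" "\<And>m. \<bar>of_int (F m) - of_int m * \<theta>\<bar> \<le> B"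
proof -
  from assms obtain \<theta> \<rho> :: real where t: "0 < \<theta>" "\<theta> < 1" and
    s: "(\<forall>n. \<sigma> n \<longleftrightarrow> \<lfloor>of_int (n + 1) * \<theta> + \<rho>\<rfloor> - \<lfloor>of_int n * \<theta> + \<rho>\<rfloor> = 1) \<or>
      (\<forall>n. \<sigma> n \<longleftrightarrow> \<lceil>of_int (n + 1) * \<theta> + \<rho>\<rceil> - \<lceil>of_int n * \<theta> + \<rho>\<rceil> = 1)"
    unfolding sturmian_def by blast
  have Suc: "of_int (n + 1) * \<theta> + \<rho> = of_int n * \<theta> + \<rho> + \<theta>" for n :: int
    by (simp add: algebra_simps)
  from s show ?thesis
  proof
    assume s: "\<forall>n. \<sigma> n \<longleftrightarrow> \<lfloor>of_int (n + 1) * \<theta> + \<rho>\<rfloor> - \<lfloor>of_int n * \<theta> + \<rho>\<rfloor> = 1"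
    show ?thesis
    proof (rule that[of "\<lambda>m. \<lfloor>of_int m * \<theta> + \<rho>\<rfloor>" \<theta> "\<bar>\<rho>\<bar> + 1"])
      fix m :: int
      show "\<lfloor>of_int (m + 1) * \<theta> + \<rho>\<rfloor> = \<lfloor>of_int m * \<theta> + \<rho>\<rfloor> + (if \<sigma> m then 1 else 0)"
      proof -
        have "\<lfloor>y + \<theta>\<rfloor> - \<lfloor>y\<rfloor> = 0 \<or> \<lfloor>y + \<theta>\<rfloor> - \<lfloor>y\<rfloor> = 1" for y :: real using t by linarith
        from this[of "of_int m * \<theta> + \<rho>"] show ?thesis using s[rule_format, of m] unfolding Suc by auto
      qed
      show "\<bar>of_int \<lfloor>of_int m * \<theta> + \<rho>\<rfloor> - of_int m * \<theta>\<bar> \<le> \<bar>\<rho>\<bar> + 1" by linarith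
    qed
  next
    assume s: "\<forall>n. \<sigma> n \<longleftrightarrow> \<lceil>of_int (n + 1) * \<theta> + \<rho>\<rceil> - \<lceil>of_int n * \<theta> + \<rho>\<rceil> = 1"
    show ?thesis
    proof (rule that[of "\<lambda>m. \<lceil>of_int m * \<theta> + \<rho>\<rceil>" \<theta> "\<bar>\<rho>\<bar> + 1"])
      fix m :: int
      show "\<lceil>of_int (m + 1) * \<theta> + \<rho>\<rceil> = \<lceil>of_int m * \<theta> + \<rho>\<rceil> + (if \<sigma> m then 1 else 0)"
      proof -
        have "\<lceil>y + \<theta>\<rceil> - \<lceil>y\<rceil> = 0 \<or> \<lceil>y + \<theta>\<rceil> - \<lceil>y\<rceil> = 1" for y :: real using t by linarith
        from this[of "of_int m * \<theta> + \<rho>"] show ?thesis using s[rule_format, of m] unfolding Suc by auto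
      qed
      show "\<bar>of_int \<lceil>of_int m * \<theta> + \<rho>\<rceil> - of_int m * \<theta>\<bar> \<le> \<bar>\<rho>\<bar> + 1" by linarith
    qed
  qed
qed

section \<open>Periods of crossing points and of codings\<close>

context tiling_trajectory
begin

definition bary :: "(label \<Rightarrow> real) \<Rightarrow> complex" where
  "bary \<beta> = of_real (\<beta> LA) * d LA + of_real (\<beta> LB) * d LB + of_real (\<beta> LC) * d LC"

lemma bary_eq:
  assumes "\<beta> LA + \<beta> LB + \<beta> LC = 1"
  shows "bary \<beta> = d LA + of_real (\<beta> LB) * (d LB - d LA) + of_real (\<beta> LC) * (d LC - d LA)"
proof -
  have A: "\<beta> LA = 1 - \<beta> LB - \<beta> LC" using assms by simp
  show ?thesis unfolding bary_def A by (simp add: algebra_simps)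
qed

lemma bary_inject:
  assumes "bary \<beta> = bary \<gamma>" "\<beta> LA + \<beta> LB + \<beta> LC = 1" "\<gamma> LA + \<gamma> LB + \<gamma> LC = 1"
  shows "\<beta> j = \<gamma> j"
proof -
  have "of_real (\<beta> LB - \<gamma> LB) * (d LB - d LA) + of_real (\<beta> LC - \<gamma> LC) * (d LC - d LA) = 0"
    using assms(1) unfolding bary_eq[OF assms(2)] bary_eq[OF assms(3)] by (simp add: algebra_simps)
  from lattice_vec_eq_0[OF this] show ?thesis using assms(2,3) by (cases j) auto
qed

text \<open>At the two ends different coordinates vanish, so at the midpoint none does. An interior
  point tells tiles apart, which a crossing point does not.\<close>

lemma midpoint_bary:
  obtains \<beta> where "\<And>j. \<beta> j > 0" "\<beta> LA + \<beta> LB + \<beta> LC = 1"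
    "(x n + x (n + 1)) / 2 = ctr (n + 1) + e (n + 1) * bary \<beta>"
proof -
  obtain \<beta> where \<beta>: "\<beta> (w (n + 1)) = 0" "\<And>j. j \<noteq> w (n + 1) \<Longrightarrow> \<beta> j > 0" "\<beta> LA + \<beta> LB + \<beta> LC = 1"
    "x (n + 1) = ctr (n + 1) + e (n + 1) * bary \<beta>"
    by (rule x_exit_bary[of "n + 1", folded bary_def]) (rule that)
  obtain \<gamma> where \<gamma>: "\<gamma> (w n) = 0" "\<And>j. j \<noteq> w n \<Longrightarrow> \<gamma> j > 0" "\<gamma> LA + \<gamma> LB + \<gamma> LC = 1"
    "x n = ctr (n + 1) + e (n + 1) * bary \<gamma>"
    by (rule x_entry_bary[of n, folded bary_def]) (rule that)
  show ?thesis
  proof (rule that[of "\<lambda>j. (\<beta> j + \<gamma> j) / 2"])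
    fix j
    have "\<beta> j \<ge> 0" by (cases "j = w (n + 1)") (use \<beta>(1) \<beta>(2)[of j] in auto)
    moreover have "\<gamma> j \<ge> 0" by (cases "j = w n") (use \<gamma>(1) \<gamma>(2)[of j] in auto)
    moreover have "\<beta> j > 0 \<or> \<gamma> j > 0" using \<beta>(2)[of j] \<gamma>(2)[of j] w_Suc[of n] by auto
    ultimately show "(\<beta> j + \<gamma> j) / 2 > 0" by auto
  next
    have "(\<beta> LA + \<beta> LB + \<beta> LC) + (\<gamma> LA + \<gamma> LB + \<gamma> LC) = 2" using \<beta>(3) \<gamma>(3) by simp
    then show "(\<beta> LA + \<gamma> LA) / 2 + (\<beta> LB + \<gamma> LB) / 2 + (\<beta> LC + \<gamma> LC) / 2 = 1" by (simp add: field_simps)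
    have "bary (\<lambda>j. (\<beta> j + \<gamma> j) / 2) = (bary \<beta> + bary \<gamma>) / 2" by (simp add: bary_def field_simps)
    then show "(x n + x (n + 1)) / 2 = ctr (n + 1) + e (n + 1) * bary (\<lambda>j. (\<beta> j + \<gamma> j) / 2)"
      unfolding \<beta>(4) \<gamma>(4) by (simp only:) (simp add: field_simps)
  qed
qed

lemma odd_ctr:
  assumes "odd (n - m)"
  obtains p q where "ctr n = ctr m + e m * (2 * d LA + lattice_vec p q)"
proof -
  have "even (n - (m + 1))" using assms by simp
  then obtain p q where "ctr n = ctr (m + 1) + e (m + 1) * lattice_vec p q"
    using even_reaches unfolding reaches_def by blast
  then have "ctr n = ctr m + e m * (2 * d LA + lattice_vec
      (coordB (nxt (w m)) + coordB (nxt (nxt (w m))) - p) (coordC (nxt (w m)) + coordC (nxt (nxt (w m))) - q))"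
    unfolding ctr_Suc e_Suc lattice_vec_diff lattice_vec_add
    using d_lattice[of "nxt (w m)"] d_lattice[of "nxt (nxt (w m))"] by (simp add: algebra_simps)
  then show ?thesis by (rule that)
qed

text \<open>An odd period would place an interior point in tiles of both orientations. Adding its
  two sets of barycentric coordinates gives positive integers at \<open>LB\<close> and
  \<open>LC\<close>, while the total is 2 and the share of \<open>LA\<close> is positive.\<close>

lemma return_even:
  assumes per: "\<And>n. x (n + int p) = x n"
  shows "even p"
proof (rule ccontr)
  assume "odd p"
  obtain \<beta> where \<beta>: "\<And>j. \<beta> j > 0" "\<beta> LA + \<beta> LB + \<beta> LC = 1"
    "(x 0 + x 1) / 2 = ctr 1 + e 1 * bary \<beta>"
    using midpoint_bary[of 0] by auto
  obtain \<gamma> where \<gamma>: "\<And>j. \<gamma> j > 0" "\<gamma> LA + \<gamma> LB + \<gamma> LC = 1"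
    "(x (int p) + x (int p + 1)) / 2 = ctr (int p + 1) + e (int p + 1) * bary \<gamma>"
    by (rule midpoint_bary[of "int p"]) (rule that)
  have xp: "x (int p) = x 0" "x (int p + 1) = x 1" using per[of 0] per[of 1] by (simp_all add: add.commute)
  obtain P Q where PQ: "ctr (int p + 1) = ctr 1 + e 1 * (2 * d LA + lattice_vec P Q)"
    by (rule odd_ctr[of "int p + 1" 1]) (use \<open>odd p\<close> in simp)
  have ep: "e (int p + 1) = - e 1" using \<open>odd p\<close> by (simp add: e_def)
  have "ctr 1 + e 1 * bary \<beta> = ctr 1 + e 1 * (2 * d LA + lattice_vec P Q) + - e 1 * bary \<gamma>"
    by (rule trans[OF \<beta>(3)[symmetric] \<gamma>(3)[unfolded xp PQ ep]])
  then have "e 1 * bary \<beta> = e 1 * (2 * d LA + lattice_vec P Q - bary \<gamma>)"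
    by (simp add: algebra_simps)
  then have "bary \<beta> = 2 * d LA + lattice_vec P Q - bary \<gamma>"
    by (simp only: mult_cancel_left e_nonzero simp_thms)
  then have "bary \<beta> + bary \<gamma> = 2 * d LA + lattice_vec P Q" by (simp only: eq_diff_eq)
  then have "of_real (\<beta> LB + \<gamma> LB - P) * (d LB - d LA) + of_real (\<beta> LC + \<gamma> LC - Q) * (d LC - d LA) = 0"
    unfolding bary_eq[OF \<beta>(2)] bary_eq[OF \<gamma>(2)] lattice_vec_def by (simp add: algebra_simps)
  from lattice_vec_eq_0[OF this] have PQ': "\<beta> LB + \<gamma> LB = P" "\<beta> LC + \<gamma> LC = Q" by simp_all
  have "0 < real_of_int P" "0 < real_of_int Q" unfolding PQ'[symmetric] using \<beta>(1) \<gamma>(1) by (simp_all add: add_pos_pos)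
  moreover have "real_of_int P + real_of_int Q < 2"
    unfolding PQ'[symmetric] using \<beta>(1)[of LA] \<gamma>(1)[of LA] \<beta>(2) \<gamma>(2) by simp
  ultimately have "P \<ge> 1" "Q \<ge> 1" "P + Q < 2" by linarith+
  then show False by linarith
qed

lemma u_return:
  assumes per: "\<And>n. x (n + int p) = x n"
  shows "u (n + int p) = u n"
  using per[of n] per[of "n - 1"] by (simp add: u_def algebra_simps)

text \<open>The direction returns, so the tile does by \<open>same_tile_if_parallel\<close>; the
  exit side is then the only label whose coordinate vanishes at the crossing point.\<close>

lemma w_return:
  assumes per: "\<And>n. x (n + int p) = x n"
  shows "w (n + int p) = w n"
proof -
  have "even p" by (rule return_even) (rule per)
  then have c: "ctr (n + int p) = ctr n" and en: "e (n + int p) = e n"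
    using same_tile_if_parallel[of "n + int p" n] u_return[of p n, OF per] by (simp_all add: e_def)
  obtain \<beta> where \<beta>: "\<beta> (w n) = 0" "\<beta> LA + \<beta> LB + \<beta> LC = 1" "x n = ctr n + e n * bary \<beta>"
    by (rule x_exit_bary[of n, folded bary_def]) (rule that)
  obtain \<gamma> where \<gamma>: "\<And>j. j \<noteq> w (n + int p) \<Longrightarrow> \<gamma> j > 0" "\<gamma> LA + \<gamma> LB + \<gamma> LC = 1"
    "x (n + int p) = ctr (n + int p) + e (n + int p) * bary \<gamma>"
    by (rule x_exit_bary[of "n + int p", folded bary_def]) (rule that)
  have "bary \<beta> = bary \<gamma>" using \<beta>(3) \<gamma>(3) per[of n] unfolding c en by simp
  then have "\<gamma> (w n) = 0" using bary_inject[of \<beta> \<gamma> "w n"] \<beta> \<gamma>(2) by simp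
  then show ?thesis using \<gamma>(1)[of "w n"] by force
qed

text \<open>After an odd number of crossings the same letters move the circumcenters by opposite
  vectors, so the sum of the two circumcenters is constant.\<close>

lemma odd_coding_period_reflection:
  assumes per: "\<And>n. w (n + int N) = w n" and "odd N"
  shows "T (n + int N) j = (ctr (int N) + ctr 0) - T n j"
proof -
  have en: "e (n + int N) = - e n" for n using \<open>odd N\<close> by (simp add: e_def)
  have step: "ctr (n + 1 + int N) + ctr (n + 1) = ctr (n + int N) + ctr n" for n
    using ctr_Suc[of n] ctr_Suc[of "n + int N"] per[of n] en[of n] by (simp add: ac_simps)
  have "ctr (n + int N) + ctr n = ctr (int N) + ctr 0"
  proof (induction n rule: int_induct[where k = 0])
    case (step1 n)
    then show ?case using step[of n] by simp
  next
    case (step2 n)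
    then show ?case using step[of "n - 1"] by simp
  qed simp
  then have c: "ctr (n + int N) = ctr (int N) + ctr 0 - ctr n" by (simp only: eq_diff_eq)
  have "T (n + int N) j = ctr (n + int N) + e (n + int N) * d j" by (rule T_eq)
  also have "\<dots> = (ctr (int N) + ctr 0) - (ctr n + e n * d j)"
    by (simp only: c en) (simp add: algebra_simps)
  finally show ?thesis by (simp only: T_eq[of n])
qed

text \<open>Two reflections in the same point bring back the tile and with it the direction. The
  distance \<open>h\<close> then fixes the line, which meets the exit side in one point.\<close>

lemma odd_coding_period_return:
  assumes per: "\<And>n. w (n + int N) = w n" and "odd N"
  shows "x (n + int (2 * N)) = x n"
proof -
  define n' where "n' = n + int (2 * N)"
  have n': "n' = n + int N + int N" by (simp add: n'_def)
  have T: "T n' j = T n j" for j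
    unfolding n' odd_coding_period_reflection[OF per \<open>odd N\<close>, of "n + int N"]
      odd_coding_period_reflection[OF per \<open>odd N\<close>, of n] by simp
  then have c: "ctr n' = ctr n" unfolding ctr_def by (metis ext)
  have w: "w n' = w n" unfolding n' per ..
  have u: "u n' = u n" by (rule same_direction_if_same_tile[OF _ c]) (simp add: n'_def)
  have e: "e n' = e n" by (simp add: e_def n'_def)
  have s: "side n' = side n" by (simp add: side_def w e)
  obtain \<mu> where \<mu>: "T n (nxt (w n)) - x n = - of_real \<mu> * side n" by (rule g_exit)
  obtain \<mu>' where \<mu>': "T n' (nxt (w n')) - x n' = - of_real \<mu>' * side n'" by (rule g_exit)
  have diff: "x n' - x n = of_real (\<mu>' - \<mu>) * side n"
  proof -
    have "x n = T n (nxt (w n)) + of_real \<mu> * side n" using \<mu> by (simp add: algebra_simps)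
    moreover have "x n' = T n (nxt (w n)) + of_real \<mu>' * side n"
      using \<mu>' unfolding T w s by (simp add: algebra_simps)
    ultimately show ?thesis by (simp add: left_diff_distrib)
  qed
  have "h n' = h n" using h_const[of n'] h_const[of n] by simp
  then have "Im (cnj (u n) * (x n' - x n)) = 0" unfolding h_def u c by (simp add: algebra_simps)
  moreover have "Im (cnj (u n) * (x n' - x n)) = (\<mu>' - \<mu>) * Im (cnj (u n) * side n)"
    unfolding diff by (simp add: algebra_simps)
  ultimately have "\<mu>' - \<mu> = 0" using transversal_u[of n] by simp
  then show ?thesis using diff by (simp add: n'_def)
qed

lemma barycenter_reflect:
  assumes "\<And>j. P j = C - Q j"
  shows "barycenter P = C - barycenter Q"
  by (simp add: barycenter_def assms field_simps)

lemma centrally_symmetric: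
  assumes per: "\<And>n. w (n + int N) = w n" and "odd N"
  shows "orbit_centrally_symmetric T w"
proof -
  define C where "C = ctr (int N) + ctr 0"
  define b where "b n = barycenter (T n) - barycenter (T 0)" for n
  define c where "c = (C - 2 * barycenter (T 0)) / 2"
  obtain r where r: "N = 2 * r + 1" using \<open>odd N\<close> by (elim oddE)
  have c2: "2 * c = C - 2 * barycenter (T 0)" by (simp add: c_def)
  have refl: "point_reflection c (b n) = b (n + int N)" for n
  proof -
    have B: "barycenter (T (n + int N)) = C - barycenter (T n)"
      unfolding C_def by (rule barycenter_reflect, rule odd_coding_period_reflection[OF per \<open>odd N\<close>])
    show ?thesis unfolding point_reflection_def c2 b_def B by simp
  qed
  have "combinatorial_orbit (T 0) w = polyline (\<lambda>k. b (2 * k))"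
    unfolding combinatorial_orbit_def b_def
    by (rule arg_cong[of _ _ polyline], rule ext, rule break_point_eq_barycenter) (rule T_Suc)
  then have "point_reflection c ` combinatorial_orbit (T 0) w = polyline (\<lambda>k. b (2 * k + int N))"
    by (simp add: point_reflection_polyline refl)
  \<comment> \<open>The odd shift by \<open>N\<close> takes tiles of one orientation to those of the
    other.\<close>
  also have "(\<lambda>k. b (2 * k + int N)) = (\<lambda>k. b (2 * (k + int r) + 1))"
    by (simp add: r algebra_simps)
  also have "polyline \<dots> = negative_combinatorial_orbit T"
    unfolding negative_combinatorial_orbit_def
    using polyline_shift[of "\<lambda>k. b (2 * k + 1)" "int r"] by (simp add: b_def)
  finally have 1: "point_reflection c ` combinatorial_orbit (T 0) w = negative_combinatorial_orbit T" .
  have "full_combinatorial_orbit T = polyline b"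
    unfolding full_combinatorial_orbit_def b_def ..
  then have "point_reflection c ` full_combinatorial_orbit T = full_combinatorial_orbit T"
    by (simp add: point_reflection_polyline refl polyline_shift[of b])
  with 1 show ?thesis unfolding orbit_centrally_symmetric_def by blast
qed

text \<open>The minimal period \<open>p = 2 * m\<close> of the crossing points divides
  \<open>2 * N\<close>, so \<open>m\<close> divides \<open>N\<close> and is odd. As \<open>N\<close>
  is \<open>m\<close> plus a multiple of \<open>p\<close>, also \<open>m\<close> is a period of the
  coding.\<close>

lemma closed_conclusion:
  assumes per: "\<And>n. w (n + int N) = w n" and "odd N"
  shows "closed_trajectory x"
    "\<exists>s :: label list. odd (length s) \<and> w = periodic_repetition (s @ s) \<and> period x = length (s @ s)"
    "\<exists>n :: nat. n \<ge> 1 \<and> period x = 4 * n + 2"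
    "orbit_centrally_symmetric T w"
proof -
  have N: "0 < 2 * N \<and> (\<forall>n. x (n + int (2 * N)) = x n)"
    using odd_coding_period_return[OF per \<open>odd N\<close>] \<open>odd N\<close> by (auto intro: odd_pos)
  then show "closed_trajectory x" unfolding closed_trajectory_def by blast
  define p where "p = period x"
  have "0 < p \<and> (\<forall>n. x (n + int p) = x n)" unfolding p_def period_def using N by (rule LeastI)
  then have p: "p > 0" "\<And>n. x (n + int p) = x n" by auto
  have p_le: "p \<le> q" if "q > 0" "\<And>n. x (n + int q) = x n" for q
    unfolding p_def period_def using that by (intro Least_le) auto
  obtain m where m: "p = 2 * m" using return_even[OF p(2)] by blast
  have "p dvd 2 * N"
  proof (rule ccontr)
    assume "\<not> p dvd 2 * N"
    then have "0 < (2 * N) mod p" by (simp add: dvd_eq_mod_eq_0)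
    moreover have "x (n + int ((2 * N) mod p)) = x n" for n
    proof -
      have "int ((2 * N) mod p) + int ((2 * N) div p) * int p = int (2 * N)"
        unfolding of_nat_mult[symmetric] of_nat_add[symmetric] by simp
      then have "x (n + int (2 * N)) = x (n + int ((2 * N) mod p) + int ((2 * N) div p) * int p)"
        by (simp only: add.assoc)
      also have "\<dots> = x (n + int ((2 * N) mod p))" by (rule periodic_int_mult) (rule p(2))
      finally show ?thesis using N by simp
    qed
    ultimately have "p \<le> (2 * N) mod p" by (rule p_le)
    then show False using p(1) by (meson mod_less_divisor not_le)
  qed
  then have "m dvd N" by (simp add: m)
  then obtain r where r: "N = m * r" by blast
  then have "odd m" "odd r" using \<open>odd N\<close> by auto
  then obtain k where k: "r = 2 * k + 1" by (elim oddE)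
  have wm: "w (n + int m) = w n" for n
  proof -
    have "w (n + int m) = w (n + int m + int k * int p)"
      by (rule periodic_int_mult[symmetric]) (rule w_return[OF p(2)])
    also have "n + int m + int k * int p = n + int N" by (simp add: r k m algebra_simps)
    finally show ?thesis using per by simp
  qed
  have m0: "m > 0" using \<open>odd m\<close> by (rule odd_pos)
  show "\<exists>s :: label list. odd (length s) \<and> w = periodic_repetition (s @ s) \<and> period x = length (s @ s)"
    using periodic_repetition_square[of w m, OF wm m0] \<open>odd m\<close> m p_def
    by (intro exI[of _ "map (\<lambda>i. w (int i)) [0..<m]"]) simp
  \<comment> \<open>Consecutive letters differ, which excludes the period 2.\<close>
  have "m \<noteq> 1" using wm[of 0] w_Suc[of 0] by auto
  obtain i where i: "m = 2 * i + 1" using \<open>odd m\<close> by (elim oddE)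
  show "\<exists>n :: nat. n \<ge> 1 \<and> period x = 4 * n + 2"
    using i \<open>m \<noteq> 1\<close> m p_def by (intro exI[of _ i]) auto
  show "orbit_centrally_symmetric T w" by (rule centrally_symmetric[OF per \<open>odd N\<close>])
qed

lemma closed_finite_directions:
  assumes "closed_trajectory x"
  shows "finite (range u)"
proof -
  obtain p where p: "p > 0" "\<And>n. x (n + int p) = x n"
    using assms unfolding closed_trajectory_def by blast
  have "range u \<subseteq> u ` {0..<int p}"
  proof
    fix v assume "v \<in> range u"
    then obtain n where "v = u n" by blast
    also have "u n = u (n mod int p + (n div int p) * int p)" by simp
    also have "\<dots> = u (n mod int p)" by (rule periodic_int_mult) (rule u_return[OF p(2)])
    finally show "v \<in> u ` {0..<int p}" using p(1) by auto
  qed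
  then show ?thesis by (rule finite_subset) simp
qed

text \<open>An alternating sum, because the orientation sign flips at each crossing; normalized to a
  first tile with sign 1.\<close>

fun displacement :: "label list \<Rightarrow> complex" where
  "displacement [] = 0"
| "displacement (c # cs) = d (nxt c) + d (nxt (nxt c)) - displacement cs"

lemma ctr_displacement:
  assumes "\<forall>i < length \<omega>. w (q + int i) = \<omega> ! i"
  shows "ctr (q + int (length \<omega>)) = ctr q + e q * displacement \<omega>"
  using assms
proof (induction \<omega> arbitrary: q)
  case (Cons c cs)
  have "w q = c" using Cons.prems[rule_format, of 0] by simp
  then have c: "ctr (q + 1) = ctr q + e q * (d (nxt c) + d (nxt (nxt c)))" using ctr_Suc[of q] by simp
  have "\<forall>i < length cs. w (q + 1 + int i) = cs ! i"
    using Cons.prems[rule_format, of "Suc i" for i] by (simp add: ac_simps)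
  from Cons.IH[OF this] have IH: "ctr (q + 1 + int (length cs)) = ctr (q + 1) - e q * displacement cs" by simp
  have len: "q + int (length (c # cs)) = q + 1 + int (length cs)" by simp
  show ?case unfolding len IH c displacement.simps by (simp add: algebra_simps)
qed simp

lemma ctr_dist: "dist (ctr (n + int i)) (ctr n) \<le> real i * (2 * R)"
proof (induction i)
  case (Suc i)
  have "dist (ctr (n + int i + 1)) (ctr (n + int i)) \<le> cmod (d (nxt (w (n + int i))) + d (nxt (nxt (w (n + int i)))))"
    unfolding ctr_Suc by (simp add: dist_norm norm_mult)
  also have "\<dots> \<le> 2 * R" using norm_triangle_ineq cmod_d by (metis mult_2)
  finally have "dist (ctr (n + int i + 1)) (ctr n) \<le> 2 * R + real i * (2 * R)"
    using Suc dist_triangle[of "ctr (n + int i + 1)" "ctr n" "ctr (n + int i)"] by linarith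
  then show ?case by (simp add: algebra_simps)
qed simp

text \<open>
  The blocks have constant displacements because their lengths are even; the frequencies of the
  blocks in a Sturmian sequence deviate from linear growth by a bounded amount.
\<close>

lemma sturmian_bounded:
  assumes "sturmian \<sigma>" and even: "even (length \<omega>1)" "even (length \<omega>2)"
    and ne: "\<omega>1 \<noteq> []" "\<omega>2 \<noteq> []"
    and conc: "concat_at (\<lambda>m. if \<sigma> m then \<omega>2 else \<omega>1) pos w"
  shows "\<exists>L. affine L \<and> aff_dim L = 1 \<and> (\<exists>M. \<forall>z \<in> polyline x. infdist z L \<le> M)"
proof -
  define B where "B = (\<lambda>m. if \<sigma> m then \<omega>2 else \<omega>1)"
  have concB: "concat_at B pos w" and neB: "\<And>m. B m \<noteq> []" and evenB: "\<And>m. even (length (B m))"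
    using conc ne even by (auto simp: B_def)
  have e_pos: "e (pos m) = e (pos 0)" for m
  proof (induction m rule: int_induct[where k = 0])
    case (step1 m)
    then show ?case using concat_atD(1)[OF concB, of m] evenB[of m] by (simp add: e_def)
  next
    case (step2 m)
    then show ?case using concat_atD(1)[OF concB, of "m - 1"] evenB[of "m - 1"] by (simp add: e_def)
  qed simp
  define V1 V2 where "V1 = e (pos 0) * displacement \<omega>1" and "V2 = e (pos 0) * displacement \<omega>2"
  define Q where "Q m = ctr (pos m)" for m
  have Q_Suc: "Q (m + 1) = Q m + (if \<sigma> m then V2 else V1)" for m
    using ctr_displacement[of "B m" "pos m"] concat_atD[OF concB, where m = m] e_pos[of m]
    by (auto simp: Q_def V1_def V2_def B_def)
  obtain \<theta> K :: real and F :: "int \<Rightarrow> int" where F: "\<And>m. F (m + 1) = F m + (if \<sigma> m then 1 else 0)"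
    "\<And>m. \<bar>of_int (F m) - of_int m * \<theta>\<bar> \<le> K"
    by (rule sturmian_counting[OF assms(1)]) (rule that)
  have Q: "Q m = Q 0 + of_int m * V1 + of_int (F m - F 0) * (V2 - V1)" for m
  proof (induction m rule: int_induct[where k = 0])
    case (step1 m)
    then show ?case using Q_Suc[of m] F(1)[of m] by (cases "\<sigma> m") (auto simp: algebra_simps)
  next
    case (step2 m)
    then show ?case using Q_Suc[of "m - 1"] F(1)[of "m - 1"] by (cases "\<sigma> (m - 1)") (auto simp: algebra_simps)
  qed simp
  \<comment> \<open>The mean displacement per block. If it vanishes, any line through
    \<open>Q 0\<close> will do, and the direction 1 is taken.\<close>
  define W where "W = V1 + of_real \<theta> * (V2 - V1)"
  define W' where "W' = (if W = 0 then 1 else W)"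
  define L where "L = affine hull {Q 0, Q 0 + W'}"
  have L_in: "Q 0 + of_int m * W \<in> L" for m
  proof -
    define r where "r = (if W = 0 then 0 else real_of_int m)"
    have "Q 0 + of_int m * W = (1 - r) *\<^sub>R Q 0 + r *\<^sub>R (Q 0 + W')"
      by (simp add: r_def W'_def scaleR_conv_of_real algebra_simps)
    moreover have "1 - r + r = 1" by simp
    ultimately show ?thesis unfolding L_def affine_hull_2 by blast
  qed
  define M1 where "M1 = 2 * K * cmod (V2 - V1)"
  have dist_line: "dist (Q m) (Q 0 + of_int m * W) \<le> M1" for m
  proof -
    have "Q m - (Q 0 + of_int m * W) = of_real (of_int (F m) - of_int m * \<theta> - of_int (F 0)) * (V2 - V1)"
    proof -
      have "q + a * v + of_int (F m - F 0) * y - (q + a * (v + of_real \<theta> * y)) =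
          (of_int (F m) - a * of_real \<theta> - of_int (F 0)) * y" for q a v y :: complex
        by (simp add: algebra_simps)
      from this[of "Q 0" "of_int m" V1 "V2 - V1"] show ?thesis unfolding W_def Q[of m] by simp
    qed
    then have "dist (Q m) (Q 0 + of_int m * W) =
        \<bar>of_int (F m) - of_int m * \<theta> - of_int (F 0)\<bar> * cmod (V2 - V1)"
      unfolding dist_norm by (simp only: norm_mult norm_of_real)
    also have "\<dots> \<le> (2 * K) * cmod (V2 - V1)"
      using F(2)[of m] F(2)[of 0] by (intro mult_right_mono) auto
    finally show ?thesis by (simp add: M1_def)
  qed
  define lmax where "lmax = max (length \<omega>1) (length \<omega>2)"
  \<comment> \<open>The summands bound the distance inside a tile, inside a block, and from the
    block start to the line.\<close>
  have "infdist z L \<le> R + real lmax * (2 * R) + M1" if z: "z \<in> polyline x" for z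
  proof -
    obtain n where "z \<in> closed_segment (x n) (x (n + 1))" using z unfolding polyline_def by blast
    then have 1: "dist z (ctr (n + 1)) \<le> R" using segment_in_cball[of n] by (auto simp: dist_commute)
    obtain m i where mi: "n + 1 = pos m + int i" "i < length (B m)"
      by (rule concat_at_cover[OF concB]) (rule neB)
    have "i \<le> lmax" using mi(2) by (auto simp: B_def lmax_def split: if_splits)
    then have "real i * (2 * R) \<le> real lmax * (2 * R)" using R_pos by (intro mult_right_mono) auto
    then have 2: "dist (ctr (n + 1)) (Q m) \<le> real lmax * (2 * R)"
      using ctr_dist[of "pos m" i] mi(1) by (simp add: Q_def)
    have "infdist z L \<le> dist z (Q 0 + of_int m * W)" by (rule infdist_le[OF L_in])
    also have "\<dots> \<le> R + real lmax * (2 * R) + M1"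
      using 1 2 dist_line[of m] dist_triangle[of z "Q 0 + of_int m * W" "Q m"]
        dist_triangle[of z "Q m" "ctr (n + 1)"] by linarith
    finally show ?thesis .
  qed
  moreover have "aff_dim L = 1" "affine L" by (simp_all add: L_def W'_def aff_dim_2)
  ultimately show ?thesis by blast
qed

text \<open>Each case of \<open>outcome\<close> makes one of the two implications vacuous: an odd
  period closes the trajectory, and in the Sturmian case a closed trajectory would have finitely
  many directions, against the injectivity of \<open>Y\<close> along the blocks.\<close>

lemma closed_or_escaping:
  assumes avoids: "avoids_circumcenters T x"
  shows "(closed_trajectory x \<longrightarrow>
        (\<exists>s :: label list. odd (length s) \<and> w = periodic_repetition (s @ s)
            \<and> period x = length (s @ s))
        \<and> (\<exists>n :: nat. n \<ge> 1 \<and> period x = 4 * n + 2)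
        \<and> orbit_centrally_symmetric T w)
    \<and> (\<not> closed_trajectory x \<longrightarrow>
        linearly_escaping x
        \<and> (\<exists>(\<omega>1 :: label list) \<omega>2 \<sigma>.
              \<omega>1 \<noteq> [] \<and> \<omega>2 \<noteq> [] \<and> \<omega>1 \<noteq> \<omega>2 \<and> sturmian \<sigma>
              \<and> is_concatenation (\<lambda>m. if \<sigma> m then \<omega>2 else \<omega>1) w))"
proof -
  obtain Y where Y: "outcome Y w" "finite (range u) \<Longrightarrow> finite (range Y)"
    by (rule trajectory_outcome[OF avoids]) (rule that)
  from Y(1) consider
    (per) N :: nat where "odd N" "\<And>n. w (n + int N) = w n" |
    (st) \<sigma> \<omega>1 \<omega>2 pos where "sturmian \<sigma>" "even (length \<omega>1)" "even (length \<omega>2)"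
        "\<omega>1 \<noteq> []" "\<omega>2 \<noteq> []" "\<omega>1 \<noteq> \<omega>2"
        "concat_at (\<lambda>m. if \<sigma> m then \<omega>2 else \<omega>1) pos w" "inj (\<lambda>m. Y (pos m))"
    unfolding outcome_def by metis
  then show ?thesis
  proof cases
    case per
    then show ?thesis using closed_conclusion[of N] by blast
  next
    case st
    have not_closed: "\<not> closed_trajectory x"
    proof
      assume "closed_trajectory x"
      then have "finite (range Y)" using Y(2) closed_finite_directions by blast
      then have "finite (range (\<lambda>m. Y (pos m)))" by (rule finite_subset[rotated]) blast
      then have "finite (UNIV :: int set)" using st(8) by (rule finite_imageD)
      then show False by simp
    qed
    have "linearly_escaping x"
      unfolding linearly_escaping_def escaping_def
      using not_closed not_drift_periodic sturmian_bounded[OF st(1-5) st(7)] by blast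
    moreover have "is_concatenation (\<lambda>m. if \<sigma> m then \<omega>2 else \<omega>1) w"
      using st(7) unfolding concat_at_def is_concatenation_def by blast
    ultimately show ?thesis using st(1,4-6) not_closed by blast
  qed
qed

end

theorem proposition13:
  fixes D :: tile
    and T :: "int \<Rightarrow> tile"
    and w :: "int \<Rightarrow> label"
    and x :: "int \<Rightarrow> complex"
  assumes "nondegenerate D"
    and "lin_indep_over_rat (\<lambda>j. tile_angle D j / pi)"
    and "trajectory D T w x"
    and "avoids_circumcenters T x"
  shows "\<not> drift_periodic x
    \<and> (closed_trajectory x \<longrightarrow>
        (\<exists>s :: label list. odd (length s) \<and> w = periodic_repetition (s @ s)
            \<and> period x = length (s @ s))
        \<and> (\<exists>n :: nat. n \<ge> 1 \<and> period x = 4 * n + 2)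
        \<and> orbit_centrally_symmetric T w)
    \<and> (\<not> closed_trajectory x \<longrightarrow>
        linearly_escaping x
        \<and> (\<exists>(\<omega>1 :: label list) \<omega>2 \<sigma>.
              \<omega>1 \<noteq> [] \<and> \<omega>2 \<noteq> [] \<and> \<omega>1 \<noteq> \<omega>2 \<and> sturmian \<sigma>
              \<and> is_concatenation (\<lambda>m. if \<sigma> m then \<omega>2 else \<omega>1) w))"
proof -
  interpret tiling_trajectory D T w x
    using assms(1-3) by unfold_locales
  show ?thesis using not_drift_periodic closed_or_escaping[OF assms(4)] by blast
qed

end
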